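(* Let $p\equiv 5\pmod{8}$ and $m\ge 4$. Then $P_{2^m}^*(X)$ has a unique decomposition into irreducible polynomials over the rationals as follows: \begin{itemize} \item[\rm (a)] if $2^m\mid s$, then \begin{align*} P_{2^m}^*(X)=\,& (X-q^{\frac 12}+2D_2 q^{\frac 14})^{2^{m-2}} (X-q^{\frac 12}-2D_2 q^{\frac 14})^{2^{m-2}}\\ &\times\Bigl(X+q^{\frac 12}+\sum_{r=2}^{m-1}2^{r-1}C_r q^{\frac{2^{r-1}-1}{2^r}}-2^{m-1}C_m q^{\frac{2^{m-1}-1}{2^m}}\Bigr)\\ &\times\Bigl(X+q^{\frac 12}+\sum_{r=2}^m 2^{r-1}C_r q^{\frac{2^{r-1}-1}{2^r}}\Bigr)\prod_{t=1}^{m-2}R_t(X)^{2^{m-t-2}}; \end{align*} \item[\rm (b)] if $2^{m-1}\parallel s$, then \begin{align*} P_{2^m}^*(X)=\,& (X-q^{\frac 12}+2D_2 q^{\frac 14})^{2^{m-2}} (X-q^{\frac 12}-2D_2 q^{\frac 14})^{2^{m-2}}\\ &\times\left(\Bigl(X+q^{\frac 12}+\sum_{r=2}^{m-1}2^{r-1}C_r q^{\frac{2^{r-1}-1}{2^r}}\Bigl)^2 -2^{2(m-1)}C_m^2 q^{\frac{2^{m-1}-1}{2^{m-1}}}\right)\\ &\times\Biggl(\Bigl(X+q^{\frac 12}+\sum_{r=2}^{m-2}2^{r-1}C_r q^{\frac{2^{r-1}-1}{2^r}}-2^{m-2}C_{m-1}q^{\frac{2^{m-2}-1}{2^{m-1}}}\Bigr)^2\Biggr.\\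 & -\Biggl.2^{2(m-1)}D_m^2 q^{\frac{2^{m-1}-1}{2^{m-1}}}\Biggr)\prod_{t=1}^{m-3}R_t(X)^{2^{m-t-2}}; \end{align*} \item[\rm (c)] if $2^{m-2}\parallel s$, then \begin{align*} P_{2^m}^*(X)=\,& (X-q^{\frac 12}+2D_2 q^{\frac 14})^{2^{m-2}} (X-q^{\frac 12}-2D_2 q^{\frac 14})^{2^{m-2}}\\ &\times\biggl(\Bigl(X+q^{\frac 12}+\sum_{r=2}^{m-3}2^{r-1}C_r q^{\frac{2^{r-1}-1}{2^r}}-2^{m-3}C_{m-2}q^{\frac{2^{m-3}-1}{2^{m-2}}}\Bigr)^2\biggr.\\ &-\biggl.2^{2(m-2)}D_{m-1}^2 q^{\frac{2^{m-2}-1}{2^{m-2}}}\biggr)^2\\ &\times\Biggl(\biggl(\Bigl(X+q^{\frac 12}+\sum_{r=2}^{m-2}2^{r-1}C_r q^{\frac{2^{r-1}-1}{2^r}}\Bigr)^2+2^{2(m-2)}C_{m-1}^2 q^{\frac{2^{m-2}-1}{2^{m-2}}}+2^{2m-3}q\biggr)^2\Biggr.\\ & -2^{2(m-1)}C_{m-1}^2 q^{\frac{2^{m-2}-1}{2^{m-2}}}\Biggl.\Bigl(X+(2^{m-2}+1)q^{\frac 12}+\sum_{r=2}^{m-2}2^{r-1}C_r q^{\frac{2^{r-1}-1}{2^r}}\Bigr)^2\Biggr)\\ &\times\prod_{t=1}^{m-4}R_t(X)^{2^{m-t-2}}. \end{align*} \end{itemize} The integers $C_r$ and $|D_r|$ are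 uniquely determined by $p^{s/2^{r-1}}=C_r^2+D_r^2$, $C_r\equiv 1\pmod 4$, $p\nmid C_r$, and \begin{align*} R_t(X)=\,&\Bigl(X+q^{\frac 12}+\sum_{r=2}^t 2^{r-1}C_r q^{\frac{2^{r-1}-1}{2^r}}-2^t C_{t+1} q^{\frac{2^t-1}{2^{t+1}}}+2^{t+1} D_{t+2} q^{\frac{2^{t+1}-1}{2^{t+2}}}\Bigr)\\ &\times\Bigl(X+q^{\frac 12}+\sum_{r=2}^t 2^{r-1}C_r q^{\frac{2^{r-1}-1}{2^r}}-2^t C_{t+1} q^{\frac{2^t-1}{2^{t+1}}}-2^{t+1} D_{t+2} q^{\frac{2^{t+1}-1}{2^{t+2}}}\Bigr). \end{align*}
   Context: Let $\mathbb F_q$ be a finite field of characteristic $p$ with $q=p^s$ elements, $p\equiv 5\pmod 8$, $\gamma$ a fixed generator of $\mathbb F_q^*$, and $\mathrm{Tr}:\mathbb F_q\to\mathbb F_p$ the trace. Let $e=2^m$ with $2^m\mid(q-1)$ (so $2^{m-2}\mid s$). The reduced cyclotomic periods of order $e$ are $\eta_k^*=\sum_{x\in\mathbb F_q}\zeta_p^{\mathrm{Tr}(\gamma^k x^e)}$, $k=0,\dots,e-1$, with $\zeta_p=\exp(2\pi i/p)$, and the reduced period polynomial is $P_e^*(X)=\prod_{k=0}^{e-1}(X-\eta_k^* )$. For $2\le r\le m-1$ (and also $r=m$ when $2^{m-1}\mid s$), the integers $C_r,D_r$ are defined by $p^{s/2^{r-1}}=C_r^2+D_r^2$, $C_r\equiv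 1\pmod 4$, $p\nmid C_r$, and $D_r\gamma^{(q-1)/4}\equiv C_r\pmod p$; these conditions determine $C_r,D_r$ uniquely. *)

theory Defs
  imports
    "HOL-Computational_Algebra.Computational_Algebra"
    "HOL-Number_Theory.Number_Theory"
    "HOL-Library.Cardinality"
begin

definition generates_units :: "'a::{field,finite} \<Rightarrow> bool" where
  "generates_units g \<longleftrightarrow> range (\<lambda>k::nat. g ^ k) = UNIV - {0}"

text \<open>
  The trace of a field with \<open>p ^ s\<close> elements down to its prime field, where \<open>p\<close> is the
  characteristic. Its values are of the form \<open>of_nat k\<close>; \<open>prime_field_rep\<close> selects the
  representative \<open>k < p\<close>, which serves as the exponent of the \<open>p\<close>-th root of unity.
\<close>

definition field_trace :: "nat \<Rightarrow> 'a::{field,finite} \<Rightarrow> 'a" where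
  "field_trace s x = (\<Sum>i<s. x ^ (CHAR('a) ^ i))"

definition prime_field_rep :: "'a::{field,finite} \<Rightarrow> nat" where
  "prime_field_rep x = (THE k. k < CHAR('a) \<and> of_nat k = x)"

definition root_of_unity :: "nat \<Rightarrow> complex" where
  "root_of_unity p = exp (2 * of_real pi * \<i> / of_nat p)"

definition reduced_period :: "nat \<Rightarrow> 'a::{field,finite} \<Rightarrow> nat \<Rightarrow> nat \<Rightarrow> complex" where
  "reduced_period s g e k =
     (\<Sum>x\<in>UNIV. root_of_unity CHAR('a) ^ prime_field_rep (field_trace s (g ^ k * x ^ e)))"

definition reduced_period_poly :: "nat \<Rightarrow> 'a::{field,finite} \<Rightarrow> nat \<Rightarrow> complex poly" where
  "reduced_period_poly s g e = (\<Prod>k<e. [:- reduced_period s g e k, 1:])"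

text \<open>
  The conditions on \<open>(C\<^sub>r, D\<^sub>r)\<close> that do not involve the generator; they fix \<open>D\<^sub>r\<close> only up to
  sign. They are meant for \<open>r\<close> with \<open>2 ^ (r - 1) dvd s\<close>, when the division below is exact.
\<close>

definition two_squares_rep :: "nat \<Rightarrow> nat \<Rightarrow> nat \<Rightarrow> int \<Rightarrow> int \<Rightarrow> bool" where
  "two_squares_rep p s r c d \<longleftrightarrow>
     int p ^ (s div 2 ^ (r - 1)) = c\<^sup>2 + d\<^sup>2 \<and> [c = 1] (mod 4) \<and> \<not> int p dvd c"

text \<open>The congruence modulo \<open>p\<close> that fixes the sign of \<open>D\<^sub>r\<close> is an equation in the finite field.\<close>

definition signed_two_squares_rep ::
    "nat \<Rightarrow> 'a::{field,finite} \<Rightarrow> nat \<Rightarrow> int \<Rightarrow> int \<Rightarrow> bool" where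
  "signed_two_squares_rep s g r c d \<longleftrightarrow>
     two_squares_rep CHAR('a) s r c d \<and>
     of_int d * g ^ ((CARD('a) - 1) div 4) = of_int c"

definition CD_pair :: "nat \<Rightarrow> 'a::{field,finite} \<Rightarrow> nat \<Rightarrow> int \<times> int" where
  "CD_pair s g r = (THE (c, d). signed_two_squares_rep s g r c d)"

text \<open>
  \<open>qpow p s a b\<close> is the rational number \<open>q powr (a / b)\<close> for \<open>q = p ^ s\<close>. It is used only when
  \<open>b dvd s * a\<close>; the lemma states that it is then the real power.
\<close>

definition qpow :: "nat \<Rightarrow> nat \<Rightarrow> nat \<Rightarrow> nat \<Rightarrow> rat" where
  "qpow p s a b = of_nat p ^ (s * a div b)"

lemma qpow_eq_powr:
  assumes "p > 0" "b > 0" "b dvd s * a"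
  shows "of_rat (qpow p s a b) = real (p ^ s) powr (real a / real b)"
proof -
  obtain k where k: "s * a = b * k"
    using assms(3) by (elim dvdE)
  have "real s * (real a / real b) = real k"
    using k assms(2) by (simp add: field_simps flip: of_nat_mult)
  moreover have "real (p ^ s) powr (real a / real b) = real p powr (real s * (real a / real b))"
    using assms(1) by (simp add: powr_powr flip: powr_realpow)
  ultimately show ?thesis
    using assms k by (simp add: qpow_def of_rat_power powr_realpow)
qed

definition S_sum :: "nat \<Rightarrow> nat \<Rightarrow> (nat \<Rightarrow> int) \<Rightarrow> nat \<Rightarrow> rat" where
  "S_sum p s C n = (\<Sum>r=2..n. 2 ^ (r - 1) * of_int (C r) * qpow p s (2 ^ (r - 1) - 1) (2 ^ r))"

text \<open>The two linear factors whose product is \<open>R\<^sub>t\<close>.\<close>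

definition R_factors ::
    "nat \<Rightarrow> nat \<Rightarrow> (nat \<Rightarrow> int) \<Rightarrow> (nat \<Rightarrow> int) \<Rightarrow> nat \<Rightarrow> rat poly multiset" where
  "R_factors p s C D t =
     {# [: qpow p s 1 2 + S_sum p s C t
           - 2 ^ t * of_int (C (t + 1)) * qpow p s (2 ^ t - 1) (2 ^ (t + 1))
           + 2 ^ (t + 1) * of_int (D (t + 2)) * qpow p s (2 ^ (t + 1) - 1) (2 ^ (t + 2)), 1 :],
        [: qpow p s 1 2 + S_sum p s C t
           - 2 ^ t * of_int (C (t + 1)) * qpow p s (2 ^ t - 1) (2 ^ (t + 1))
           - 2 ^ (t + 1) * of_int (D (t + 2)) * qpow p s (2 ^ (t + 1) - 1) (2 ^ (t + 2)), 1 :] #}"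

text \<open>
  Decomposition of a complex polynomial into monic rational irreducibles, counted with
  multiplicity; a multiset makes uniqueness independent of the order of the factors.
\<close>

definition irreducible_decomposition :: "complex poly \<Rightarrow> rat poly multiset \<Rightarrow> bool" where
  "irreducible_decomposition P M \<longleftrightarrow>
     P = map_poly of_rat (\<Prod>\<^sub># M) \<and> (\<forall>f\<in>#M. irreducible f \<and> lead_coeff f = 1)"

definition unique_irreducible_decomposition :: "complex poly \<Rightarrow> rat poly multiset \<Rightarrow> bool" where
  "unique_irreducible_decomposition P M \<longleftrightarrow>
     irreducible_decomposition P M \<and> (\<forall>N. irreducible_decomposition P N \<longrightarrow> N = M)"

end

theory Submission
  imports Defs "HOL-Computational_Algebra.Field_as_Ring"
begin

text \<open>
  A period of order \<open>2 ^ m\<close> is a linear combination of the Gauss sums of the characters of order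
  \<open>2 ^ r\<close>, \<open>r \<le> m\<close>. As \<open>p\<close> generates the group of residues \<open>1\<close> modulo \<open>4\<close> modulo \<open>2 ^ r\<close>, the
  Frobenius leaves only one Gauss sum \<open>G r\<close> and its conjugate for each \<open>r\<close>. The duplication formula
  becomes \<open>(G r)\<^sup>2 = G 1 * G (r - 1)\<close> up to sign for \<open>r \<ge> 3\<close>, where \<open>G 1 = - p ^ (s div 2)\<close>. Starting
  from a quartic Jacobi sum, which is a Gaussian integer not divisible by \<open>p\<close>, one extracts square
  roots in the Gaussian integers to obtain \<open>G r\<close> up to sign. The sign follows from the period at
  \<open>0\<close> modulo \<open>2 ^ (r + 1)\<close>. Irreducibility of the nonlinear factors comes from the irrationality of
  \<open>sqrt p\<close>.
\<close>

subsection \<open>Sums of two squares and powers of two\<close>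

text \<open>Let \<open>v\<close> be the exact exponent of 2 in \<open>s\<close>. As \<open>p\<close>
  is 5 modulo 8, exactly \<open>2 ^ (v + 2)\<close> divides \<open>q - 1\<close>, so the cases of
  the theorem are \<open>m <= v\<close>, \<open>m = v + 1\<close> and \<open>m = v + 2\<close>. The
  obstacle is that the descent stops at the top. Up to \<open>r = v\<close> the number
  \<open>radix r\<close> is an integer and the sign can be read off a congruence. At
  \<open>r = v + 1\<close> it is an odd power of \<open>sqrt p\<close> and the sign stays
  undetermined, which is harmless because the rational factors contain only the square of that term.
  At \<open>r = v + 2\<close> no Gaussian square root is left to take and the character is odd; the
  relation for the square of \<open>G r\<close> and its absolute value still determine the squares
  of its real and imaginary part. The Jacobi sum in the duplication formula pairs
  \<open>zt r\<close> with the quadratic character. Twisting by that character replaces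
  \<open>zt r\<close> by its power with exponent \<open>2 ^ (r - 1) + 1\<close>, which is 1 modulo 4
  for \<open>r >= 3\<close>, so that Frobenius cancels the Gauss sums. At \<open>r = 2\<close> this
  fails, and the quartic Jacobi sum has to be analysed directly.\<close>

lemma pow_cong_1_mod_2_power:
  fixes p :: int
  assumes "[p = 1] (mod 4)" "2 ^ j dvd n"
  shows "[p ^ n = 1] (mod 2 ^ (j + 2))"
proof -
  have *: "[p ^ (2 ^ j) = 1] (mod 2 ^ (j + 2))"
  proof (induction j)
    case 0
    then show ?case using assms(1) by simp
  next
    case (Suc j)
    obtain k where k: "p ^ 2 ^ j = 1 + 2 ^ (j + 2) * k"
      using Suc by (metis cong_iff_lin cong_sym)
    have "p ^ 2 ^ Suc j = (p ^ 2 ^ j) ^ 2"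
      by (simp add: power_mult [symmetric] mult.commute)
    also have "\<dots> = 1 + 2 ^ (Suc j + 2) * (k + 2 ^ (j + 1) * k\<^sup>2)"
      unfolding k by (simp add: power2_eq_square algebra_simps)
    finally have "2 ^ (Suc j + 2) dvd p ^ 2 ^ Suc j - 1"
      by simp
    then show ?case by (simp only: cong_iff_dvd_diff)
  qed
  obtain l where "n = 2 ^ j * l" using assms(2) by blast
  then have "p ^ n = (p ^ 2 ^ j) ^ l" by (simp add: power_mult)
  then show ?thesis using cong_pow[OF *, of l] by simp
qed

text \<open>A number that is 5 modulo 8 exceeds 1 by exactly two factors of 2, and squaring
  \<open>1 + 2 ^ (j + 2) * u\<close> with \<open>u\<close> odd adds exactly one more.\<close>

lemma two_power_exact_dvd_pow_diff_1:
  fixes p :: nat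
  assumes "[p = 5] (mod 8)"
  shows "\<exists>u. odd u \<and> p ^ 2 ^ j = 1 + 2 ^ (j + 2) * u"
proof (induction j)
  case 0
  have "p mod 8 = 5" using assms by (simp add: cong_def)
  then have "p = 1 + 4 * (1 + 2 * (p div 8))" by presburger
  then show ?case by (intro exI[of _ "1 + 2 * (p div 8)"]) simp
next
  case (Suc j)
  then obtain u where u: "odd u" "p ^ 2 ^ j = 1 + 2 ^ (j + 2) * u" by blast
  have "p ^ 2 ^ Suc j = (p ^ 2 ^ j) ^ 2"
    by (simp add: power_mult [symmetric] mult.commute)
  also have "\<dots> = 1 + 2 ^ (Suc j + 2) * (u + 2 ^ (j + 1) * u\<^sup>2)"
    unfolding u(2) by (simp add: power2_eq_square algebra_simps)
  finally show ?case using u(1) by (intro exI[of _ "u + 2 ^ (j + 1) * u\<^sup>2"]) simp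
qed

text \<open>An exponent that works modulo \<open>2 ^ (n + 2)\<close> but misses by an odd multiple
  of that modulus is repaired by adding \<open>2 ^ n\<close>, since \<open>p ^ 2 ^ n - 1\<close> is
  an odd multiple of it too.\<close>

lemma cong_power_of_1_mod_4:
  fixes p :: nat
  assumes "[p = 5] (mod 8)" "[j = 1] (mod 4)"
  shows "\<exists>i. [p ^ i = j] (mod 2 ^ (n + 2))"
proof (induction n)
  case 0
  then show ?case using assms(2) by (intro exI[of _ 0]) (auto simp: cong_sym)
next
  case (Suc n)
  then obtain i where i: "[p ^ i = j] (mod 2 ^ (n + 2))" by blast
  obtain u where u: "odd u" "p ^ 2 ^ n = 1 + 2 ^ (n + 2) * u"
    using two_power_exact_dvd_pow_diff_1[OF assms(1)] by blast
  have "odd p" using assms(1) by (simp add: cong_def) presburger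
  then have odd: "odd (p ^ i * u)" using u(1) by simp
  then obtain w where w: "p ^ i * u = 2 * w + 1" by (elim oddE)
  have "int (2 ^ (n + 2)) dvd int (p ^ i) - int j"
    using i by (simp only: cong_iff_dvd_diff flip: cong_int_iff)
  then obtain k where k: "int (p ^ i) - int j = 2 ^ (n + 2) * k"
    by (auto elim!: dvdE)
  show ?case
  proof (cases "even k")
    case True
    then have "2 ^ (Suc n + 2) dvd int (p ^ i) - int j"
      unfolding k by (auto elim!: evenE)
    then have "[int (p ^ i) = int j] (mod int (2 ^ (Suc n + 2)))"
      by (simp add: cong_iff_dvd_diff)
    then show ?thesis using cong_int_iff by blast
  next
    case False
    then obtain l where l: "k = 2 * l + 1" by (elim oddE)
    have "int (p ^ (i + 2 ^ n)) - int j = int (p ^ i) - int j + 2 ^ (n + 2) * int (p ^ i * u)"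
      by (simp add: power_add u(2) algebra_simps)
    also have "\<dots> = 2 ^ (Suc n + 2) * (l + int w + 1)"
      unfolding k w l by (simp add: algebra_simps)
    finally have "2 ^ (Suc n + 2) dvd int (p ^ (i + 2 ^ n)) - int j" by simp
    then have "[int (p ^ (i + 2 ^ n)) = int j] (mod int (2 ^ (Suc n + 2)))"
      by (simp add: cong_iff_dvd_diff)
    then show ?thesis using cong_int_iff by blast
  qed
qed

text \<open>\<open>p ^ k\<close> divides \<open>(a * d - b * c) * (a * d + b * c)\<close> and
  \<open>p\<close> cannot divide both factors, so \<open>p ^ k\<close> divides one of them. By the
  Brahmagupta identity that factor is smaller than \<open>p ^ k\<close> in absolute value, the
  complementary form being odd and hence nonzero; so it vanishes.\<close>

lemma two_squares_unique:
  fixes a b c d p :: int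
  assumes p: "prime p" "odd p" and "odd a" "odd c" "\<not> p dvd a" "\<not> p dvd c"
    and ab: "a\<^sup>2 + b\<^sup>2 = p ^ k" and cd: "c\<^sup>2 + d\<^sup>2 = p ^ k" and "k > 0"
  shows "\<bar>a\<bar> = \<bar>c\<bar> \<and> \<bar>b\<bar> = \<bar>d\<bar>"
proof -
  \<comment> \<open>\<open>d\<close> is generalised here so that the other factor can be treated
    with \<open>- d\<close>.\<close>
  have main: "a\<^sup>2 = c\<^sup>2" if "p ^ k dvd a * d - b * c" "c\<^sup>2 + d\<^sup>2 = p ^ k" for d
  proof -
    have "odd (p ^ k)" using p(2) by simp
    then have "odd (a\<^sup>2 + b\<^sup>2)" "odd (c\<^sup>2 + d\<^sup>2)" using ab that(2) by metis+
    then have ev: "even b" "even d" using \<open>odd a\<close> \<open>odd c\<close> by simp_all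
    have eq: "(a * d - b * c)\<^sup>2 + (a * c + b * d)\<^sup>2 = (p ^ k)\<^sup>2"
    proof -
      have "(a * d - b * c)\<^sup>2 + (a * c + b * d)\<^sup>2 = (a\<^sup>2 + b\<^sup>2) * (c\<^sup>2 + d\<^sup>2)"
        by (simp add: power2_eq_square algebra_simps)
      then show ?thesis using ab that(2) by (simp add: power2_eq_square)
    qed
    have odd: "odd (a * c + b * d)" using ev \<open>odd a\<close> \<open>odd c\<close> by (metis even_add even_mult_iff)
    then have ne: "a * c + b * d \<noteq> 0" by (metis even_zero)
    have "a * d - b * c = 0"
    proof (rule ccontr)
      assume "a * d - b * c \<noteq> 0"
      then have "p ^ k \<le> \<bar>a * d - b * c\<bar>"
        using that(1) by (metis dvd_imp_le_int abs_ge_self order_trans)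
      moreover have "p ^ k > 0" using p(1) by (simp add: prime_gt_0_int)
      ultimately have "(p ^ k)\<^sup>2 \<le> \<bar>a * d - b * c\<bar>\<^sup>2"
        by (intro power_mono) auto
      then have "(a * c + b * d)\<^sup>2 \<le> 0" using eq unfolding power2_abs by linarith
      then show False using ne by simp
    qed
    then have "a * d = b * c" by simp
    then have "a\<^sup>2 * d\<^sup>2 = b\<^sup>2 * c\<^sup>2" by (metis power_mult_distrib)
    then have "a\<^sup>2 * (c\<^sup>2 + d\<^sup>2) = c\<^sup>2 * (a\<^sup>2 + b\<^sup>2)" by (simp add: algebra_simps)
    then show ?thesis using ab that(2) p(1) by (simp add: prime_gt_0_int)
  qed
  have "a\<^sup>2 = c\<^sup>2"
  proof -
    have prod: "(a * d - b * c) * (a * d - b * (- c)) = p ^ k * (a\<^sup>2 - c\<^sup>2)"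
    proof -
      have "d\<^sup>2 = p ^ k - c\<^sup>2" "b\<^sup>2 = p ^ k - a\<^sup>2" using ab cd by simp_all
      moreover have "(a * d - b * c) * (a * d - b * (- c)) = a\<^sup>2 * d\<^sup>2 - b\<^sup>2 * c\<^sup>2"
        by (simp add: power2_eq_square algebra_simps)
      ultimately show ?thesis by (simp only:) (simp add: algebra_simps)
    qed
    have "\<not> (p dvd a * d - b * c \<and> p dvd a * d - b * (- c))"
    proof
      assume "p dvd a * d - b * c \<and> p dvd a * d - b * (- c)"
      then have "p dvd (a * d - b * c) + (a * d - b * (- c))" using dvd_add by blast
      then have "p dvd 2 * (a * d)" by (simp add: algebra_simps)
      moreover have "\<not> p dvd 2" using p
        by (metis primes_dvd_imp_eq two_is_prime dvd_refl)
      ultimately have "p dvd d" using p(1) assms(5) by (simp add: prime_dvd_mult_iff)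
      then have "p dvd p ^ k - d\<^sup>2"
        using \<open>k > 0\<close> by (intro dvd_diff) (auto simp: power2_eq_square dvd_power)
      then have "p dvd c\<^sup>2" using cd by (metis add_diff_cancel_right')
      then show False using p(1) assms(6) prime_dvd_power by blast
    qed
    then consider "\<not> p dvd a * d - b * (- c)" | "\<not> p dvd a * d - b * c" by blast
    then show ?thesis
    proof cases
      case 1
      then have "coprime (p ^ k) (a * d - b * (- c))"
        using p(1) by (intro coprime_power_left_iff[THEN iffD2] disjI1) (simp add: prime_imp_coprime)
      then have "p ^ k dvd a * d - b * c"
        using prod by (metis coprime_dvd_mult_left_iff dvd_triv_left)
      then show ?thesis using main cd by blast
    next
      case 2
      then have "coprime (p ^ k) (a * d - b * c)"
        using p(1) by (intro coprime_power_left_iff[THEN iffD2] disjI1) (simp add: prime_imp_coprime)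
      then have "p ^ k dvd a * d - b * (- c)"
        using prod by (metis coprime_dvd_mult_right_iff dvd_triv_left)
      then have "p ^ k dvd - (a * d - b * (- c))" by (simp only: dvd_minus_iff)
      then have "p ^ k dvd a * (- d) - b * c" by (simp add: algebra_simps)
      then show ?thesis using main[of "- d"] cd by simp
    qed
  qed
  moreover then have "b\<^sup>2 = d\<^sup>2" using ab cd by simp
  ultimately show ?thesis by (simp add: power2_eq_iff abs_eq_iff)
qed

text \<open>A Gaussian square root of \<open>a + b * \<i>\<close>, by the parametrisation of
  Pythagorean triples: \<open>(p ^ k + a) / 2\<close> and \<open>(p ^ k - a) / 2\<close> are coprime
  with product \<open>(b / 2) ^ 2\<close>, hence both are squares.\<close>

lemma two_squares_descent:
  fixes a b p :: int
  assumes p: "prime p" "[p = 1] (mod 4)" and a: "[a = 1] (mod 4)" "\<not> p dvd a"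
    and ab: "a\<^sup>2 + b\<^sup>2 = p ^ (2 * k)" and "k > 0"
  obtains c d where "[c = 1] (mod 4)" "\<not> p dvd c" "c\<^sup>2 + d\<^sup>2 = p ^ k"
    "a = c\<^sup>2 - d\<^sup>2" "b = 2 * c * d"
proof -
  define w where "w = p ^ k"
  have w4: "w mod 4 = 1" using cong_pow[OF p(2), of k] unfolding w_def cong_def by simp
  have a4: "a mod 4 = 1" using a(1) unfolding cong_def by simp
  have w: "w > 0" "p dvd w" using p(1) \<open>k > 0\<close> by (auto simp: w_def prime_gt_0_int dvd_power)
  have ab': "a\<^sup>2 + b\<^sup>2 = w\<^sup>2" using ab by (simp add: w_def power_even_eq)
  have "odd w" "odd a" using w4 a4 by presburger+
  then have "odd (w\<^sup>2)" "odd (a\<^sup>2)" by simp_all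
  then have "even (b\<^sup>2)" using ab' by (metis even_add)
  then have "even b" by simp
  then obtain b' where b': "b = 2 * b'" by blast
  obtain u where u: "w + a = 2 * u" using \<open>odd w\<close> \<open>odd a\<close> by (meson evenE odd_add)
  define v where "v = w - u"
  have v: "w - a = 2 * v" using u by (simp add: v_def)
  have uv: "u * v = b'\<^sup>2"
  proof -
    have "4 * (u * v) = (w + a) * (w - a)" using u v by simp
    also have "\<dots> = b\<^sup>2" using ab' by (simp add: power2_eq_square algebra_simps)
    finally show ?thesis by (simp add: b')
  qed
  have "\<bar>a\<bar> < w"
  proof -
    have "\<bar>a\<bar>\<^sup>2 \<le> w\<^sup>2" using ab' by (metis le_add_same_cancel1 power2_abs zero_le_power2)
    then have "\<bar>a\<bar> \<le> w" using w by (simp add: power2_le_iff_abs_le)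
    moreover have "\<bar>a\<bar> \<noteq> w" using a(2) w by auto
    ultimately show ?thesis by simp
  qed
  then have pos: "u > 0" "v > 0" using u v by auto
  have cop: "coprime u v"
  proof -
    have "coprime p (gcd u v)"
    proof (rule ccontr)
      assume "\<not> coprime p (gcd u v)"
      then have "p dvd gcd u v" using p(1) prime_imp_coprime by blast
      then have "p dvd u" "p dvd v" by auto
      then have "p dvd u - v" by simp
      moreover have "u - v = a" using u v by simp
      ultimately show False using a(2) by simp
    qed
    then have *: "coprime (gcd u v) (p ^ k)" by (simp add: coprime_commute)
    have "gcd u v dvd u + v" by simp
    then have "gcd u v dvd p ^ k" by (simp add: v_def w_def)
    then have "gcd u v dvd 1" using coprime_common_divisor[OF * dvd_refl] by simp
    then show ?thesis by (simp add: coprime_iff_gcd_eq_1)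
  qed
  have cop': "coprime (nat u) (nat v)" using cop pos by (simp add: coprime_int_iff[symmetric])
  have "nat u * nat v = (nat \<bar>b'\<bar>)\<^sup>2"
    using uv pos nat_power_eq[of "\<bar>b'\<bar>" 2] by (simp flip: nat_mult_distrib)
  then have "is_nth_power 2 (nat u * nat v)" by (simp add: is_nth_power_nth_power)
  then have "is_nth_power 2 (nat u)" "is_nth_power 2 (nat v)"
    using is_nth_power_mult_coprime_natD[OF cop'] pos by auto
  then obtain c0 d0 where c0: "nat u = c0\<^sup>2" and d0: "nat v = d0\<^sup>2"
    by (auto elim!: is_nth_powerE)
  have uc: "u = (int c0)\<^sup>2" and vd: "v = (int d0)\<^sup>2" using c0 d0 pos by (simp_all flip: of_nat_power)
  \<comment> \<open>The residues modulo 4 decide which half is odd; its root \<open>c0\<close> is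
    then odd, and one of \<open>c0\<close> and \<open>- c0\<close> is 1 modulo 4.\<close>
  have "odd u"
  proof -
    have "(w + a) mod 4 = 2" using w4 a4 by presburger
    then show ?thesis using u by presburger
  qed
  then have "odd c0" using uc by simp
  then have "int c0 mod 4 = 1 \<or> - int c0 mod 4 = 1" by presburger
  then obtain c where c: "c\<^sup>2 = u" "c mod 4 = 1"
    using uc by (metis power2_minus)
  have "b'\<^sup>2 = (c * int d0)\<^sup>2" using uv vd c by (simp add: power_mult_distrib)
  then obtain d where d: "d\<^sup>2 = v" "b' = c * d"
    using vd by (metis power2_minus mult_minus_right power2_eq_iff)
  have eq: "c\<^sup>2 + d\<^sup>2 = w" using c d by (simp add: v_def)
  have "a = c\<^sup>2 - d\<^sup>2" using c d u v by simp
  have "\<not> p dvd c"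
  proof
    assume "p dvd c"
    then have *: "p dvd c\<^sup>2" by (simp add: power2_eq_square)
    then have "p dvd w - c\<^sup>2" using w by simp
    then have "p dvd d\<^sup>2" using eq by (metis add_diff_cancel_left')
    then show False using * a(2) \<open>a = c\<^sup>2 - d\<^sup>2\<close> by simp
  qed
  show ?thesis
    by (rule that[of c d]) (use c d eq \<open>a = c\<^sup>2 - d\<^sup>2\<close> \<open>\<not> p dvd c\<close> b' in \<open>auto simp: w_def cong_def\<close>)
qed

section \<open>Factorials and central binomial coefficients modulo \<open>p\<close>\<close>

lemma fact_prime_part:
  fixes p :: nat
  assumes "prime p"
  shows "\<exists>u. fact n = p ^ (n div p) * fact (n div p) * u \<and> \<not> p dvd u"
proof (induction n)
  case 0
  then show ?case using assms by (intro exI[of _ 1]) (auto simp: prime_nat_iff)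
next
  case (Suc n)
  then obtain u where u: "fact n = p ^ (n div p) * fact (n div p) * u" "\<not> p dvd u" by blast
  show ?case
  proof (cases "p dvd Suc n")
    case True
    then have d: "Suc n div p = Suc (n div p)" by (simp add: div_Suc dvd_eq_mod_eq_0)
    have "Suc n = p * Suc (n div p)" using True d by (metis dvd_mult_div_cancel)
    then have "fact (Suc n) = p * Suc (n div p) * fact n" by (metis fact_Suc of_nat_id)
    then show ?thesis using u unfolding d by (intro exI[of _ u]) (simp add: algebra_simps)
  next
    case False
    then have d: "Suc n div p = n div p" by (simp add: div_Suc dvd_eq_mod_eq_0)
    have "\<not> p dvd Suc n * u" using False u(2) assms by (simp add: prime_dvd_mult_iff del: mult_Suc)
    then show ?thesis using u(1) unfolding d by (intro exI[of _ "Suc n * u"]) (simp add: algebra_simps)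
  qed
qed

text \<open>All base \<open>p\<close> digits of \<open>(p ^ s - 1) div 4\<close> equal
  \<open>(p - 1) div 4\<close>, so doubling produces no carry (Kummer). The induction strips the
  lowest digit by comparing prime parts of factorials. The result keeps the quartic Jacobi sum
  nonzero modulo \<open>p\<close>.\<close>

lemma not_dvd_central_binomial:
  fixes p :: nat
  assumes p: "prime p" "[p = 1] (mod 4)"
  shows "\<not> p dvd (2 * ((p ^ s - 1) div 4)) choose ((p ^ s - 1) div 4)"
proof (induction s)
  case 0
  then show ?case using p(1) by (auto simp: not_prime_1)
next
  case (Suc s)
  define n where "n = (p ^ s - 1) div 4"
  define b where "b = (p - 1) div 4"
  have p1: "p > 1" using p(1) prime_gt_1_nat by blast
  have pb: "p = 4 * b + 1"
  proof -
    have "p mod 4 = 1" using p(2) by (simp add: cong_def)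
    then show ?thesis unfolding b_def by presburger
  qed
  have pn: "p ^ s = 4 * n + 1"
  proof -
    have "[p ^ s = 1 ^ s] (mod 4)" using p(2) cong_pow by blast
    then have "p ^ s mod 4 = 1" by (simp add: cong_def)
    then show ?thesis unfolding n_def by presburger
  qed
  define n' where "n' = p * n + b"
  have n': "(p ^ Suc s - 1) div 4 = n'"
  proof -
    have "p ^ Suc s = p * (4 * n + 1)" using pn by simp
    also have "\<dots> = 4 * (p * n) + p" by (simp add: algebra_simps)
    finally show ?thesis unfolding n'_def using pb by simp
  qed
  have "b < p" "2 * b < p" using pb by auto
  then have d: "n' div p = n" "(2 * n') div p = 2 * n"
    using p1 div_mult_self4[of p "2 * n" "2 * b"] by (simp_all add: n'_def algebra_simps)
  obtain u where u: "fact (2 * n') = p ^ (2 * n) * fact (2 * n) * u" "\<not> p dvd u"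
    using fact_prime_part[OF p(1), of "2 * n'"] d by auto
  obtain w where w: "fact n' = p ^ n * fact n * w" "\<not> p dvd w"
    using fact_prime_part[OF p(1), of n'] d by auto
  define F where "F = p ^ (2 * n) * (fact n)\<^sup>2"
  have F0: "F > 0" using p1 by (simp add: F_def)
  have "F * (w\<^sup>2 * (2 * n' choose n')) = fact n' * fact n' * (2 * n' choose n')"
    unfolding w(1) F_def by (simp add: power2_eq_square power_add mult_2 mult_2_right algebra_simps)
  also have "\<dots> = fact (2 * n')"
    using binomial_fact_lemma[of n' "2 * n'"] by simp
  also have "\<dots> = p ^ (2 * n) * (fact n * fact n * (2 * n choose n)) * u"
    using binomial_fact_lemma[of n "2 * n"] by (simp add: u(1))
  also have "\<dots> = F * (u * (2 * n choose n))"
    by (simp add: F_def power2_eq_square algebra_simps)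
  finally have eq: "w\<^sup>2 * (2 * n' choose n') = u * (2 * n choose n)" using F0 by simp
  have "\<not> p dvd u * (2 * n choose n)"
    using Suc u(2) p(1) by (simp add: prime_dvd_mult_iff n_def)
  then show ?case unfolding n' eq[symmetric] by (simp add: prime_dvd_mult_iff[OF p(1)])
qed

text \<open>The sequence \<open>c n + d n * \<i>\<close> consists of iterated square roots of \<open>a + b * \<i>\<close>.\<close>

lemma two_squares_chain:
  fixes a b p :: int
  assumes p: "prime p" "[p = 1] (mod 4)" and a: "[a = 1] (mod 4)" "\<not> p dvd a"
    and ab: "a\<^sup>2 + b\<^sup>2 = p ^ s" and s: "s > 0" "2 ^ v dvd s"
  obtains c d :: "nat \<Rightarrow> int" where "c 0 = a" "d 0 = b"
    "\<And>n. n \<le> v \<Longrightarrow> [c n = 1] (mod 4) \<and> \<not> p dvd c n \<and> (c n)\<^sup>2 + (d n)\<^sup>2 = p ^ (s div 2 ^ n)"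
    "\<And>n. n < v \<Longrightarrow> c n = (c (Suc n))\<^sup>2 - (d (Suc n))\<^sup>2 \<and> d n = 2 * c (Suc n) * d (Suc n)"
proof -
  \<comment> \<open>Beyond \<open>v\<close> both relations are vacuous, so that dependent choice
    yields a sequence on all natural numbers.\<close>
  define P where "P = (\<lambda>n x. (n = 0 \<longrightarrow> x = (a, b)) \<and> (n \<le> v \<longrightarrow> [fst x = 1] (mod 4) \<and>
    \<not> p dvd fst x \<and> (fst x)\<^sup>2 + (snd x)\<^sup>2 = p ^ (s div 2 ^ n)))"
  define Q where "Q = (\<lambda>n x y. n < v \<longrightarrow>
    fst x = (fst y)\<^sup>2 - (snd y)\<^sup>2 \<and> snd x = 2 * fst y * snd (y :: int \<times> int))"
  have "\<exists>f. \<forall>n. P n (f n) \<and> Q n (f n) (f (Suc n))"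
  proof (rule dependent_nat_choice)
    show "\<exists>x. P 0 x" using a ab by (intro exI[of _ "(a, b)"]) (simp add: P_def)
  next
    fix x n assume x: "P n x"
    show "\<exists>y. P (Suc n) y \<and> Q n x y"
    proof (cases "n < v")
      case True
      then have "2 ^ Suc n dvd s" using s(2) by (meson Suc_leI dvd_trans le_imp_power_dvd)
      then obtain k where k: "s = 2 ^ Suc n * k" by blast
      then have "s div 2 ^ n = 2 * k" "s div 2 ^ Suc n = k" "k > 0"
        using s(1) by (simp_all add: mult.assoc)
      moreover obtain c d where "[c = 1] (mod 4)" "\<not> p dvd c" "c\<^sup>2 + d\<^sup>2 = p ^ k"
        "fst x = c\<^sup>2 - d\<^sup>2" "snd x = 2 * c * d"
        using two_squares_descent[OF p, of "fst x" "snd x" k] x True calculation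
        by (auto simp: P_def)
      ultimately show ?thesis by (intro exI[of _ "(c, d)"]) (simp add: P_def Q_def)
    qed (auto simp: P_def Q_def)
  qed
  then obtain f where f: "\<And>n. P n (f n)" "\<And>n. Q n (f n) (f (Suc n))" by blast
  show ?thesis
    by (rule that[of "\<lambda>n. fst (f n)" "\<lambda>n. snd (f n)"])
      (use f(1)[of 0] f in \<open>auto simp: P_def Q_def\<close>)
qed

text \<open>Eliminating \<open>c (Suc n)\<close> gives
  \<open>c n = p ^ (s div 2 ^ Suc n) - 2 * (d (Suc n)) ^ 2\<close>. The doubling in
  \<open>d n = 2 * c (Suc n) * d (Suc n)\<close> collects one power of 2 per remaining level, so
  modulo \<open>2 ^ (k + 3)\<close> the power of \<open>p\<close> is 1 and the square term is
  0.\<close>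

lemma two_squares_chain_cong:
  fixes p :: int and c d :: "nat \<Rightarrow> int"
  assumes p: "prime p" "[p = 1] (mod 4)" and s: "2 ^ v dvd s"
    and sq: "\<And>n. n \<le> v \<Longrightarrow> [c n = 1] (mod 4) \<and> (c n)\<^sup>2 + (d n)\<^sup>2 = p ^ (s div 2 ^ n)"
    and step: "\<And>n. n < v \<Longrightarrow> c n = (c (Suc n))\<^sup>2 - (d (Suc n))\<^sup>2 \<and> d n = 2 * c (Suc n) * d (Suc n)"
    and nk: "n + Suc k < v"
  shows "[c n = 1] (mod 2 ^ (k + 3))"
proof -
  have s_div: "2 ^ (v - n) dvd s div 2 ^ n" if "n \<le> v" for n
  proof -
    have "(2::nat) ^ v = 2 ^ n * 2 ^ (v - n)" using that by (simp flip: power_add)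
    then show ?thesis using s by (auto elim!: dvdE simp: mult.assoc)
  qed
  \<comment> \<open>Start of the count: the odd square and this power of \<open>p\<close> are both 1
    modulo 8, so 8 divides \<open>(d n) ^ 2\<close> and therefore 4 divides
    \<open>d n\<close>.\<close>
  have d4: "4 dvd d n" if n: "n < v" for n
  proof -
    have odd: "odd (c n)" using sq[of n] n by (auto simp: cong_def) presburger
    have "(2::nat) ^ 1 dvd 2 ^ (v - n)" by (intro le_imp_power_dvd) (use n in auto)
    then have "2 ^ 1 dvd s div 2 ^ n" using s_div[of n] n by (meson dvd_trans less_imp_le_nat)
    then have "[p ^ (s div 2 ^ n) = 1] (mod 2 ^ (1 + 2))" by (rule pow_cong_1_mod_2_power[OF p(2)])
    then have p8: "p ^ (s div 2 ^ n) mod 8 = 1" by (simp add: cong_def)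
    obtain e where e: "c n = 2 * e + 1" using odd by (elim oddE)
    have "even (e * (e + 1))" by simp
    then obtain f where f: "e * (e + 1) = 2 * f" by (elim evenE)
    have c8: "(c n)\<^sup>2 = 8 * f + 1"
    proof -
      have "(c n)\<^sup>2 = 4 * (e * (e + 1)) + 1" unfolding e by (simp add: power2_eq_square algebra_simps)
      then show ?thesis unfolding f by simp
    qed
    have d8: "8 dvd (d n)\<^sup>2"
    proof -
      have "8 * f + 1 + (d n)\<^sup>2 = p ^ (s div 2 ^ n)" using sq[of n] n c8 by simp
      then show ?thesis using p8 by presburger
    qed
    then have "even ((d n)\<^sup>2)" by (rule dvd_trans[rotated]) simp
    then obtain g where g: "d n = 2 * g" by (auto elim!: evenE)
    have "8 dvd 4 * g\<^sup>2" using d8 unfolding g by (simp add: power_mult_distrib)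
    then obtain h where "4 * g\<^sup>2 = 8 * h" by blast
    then have "g\<^sup>2 = 2 * h" by simp
    then have "even (g\<^sup>2)" by simp
    then have "even g" by simp
    then show ?thesis unfolding g by auto
  qed
  have d_dvd: "2 ^ (k + 2) dvd d n" if "n + k < v" for n k
    using that
  proof (induction k arbitrary: n)
    case 0
    then show ?case using d4[of n] by simp
  next
    case (Suc k)
    then have "2 ^ (k + 2) dvd d (Suc n)" by simp
    then have "2 * 2 ^ (k + 2) dvd 2 * c (Suc n) * d (Suc n)"
      by (intro mult_dvd_mono) simp_all
    moreover have "d n = 2 * c (Suc n) * d (Suc n)" using step Suc.prems by simp
    ultimately show ?case by (simp only: add_Suc power_Suc)
  qed
  have "2 ^ (k + 2) dvd d (Suc n)" using d_dvd[of "Suc n" k] nk by simp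
  then have "2 * 2 ^ (k + 2) dvd 2 * (d (Suc n) * d (Suc n))"
    by (intro mult_dvd_mono) (auto simp: dvd_mult)
  then have "2 ^ (k + 3) dvd 2 * (d (Suc n))\<^sup>2" by (simp add: power2_eq_square power_add mult.commute)
  moreover have cn: "c n = p ^ (s div 2 ^ Suc n) - 2 * (d (Suc n))\<^sup>2"
  proof -
    have "c n = (c (Suc n))\<^sup>2 - (d (Suc n))\<^sup>2" using step nk by simp
    moreover have "(c (Suc n))\<^sup>2 + (d (Suc n))\<^sup>2 = p ^ (s div 2 ^ Suc n)" using sq nk by simp
    ultimately show ?thesis by linarith
  qed
  moreover have "2 ^ (k + 3) dvd p ^ (s div 2 ^ Suc n) - 1"
  proof -
    have "(2::nat) ^ (k + 1) dvd 2 ^ (v - Suc n)" by (intro le_imp_power_dvd) (use nk in auto)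
    moreover have "2 ^ (v - Suc n) dvd s div 2 ^ Suc n" using s_div[of "Suc n"] nk by simp
    ultimately have "2 ^ (k + 1) dvd s div 2 ^ Suc n" by (rule dvd_trans)
    then have "[p ^ (s div 2 ^ Suc n) = 1] (mod 2 ^ (k + 1 + 2))"
      by (rule pow_cong_1_mod_2_power[OF p(2)])
    then show ?thesis by (simp add: cong_iff_dvd_diff numeral_3_eq_3)
  qed
  ultimately have "2 ^ (k + 3) dvd (p ^ (s div 2 ^ Suc n) - 1) - 2 * (d (Suc n))\<^sup>2"
    by (simp only: dvd_diff)
  also have "\<dots> = c n - 1" by (simp add: cn)
  finally show ?thesis by (simp only: cong_iff_dvd_diff)
qed

text \<open>
  The hypothesis on \<open>t\<close> is what the cyclotomic period of order \<open>2 ^ r\<close> at \<open>0\<close> satisfies; modulo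
  \<open>2 ^ (r + 1)\<close> it determines the sign \<open>sg r\<close>, since all earlier summands are known there.
\<close>

lemma sign_determination:
  fixes p :: int and c d :: "nat \<Rightarrow> int" and sg t :: "nat \<Rightarrow> int"
  assumes p: "prime p" "[p = 1] (mod 4)" and s: "2 ^ v dvd s"
    and sq: "\<And>n. n \<le> v \<Longrightarrow> [c n = 1] (mod 4) \<and> (c n)\<^sup>2 + (d n)\<^sup>2 = p ^ (s div 2 ^ n)"
    and step: "\<And>n. n < v \<Longrightarrow> c n = (c (Suc n))\<^sup>2 - (d (Suc n))\<^sup>2 \<and> d n = 2 * c (Suc n) * d (Suc n)"
    and eps: "\<And>r. sg r = 1 \<or> sg r = -1"
    and t: "\<And>r. 2 \<le> r \<Longrightarrow> r \<le> v \<Longrightarrow> odd (t r) \<and>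
      - (p ^ (s div 2)) - (\<Sum>i=2..r. 2 ^ (i - 1) * (sg i * c (i - 1)) * p ^ (s * (2 ^ (i - 1) - 1) div 2 ^ i))
        = 1 + 2 ^ r * t r"
    and r: "2 \<le> r" "r \<le> v"
  shows "sg r = 1"
  using r
proof (induction r rule: less_induct)
  case (less r)
  define T where "T = (\<lambda>i. 2 ^ (i - 1) * (sg i * c (i - 1)) * p ^ (s * (2 ^ (i - 1) - 1) div 2 ^ i))"
  define M :: int where "M = 2 ^ (r + 1)"
  have pow1: "[p ^ (s * (2 ^ (i - 1) - 1) div 2 ^ i) = 1] (mod 2 ^ (v - i + 2))" if "i \<le> v" for i
  proof -
    have "(2::nat) ^ v = 2 ^ i * 2 ^ (v - i)" using that by (simp flip: power_add)
    then have "2 ^ (v - i) dvd s * (2 ^ (i - 1) - 1) div 2 ^ i"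
      using s by (auto elim!: dvdE simp: mult.assoc)
    then show ?thesis by (rule pow_cong_1_mod_2_power[OF p(2)])
  qed
  \<comment> \<open>The earlier signs are 1 by induction, so every earlier summand, and hence their
    sum, is known modulo \<open>M\<close>.\<close>
  have T: "[T i = 2 ^ (i - 1)] (mod M)" if i: "2 \<le> i" "i < r" for i
  proof -
    have 1: "[c (i - 1) = 1] (mod 2 ^ (r - i + 2))"
      using two_squares_chain_cong[OF p s sq step, of "i - 1" "r - i - 1"] i less.prems
      by (simp add: Suc_diff_Suc eval_nat_numeral)
    have 2: "[p ^ (s * (2 ^ (i - 1) - 1) div 2 ^ i) = 1] (mod 2 ^ (r - i + 2))"
      by (rule cong_dvd_modulus[OF pow1]) (use i less.prems in \<open>auto intro!: le_imp_power_dvd\<close>)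
    have "[c (i - 1) * p ^ (s * (2 ^ (i - 1) - 1) div 2 ^ i) = 1] (mod 2 ^ (r - i + 2))"
      using cong_mult[OF 1 2] by simp
    then have "2 ^ (i - 1) * 2 ^ (r - i + 2) dvd
        2 ^ (i - 1) * (c (i - 1) * p ^ (s * (2 ^ (i - 1) - 1) div 2 ^ i) - 1)"
      by (intro mult_dvd_mono) (auto simp: cong_iff_dvd_diff)
    moreover have "2 ^ (i - 1) * 2 ^ (r - i + 2) = M"
      using i by (cases r) (simp_all add: M_def flip: power_add)
    moreover have "sg i = 1" using less.IH i less.prems by simp
    ultimately show ?thesis by (simp add: T_def cong_iff_dvd_diff algebra_simps)
  qed
  have "[(\<Sum>i\<in>{2..<r}. T i) = (\<Sum>i\<in>{2..<r}. 2 ^ (i - 1))] (mod M)"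
    by (rule cong_sum) (use T in auto)
  moreover have "(\<Sum>i\<in>{2..<r}. 2 ^ (i - 1)) = (2 ^ (r - 1) - 2 :: int)"
    using less.prems(1)
  proof (induction r rule: dec_induct)
    case (step n)
    then obtain n' where "n = Suc n'" by (cases n) auto
    then show ?case using step by simp
  qed simp
  ultimately have S: "[(\<Sum>i\<in>{2..<r}. T i) = 2 ^ (r - 1) - 2] (mod M)" by simp
  define x where "x = sg r * c (r - 1) * p ^ (s * (2 ^ (r - 1) - 1) div 2 ^ r)"
  have Tr: "T r = 2 ^ (r - 1) * x" by (simp add: T_def x_def)
  have "{2..r} = insert r {2..<r}" using less.prems by auto
  then have sum: "(\<Sum>i=2..r. T i) = 2 ^ (r - 1) * x + (\<Sum>i\<in>{2..<r}. T i)" by (simp add: Tr)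
  obtain u where u: "t r = 2 * u + 1" using t[of r] less.prems by (auto elim: oddE)
  have tr: "- (p ^ (s div 2)) - (\<Sum>i=2..r. T i) = 1 + 2 ^ r * t r"
    using t[of r] less.prems by (simp add: T_def)
  have ps: "[p ^ (s div 2) = 1] (mod M)"
  proof -
    have "(2::nat) ^ v = 2 * 2 ^ (v - 1)" using less.prems by (cases v) auto
    then have "2 ^ (v - 1) dvd s div 2" using s by (auto elim!: dvdE simp: mult.assoc)
    then have "[p ^ (s div 2) = 1] (mod 2 ^ (v - 1 + 2))" by (rule pow_cong_1_mod_2_power[OF p(2)])
    then show ?thesis unfolding M_def
      by (rule cong_dvd_modulus) (use less.prems in \<open>auto intro!: le_imp_power_dvd\<close>)
  qed
  \<comment> \<open>With \<open>t r\<close> odd the hypothesis says modulo \<open>M\<close> that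
    \<open>2 ^ (r - 1) * (x + 3)\<close> is 0; as \<open>M = 2 ^ (r - 1) * 4\<close>, this fixes
    \<open>x\<close> modulo 4 and with it the sign.\<close>
  have "M dvd (p ^ (s div 2) - 1) + ((\<Sum>i\<in>{2..<r}. T i) - (2 ^ (r - 1) - 2)) + M * u"
    using S ps by (intro dvd_add) (auto simp: cong_iff_dvd_diff)
  also have "(p ^ (s div 2) - 1) + ((\<Sum>i\<in>{2..<r}. T i) - (2 ^ (r - 1) - 2)) + M * u
      = - (2 ^ (r - 1) * x) - 2 ^ (r - 1) - 2 ^ r"
    using tr sum by (simp add: u M_def algebra_simps)
  also have "\<dots> = - (2 ^ (r - 1) * (x + 3))"
    using less.prems by (cases r) (simp_all add: algebra_simps)
  finally have "M dvd 2 ^ (r - 1) * (x + 3)" by simp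
  moreover have "M = 2 ^ (r - 1) * 4" using less.prems by (cases r) (simp_all add: M_def)
  ultimately have "4 dvd x + 3" by simp
  then have x: "[x = 1] (mod 4)" unfolding cong_iff_dvd_diff by presburger
  have "[p ^ (s * (2 ^ (r - 1) - 1) div 2 ^ r) = 1] (mod 4)"
    by (rule cong_dvd_modulus[OF pow1]) (use less.prems in auto)
  moreover have "[c (r - 1) = 1] (mod 4)" using sq[of "r - 1"] less.prems by simp
  ultimately have "[x = sg r * 1 * 1] (mod 4)"
    unfolding x_def by (intro cong_mult cong_refl)
  then have "[sg r = 1] (mod 4)" using x by (metis cong_sym cong_trans mult.right_neutral)
  then show ?case using eps[of r] by (auto simp: cong_def)
qed

text \<open>Every nonzero index below \<open>2 ^ Suc n\<close> is \<open>2 ^ t\<close> times an odd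
  number; for \<open>t < n\<close> the odd parts split evenly, \<open>2 ^ (n - 1 - t)\<close> in
  each class modulo 4. What remains are the indices \<open>2 ^ n\<close> and 0. Applied to the
  linear factors of the period polynomial, this produces the multiplicities in the theorem.\<close>

lemma prod_two_adic_class:
  fixes f :: "nat \<Rightarrow> 'b::comm_monoid_mult"
  assumes "\<And>t j. [j = 1] (mod 4) \<Longrightarrow> f (2 ^ t * j) = f (2 ^ t)"
    and "\<And>t j. [j = 3] (mod 4) \<Longrightarrow> f (2 ^ t * j) = f (2 ^ t * 3)"
  shows "(\<Prod>k<2 ^ Suc n. f k)
    = (\<Prod>t<n. (f (2 ^ t) * f (2 ^ t * 3)) ^ 2 ^ (n - 1 - t)) * f (2 ^ n) * f 0"
  using assms
proof (induction n arbitrary: f)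
  case 0
  have "{..<2::nat} = {0, 1}" by auto
  then show ?case by (simp add: mult.commute)
next
  case (Suc n)
  have even: "(\<Prod>k<2 * N. g k) = (\<Prod>k<N. g (2 * k)) * (\<Prod>k<N. g (2 * k + 1))"
    for g :: "nat \<Rightarrow> 'b" and N by (induction N) (simp_all add: algebra_simps)
  have "(\<Prod>k<2 ^ Suc (Suc n). f k) = (\<Prod>k<2 ^ Suc n. f (2 * k)) * (\<Prod>k<2 ^ Suc n. f (2 * k + 1))"
    using even[of f "2 ^ Suc n"] by simp
  also have "(\<Prod>k<2 ^ Suc n. f (2 * k + 1)) = (\<Prod>k<2 ^ n. f (2 * (2 * k) + 1)) * (\<Prod>k<2 ^ n. f (2 * (2 * k + 1) + 1))"
    using even[of "\<lambda>k. f (2 * k + 1)" "2 ^ n"] by simp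
  also have "(\<Prod>k<2 ^ n. f (2 * (2 * k) + 1)) = (\<Prod>k<(2::nat) ^ n. f 1)"
  proof (rule prod.cong)
    show "f (2 * (2 * k) + 1) = f 1" for k
      using Suc.prems(1)[of "2 * (2 * k) + 1" 0] by (simp add: cong_def mod_Suc)
  qed simp
  also have "(\<Prod>k<2 ^ n. f (2 * (2 * k + 1) + 1)) = (\<Prod>k<(2::nat) ^ n. f 3)"
  proof (rule prod.cong)
    fix k :: nat
    have "[4 * k + 3 = 3] (mod 4)" by (simp add: cong_def)
    then have "f (4 * k + 3) = f 3" using Suc.prems(2)[of "4 * k + 3" 0] by simp
    moreover have "2 * (2 * k + 1) + 1 = 4 * k + 3" by simp
    ultimately show "f (2 * (2 * k + 1) + 1) = f 3" by (simp only:)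
  qed simp
  also have "(\<Prod>k<2 ^ Suc n. f (2 * k))
      = (\<Prod>t<n. (f (2 * 2 ^ t) * f (2 * (2 ^ t * 3))) ^ 2 ^ (n - 1 - t)) * f (2 * 2 ^ n) * f (2 * 0)"
  proof (rule Suc.IH)
    show "f (2 * (2 ^ t * j)) = f (2 * 2 ^ t)" if "[j = 1] (mod 4)" for t j
      using Suc.prems(1)[OF that, of "Suc t"] by (simp add: mult.assoc)
    show "f (2 * (2 ^ t * j)) = f (2 * (2 ^ t * 3))" if "[j = 3] (mod 4)" for t j
      using Suc.prems(2)[OF that, of "Suc t"] by (simp add: mult.assoc)
  qed
  finally show ?case
    unfolding prod.lessThan_Suc_shift by (simp add: power_mult_distrib ac_simps)
qed

subsection \<open>Finite fields with a fixed generator\<close>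

lemma root_of_unity_eq_cis: "root_of_unity n = cis (2 * pi / real n)"
  by (simp add: root_of_unity_def cis_conv_exp mult_ac)

lemma root_of_unity_power_self: "n > 0 \<Longrightarrow> root_of_unity n ^ n = 1"
  by (simp add: root_of_unity_eq_cis DeMoivre)

lemma sum_root_of_unity_powers:
  assumes "p > 1"
  shows "(\<Sum>j<p. root_of_unity p ^ j) = 0"
proof -
  have "root_of_unity p ^ p = 1"
    using assms by (simp add: root_of_unity_eq_cis DeMoivre)
  moreover have "root_of_unity p \<noteq> 1"
  proof
    assume "root_of_unity p = 1"
    then have "cos (2 * pi / real p) = 1" by (simp add: root_of_unity_eq_cis complex_eq_iff)
    then obtain x :: int where x: "2 * pi / real p = of_int x * 2 * pi" 
      using cos_one_2pi_int by blast
    have "2 * pi * (of_int x * real p) = 2 * pi * 1"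
      using x assms by (simp add: field_simps)
    then have "of_int x * real p = 1" by simp
    then have "x * int p = 1" by (metis of_int_1 of_int_eq_iff of_int_mult of_int_of_nat_eq)
    then have "int p dvd 1" by (metis dvd_triv_right)
    then show False using assms by simp
  qed
  ultimately show ?thesis by (simp add: geometric_sum)
qed

locale generated_field =
  fixes \<gamma> :: "'a::{field,finite}" and p s :: nat
  assumes char: "CHAR('a) = p" and card: "CARD('a) = p ^ s" and gen: "generates_units \<gamma>"
begin

lemma prime_p: "prime p"
  using prime_CHAR_semidom[where ?'a = 'a] finite_imp_CHAR_pos[where ?'a = 'a] char by simp

lemma p_gt_1: "p > 1"
  using prime_p prime_gt_1_nat by blast

lemma q_gt_1: "p ^ s > 1"
proof -
  have "card {0, 1 :: 'a} \<le> CARD('a)" by (intro card_mono) auto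
  then show ?thesis by (simp add: card)
qed

lemma s_pos: "s > 0"
  using q_gt_1 by (cases s) auto

lemma freshman: "(x + y :: 'a) ^ (p ^ i) = x ^ (p ^ i) + y ^ (p ^ i)"
  using freshmans_dream'[where ?'a = 'a, of "p ^ i" i] prime_p char by simp

lemma freshman_sum: "(\<Sum>j\<in>A. f j :: 'a) ^ (p ^ i) = (\<Sum>j\<in>A. f j ^ (p ^ i))"
  using freshmans_dream_sum'[where ?'a = 'a, of "p ^ i" i f A] prime_p char by simp

definition q1 :: nat where "q1 = p ^ s - 1"

lemma q_eq_Suc_q1: "p ^ s = Suc q1" and q1_pos: "q1 > 0"
  using q_gt_1 by (simp_all add: q1_def)

lemma power_card_minus_1:
  assumes "(x::'a) \<noteq> 0"
  shows "x ^ q1 = 1"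
proof -
  have "(\<Prod>y\<in>UNIV - {0}. x * y) = (\<Prod>y\<in>UNIV - {0}. y)"
    by (rule prod.reindex_bij_witness[of _ "\<lambda>y. y / x" "\<lambda>y. x * y"]) (use assms in auto)
  then have "x ^ q1 * \<Prod>(UNIV - {0}) = 1 * \<Prod>(UNIV - {0})"
    by (simp add: prod.distrib card q1_def)
  then show ?thesis by (subst (asm) mult_cancel_right) simp
qed

lemma power_card: "(x::'a) ^ (p ^ s) = x"
proof (cases "x = 0")
  case False
  have "x ^ (p ^ s) = x * x ^ q1" by (simp add: q_eq_Suc_q1)
  then show ?thesis using False by (simp add: power_card_minus_1)
qed (simp add: q_eq_Suc_q1)

lemma gamma_range: "range (\<lambda>k::nat. \<gamma> ^ k) = UNIV - {0}"
  using gen by (simp add: generates_units_def)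

lemma gamma_power_nonzero [simp]: "\<gamma> ^ k \<noteq> 0"
  using gamma_range by (metis Diff_iff insertI1 rangeI)

lemma gamma_nonzero [simp]: "\<gamma> \<noteq> 0"
  using gamma_power_nonzero[of 1] by simp

lemma gamma_power_mod: "\<gamma> ^ (k mod q1) = \<gamma> ^ k"
proof -
  have "\<gamma> ^ k = \<gamma> ^ (q1 * (k div q1) + k mod q1)" by simp
  also have "\<dots> = \<gamma> ^ (k mod q1)"
    by (simp only: power_add power_mult) (simp add: power_card_minus_1)
  finally show ?thesis by simp
qed

lemma bij_gamma: "bij_betw (\<lambda>k. \<gamma> ^ k) {..<q1} (UNIV - {0})"
proof -
  have im: "(\<lambda>k. \<gamma> ^ k) ` {..<q1} = UNIV - {0}"
  proof
    show "UNIV - {0} \<subseteq> (\<lambda>k. \<gamma> ^ k) ` {..<q1}"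
    proof
      fix x assume "x \<in> UNIV - {0 :: 'a}"
      then obtain k where "x = \<gamma> ^ k" using gamma_range by blast
      then have "x = \<gamma> ^ (k mod q1)" by (simp add: gamma_power_mod)
      then show "x \<in> (\<lambda>k. \<gamma> ^ k) ` {..<q1}" using q1_pos by auto
    qed
  qed auto
  moreover have "inj_on (\<lambda>k. \<gamma> ^ k) {..<q1}"
    by (rule eq_card_imp_inj_on) (simp_all only: im, simp_all add: card q_eq_Suc_q1)
  ultimately show ?thesis by (simp add: bij_betw_def)
qed

lemma gamma_power_eq_iff: "\<gamma> ^ a = \<gamma> ^ b \<longleftrightarrow> [a = b] (mod q1)"
proof -
  have "\<gamma> ^ a = \<gamma> ^ b \<longleftrightarrow> \<gamma> ^ (a mod q1) = \<gamma> ^ (b mod q1)"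
    by (simp add: gamma_power_mod)
  also have "\<dots> \<longleftrightarrow> a mod q1 = b mod q1"
    using bij_gamma q1_pos by (auto simp: bij_betw_def inj_on_def)
  finally show ?thesis by (simp add: cong_def)
qed

definition dlog :: "'a \<Rightarrow> nat" where "dlog x = (SOME k. x = \<gamma> ^ k)"

lemma gamma_power_dlog: "x \<noteq> 0 \<Longrightarrow> \<gamma> ^ dlog x = x"
  unfolding dlog_def using gamma_range by (metis (mono_tags) Diff_iff UNIV_I rangeE singletonD someI)

lemma obtain_gamma_power:
  assumes "x \<noteq> 0"
  obtains k where "x = \<gamma> ^ k"
  using gamma_power_dlog[OF assms] by metis

lemma sum_nonzero_eq_sum_gamma: "(\<Sum>x\<in>UNIV - {0}. f x) = (\<Sum>k<q1. f (\<gamma> ^ k))"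
  using sum.reindex_bij_betw[OF bij_gamma, of f] by simp

section \<open>Subfields as fixed sets of powers of Frobenius, and the fibres of the trace\<close>

definition subfield :: "nat \<Rightarrow> 'a set" where "subfield k = {x. x ^ (p ^ k) = x}"

lemma subfield_add: "x \<in> subfield k \<Longrightarrow> y \<in> subfield k \<Longrightarrow> x + y \<in> subfield k"
  by (simp add: subfield_def freshman)

lemma subfield_mult: "x \<in> subfield k \<Longrightarrow> y \<in> subfield k \<Longrightarrow> x * y \<in> subfield k"
  by (simp add: subfield_def power_mult_distrib)

lemma subfield_0 [simp]: "0 \<in> subfield k"
  using p_gt_1 by (simp add: subfield_def)

lemma subfield_1 [simp]: "1 \<in> subfield k"
  by (simp add: subfield_def)

lemma subfield_diff:
  assumes "x \<in> subfield k" "y \<in> subfield k"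
  shows "x - y \<in> subfield k"
proof -
  have "(x - y) ^ p ^ k + y ^ p ^ k = x ^ p ^ k" by (simp flip: freshman)
  then show ?thesis using assms by (simp add: subfield_def eq_diff_eq)
qed

lemma subfield_of_nat [simp]: "of_nat n \<in> subfield k"
  by (induction n) (auto intro: subfield_add)

lemma subfield_mono_dvd:
  assumes "k dvd l" "x \<in> subfield k"
  shows "x \<in> subfield l"
proof -
  have "x ^ (p ^ (k * j)) = x" for j
    using assms(2) by (induction j) (simp_all add: subfield_def power_add power_mult)
  then show ?thesis using assms(1) by (auto simp: subfield_def elim!: dvdE)
qed

lemma q_minus_1_factor:
  assumes "k dvd s"
  shows "q1 = q1 div (p ^ k - 1) * (p ^ k - 1)"
proof -
  have "int (p ^ k) - 1 dvd int (p ^ k) ^ (s div k) - 1"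
    by (simp add: power_diff_1_eq)
  also have "int (p ^ k) ^ (s div k) = int (p ^ s)"
    using assms by (simp flip: power_mult)
  finally have "int (p ^ k - 1) dvd int q1"
    using p_gt_1 by (simp add: of_nat_diff q1_def)
  then have "p ^ k - 1 dvd q1" by (simp only: int_dvd_int_iff)
  then show ?thesis by simp
qed

lemma gamma_power_in_subfield_iff:
  assumes "k dvd s" "k > 0"
  shows "\<gamma> ^ j \<in> subfield k \<longleftrightarrow> q1 div (p ^ k - 1) dvd j"
proof -
  have pk: "p ^ k > 1" using p_gt_1 assms(2) by (intro one_less_power)
  have "\<gamma> ^ j \<in> subfield k \<longleftrightarrow> \<gamma> ^ (j * (p ^ k - 1) + j) = \<gamma> ^ j"
    using pk by (simp add: subfield_def algebra_simps flip: power_mult)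
  also have "\<dots> \<longleftrightarrow> [j * (p ^ k - 1) + j = 0 + j] (mod q1)"
    by (simp add: gamma_power_eq_iff)
  also have "\<dots> \<longleftrightarrow> q1 dvd j * (p ^ k - 1)"
    by (simp only: cong_add_rcancel_nat cong_0_iff)
  also have "\<dots> \<longleftrightarrow> q1 div (p ^ k - 1) dvd j"
    by (subst q_minus_1_factor[OF assms(1)]) (use pk in auto)
  finally show ?thesis .
qed

lemma card_subfield:
  assumes "k dvd s" "k > 0"
  shows "card (subfield k) = p ^ k"
proof -
  define N where "N = q1 div (p ^ k - 1)"
  have pk: "p ^ k > 1" using p_gt_1 assms(2) by (intro one_less_power)
  have N: "q1 = N * (p ^ k - 1)" unfolding N_def by (rule q_minus_1_factor[OF assms(1)])
  then have N0: "N > 0" using q1_pos by (metis gr0I less_irrefl mult_0)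
  have "subfield k - {0} = (\<lambda>k. \<gamma> ^ k) ` ((*) N ` {..<p ^ k - 1})"
  proof (intro equalityI subsetI)
    fix x assume x: "x \<in> subfield k - {0}"
    then have "x \<in> (\<lambda>k. \<gamma> ^ k) ` {..<q1}" using bij_gamma by (auto simp: bij_betw_def)
    then obtain j where j: "x = \<gamma> ^ j" "j < q1" by blast
    then have "N dvd j" using x gamma_power_in_subfield_iff[OF assms, of j] by (simp add: N_def)
    then obtain i where i: "j = N * i" by blast
    then have "i < p ^ k - 1" using j(2) N0 unfolding N by simp
    then show "x \<in> (\<lambda>k. \<gamma> ^ k) ` ((*) N ` {..<p ^ k - 1})" unfolding j(1) i by (intro imageI) simp
  next
    fix x assume "x \<in> (\<lambda>k. \<gamma> ^ k) ` ((*) N ` {..<p ^ k - 1})"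
    then obtain i where i: "x = \<gamma> ^ (N * i)" by blast
    have "\<gamma> ^ (N * i) \<in> subfield k"
      unfolding gamma_power_in_subfield_iff[OF assms] N_def by (rule dvd_triv_left)
    then show "x \<in> subfield k - {0}" by (simp add: i)
  qed
  moreover have "inj_on (\<lambda>k. \<gamma> ^ k) ((*) N ` {..<p ^ k - 1})"
  proof (rule inj_on_subset)
    show "inj_on (\<lambda>k. \<gamma> ^ k) {..<q1}" using bij_gamma by (simp add: bij_betw_def)
    have "N * i < q1" if "i < p ^ k - 1" for i unfolding N using that N0 by (simp only: mult_less_cancel1)
    then show "(*) N ` {..<p ^ k - 1} \<subseteq> {..<q1}" by blast
  qed
  moreover have "inj_on ((*) N) {..<p ^ k - 1}" using N0 by (simp add: inj_on_def)
  ultimately have "card (subfield k - {0}) = p ^ k - 1" by (simp add: card_image)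
  then show ?thesis using pk by (simp add: card_Diff_singleton)
qed

lemma inj_of_nat: "inj_on (of_nat :: nat \<Rightarrow> 'a) {..<p}"
  by (auto simp: inj_on_def of_nat_eq_iff_cong_CHAR char cong_def)

lemma prime_subfield_eq: "subfield 1 = of_nat ` {..<p}"
proof (rule sym, rule card_subset_eq)
  show "card (of_nat ` {..<p} :: 'a set) = card (subfield 1)"
    using card_image[OF inj_of_nat] card_subfield[of 1] by simp
qed auto

lemma field_trace_add: "field_trace k (x + y :: 'a) = field_trace k x + field_trace k y"
  by (simp add: field_trace_def char freshman sum.distrib)

lemma field_trace_scale: "c \<in> subfield 1 \<Longrightarrow> field_trace k (c * x) = c * field_trace k x"
  using subfield_mono_dvd[of 1 _ c]
  by (simp add: field_trace_def char power_mult_distrib sum_distrib_left subfield_def)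

lemma field_trace_frobenius:
  assumes "x \<in> subfield k" "k > 0"
  shows "field_trace k (x ^ p) = field_trace k x"
proof -
  obtain k' where k: "k = Suc k'" using assms(2) gr0_implies_Suc by blast
  have "field_trace k (x ^ p) = (\<Sum>i<k. x ^ (p ^ Suc i))"
    by (simp add: field_trace_def char power_mult)
  also have "\<dots> = (\<Sum>i<k'. x ^ (p ^ Suc i)) + x ^ (p ^ 0)"
    using assms(1) by (simp add: k subfield_def)
  also have "\<dots> = (\<Sum>i<k. x ^ (p ^ i))"
    unfolding k sum.lessThan_Suc_shift by (simp add: add.commute)
  finally show ?thesis by (simp add: field_trace_def char)
qed

lemma field_trace_in_prime_subfield:
  assumes "x \<in> subfield k" "k > 0"
  shows "field_trace k x \<in> subfield 1"
proof -
  have "field_trace k x ^ (p ^ 1) = field_trace k (x ^ p)"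
    unfolding field_trace_def char freshman_sum by (simp flip: power_mult add: mult.commute)
  then show ?thesis using field_trace_frobenius[OF assms] by (simp add: subfield_def)
qed

text \<open>Each fibre lies in the zero set of a polynomial of degree at most
  \<open>p ^ (k - 1)\<close>, and the \<open>p\<close> fibres together have \<open>p ^ k\<close>
  elements, so every bound is attained. Surjectivity of the trace is thereby included.\<close>

lemma card_trace_fibre:
  assumes "k dvd s" "k > 0" "c \<in> subfield 1"
  shows "card {x \<in> subfield k. field_trace k x = c} = p ^ (k - 1)"
proof -
  define F where "F c = {x \<in> subfield k. field_trace k x = c}" for c
  have le: "card (F c) \<le> p ^ (k - 1)" for c
  proof -
    define P where "P = (\<Sum>i<k. Polynomial.monom (1::'a) (p ^ i)) - [:c:]"
    have "Polynomial.coeff P (p ^ (k - 1)) = (\<Sum>i<k. if i = k - 1 then 1 else 0)"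
      using p_gt_1 by (simp add: P_def coeff_sum coeff_pCons split: nat.splits)
    also have "\<dots> = 1" using assms(2) by (subst sum.delta) auto
    finally have P0: "P \<noteq> 0" by auto
    have "degree P \<le> p ^ (k - 1)"
      unfolding P_def
    proof (intro degree_diff_le degree_sum_le)
      fix i assume "i \<in> {..<k}"
      then have "p ^ i \<le> p ^ (k - 1)" using p_gt_1 by (intro power_increasing) auto
      then show "degree (Polynomial.monom (1::'a) (p ^ i)) \<le> p ^ (k - 1)"
        by (simp add: degree_monom_eq)
    qed auto
    moreover have "F c \<subseteq> {x. poly P x = 0}"
      by (auto simp: F_def P_def field_trace_def char poly_sum poly_monom)
    then have "card (F c) \<le> card {x. poly P x = 0}" by (intro card_mono) auto
    moreover have "card {x. poly P x = 0} \<le> degree P" using P0 by (rule card_poly_roots_bound)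
    ultimately show ?thesis by linarith
  qed
  have "card (subfield k) = card (\<Union>c\<in>subfield 1. F c)"
    using field_trace_in_prime_subfield assms by (intro arg_cong[of _ _ card]) (auto simp: F_def)
  also have "\<dots> = (\<Sum>c\<in>subfield 1. card (F c))"
    by (intro card_UN_disjoint) (auto simp: F_def)
  finally have "(\<Sum>c\<in>subfield 1. card (F c)) = p ^ k" using card_subfield assms by simp
  also have "p ^ k = (\<Sum>c\<in>subfield 1. p ^ (k - 1))"
    using card_subfield[of 1] assms(2) by (simp flip: power_Suc)
  finally have "(\<Sum>c\<in>subfield 1. card (F c)) = (\<Sum>c\<in>subfield 1. p ^ (k - 1))" .
  then have "\<forall>c\<in>subfield 1. card (F c) = p ^ (k - 1)"
    using sum_mono_inv[of "\<lambda>c. card (F c)" "subfield 1" "\<lambda>_. p ^ (k - 1)"] le by auto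
  then show ?thesis using assms(3) by (simp add: F_def)
qed

lemma subfield_s [simp]: "subfield s = UNIV"
  by (auto simp: subfield_def power_card)

definition \<psi> :: "'a \<Rightarrow> complex" where
  "\<psi> x = root_of_unity p ^ prime_field_rep (field_trace s x)"

lemma prime_field_rep_of_nat: "prime_field_rep (of_nat n :: 'a) = n mod p"
  unfolding prime_field_rep_def char
proof (rule the_equality)
  show "n mod p < p \<and> of_nat (n mod p) = (of_nat n :: 'a)"
    using p_gt_1 by (simp add: of_nat_eq_iff_cong_CHAR char)
  show "k = n mod p" if "k < p \<and> of_nat k = (of_nat n :: 'a)" for k
    using that by (auto simp: of_nat_eq_iff_cong_CHAR char cong_def)
qed

lemma root_of_unity_power_mod: "root_of_unity p ^ (n mod p) = root_of_unity p ^ n"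
proof -
  have "root_of_unity p ^ p = 1" using p_gt_1 by (simp add: root_of_unity_eq_cis DeMoivre)
  then have "root_of_unity p ^ (p * (n div p) + n mod p) = root_of_unity p ^ (n mod p)"
    by (simp only: power_add power_mult) simp
  then show ?thesis by simp
qed

lemma psi_eq: "field_trace s x = of_nat n \<Longrightarrow> \<psi> x = root_of_unity p ^ n"
  by (simp add: \<psi>_def prime_field_rep_of_nat root_of_unity_power_mod)

lemma obtain_trace:
  obtains n where "n < p" "field_trace s (x :: 'a) = of_nat n"
  using field_trace_in_prime_subfield[of x s] s_pos by (auto simp: prime_subfield_eq[simplified])

lemma psi_0 [simp]: "\<psi> 0 = 1"
  using psi_eq[of 0 0] p_gt_1 by (simp add: field_trace_def char power_0_left)

lemma psi_add: "\<psi> (x + y) = \<psi> x * \<psi> y"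
proof -
  obtain m n where "field_trace s x = of_nat m" "field_trace s y = of_nat n"
    using obtain_trace by metis
  then show ?thesis
    using psi_eq[of x m] psi_eq[of y n] psi_eq[of "x + y" "m + n"]
    by (simp add: field_trace_add power_add)
qed

lemma norm_psi [simp]: "norm (\<psi> x) = 1"
  by (simp add: \<psi>_def root_of_unity_eq_cis norm_power)

lemma psi_nonzero [simp]: "\<psi> x \<noteq> 0"
  using norm_psi[of x] by (metis norm_zero zero_neq_one)

lemma psi_minus: "\<psi> (- x) = cnj (\<psi> x)"
proof -
  have "\<psi> x * \<psi> (- x) = 1" using psi_add[of x "- x"] by simp
  moreover have "\<psi> x * cnj (\<psi> x) = 1" by (simp add: complex_norm_square[symmetric])
  ultimately show ?thesis by (metis mult_cancel_left psi_nonzero)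
qed

lemma psi_frobenius: "\<psi> (x ^ p ^ i) = \<psi> x"
proof (induction i)
  case (Suc i)
  have "\<psi> (x ^ p ^ Suc i) = \<psi> ((x ^ p ^ i) ^ p)" by (simp flip: power_mult add: mult.commute)
  also have "\<dots> = \<psi> (x ^ p ^ i)" using field_trace_frobenius[of _ s] s_pos by (simp add: \<psi>_def)
  finally show ?case using Suc by simp
qed simp

lemma psi_power_p: "\<psi> x ^ p = 1"
proof -
  have "\<psi> x ^ p = (root_of_unity p ^ p) ^ prime_field_rep (field_trace s x)"
    by (simp add: \<psi>_def mult.commute flip: power_mult)
  then show ?thesis using root_of_unity_power_self[of p] p_gt_1 by simp
qed

lemma sum_psi: "(\<Sum>x\<in>UNIV. \<psi> x) = 0"
proof -
  have "(\<Sum>x\<in>UNIV. \<psi> x) = (\<Sum>c\<in>subfield 1. \<Sum>x\<in>{x \<in> subfield s. field_trace s x = c}. \<psi> x)"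
    using field_trace_in_prime_subfield[of _ s] s_pos
    by (subst sum.UNION_disjoint[symmetric]) (auto intro!: sum.cong)
  also have "\<dots> = (\<Sum>c\<in>subfield 1. of_nat (p ^ (s - 1)) * root_of_unity p ^ prime_field_rep c)"
  proof (rule sum.cong)
    fix c assume c: "c \<in> subfield 1"
    have "(\<Sum>x\<in>{x \<in> subfield s. field_trace s x = c}. \<psi> x)
        = (\<Sum>x\<in>{x \<in> subfield s. field_trace s x = c}. root_of_unity p ^ prime_field_rep c)"
      by (intro sum.cong) (auto simp: \<psi>_def)
    then show "(\<Sum>x\<in>{x \<in> subfield s. field_trace s x = c}. \<psi> x)
        = of_nat (p ^ (s - 1)) * root_of_unity p ^ prime_field_rep c"
      using card_trace_fibre[OF _ s_pos c] by simp
  qed simp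
  also have "\<dots> = of_nat (p ^ (s - 1)) * (\<Sum>n<p. root_of_unity p ^ n)"
    unfolding prime_subfield_eq sum_distrib_left
    by (subst sum.reindex[OF inj_of_nat]) (auto intro!: sum.cong simp: prime_field_rep_of_nat)
  also have "\<dots> = 0" using sum_root_of_unity_powers[OF p_gt_1] by simp
  finally show ?thesis .
qed

lemma sum_psi_scaled: "(\<Sum>x\<in>UNIV. \<psi> (c * x)) = (if c = 0 then of_nat (p ^ s) else 0)"
proof (cases "c = 0")
  case False
  have "(\<Sum>x\<in>UNIV. \<psi> (c * x)) = (\<Sum>x\<in>UNIV. \<psi> x)"
    by (rule sum.reindex_bij_witness[of _ "\<lambda>y. y / c" "\<lambda>y. c * y"]) (use False in auto)
  then show ?thesis using False sum_psi by simp
qed (simp add: card)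

text \<open>Translating by some \<open>b\<close> with \<open>\<psi> (b * x)\<close> different from 1
  multiplies the sum by that value, so the sum vanishes.\<close>

lemma sum_psi_subfield:
  "(\<Sum>a\<in>subfield k. \<psi> (a * x)) = (if \<forall>a\<in>subfield k. \<psi> (a * x) = 1 then of_nat (card (subfield k)) else 0)"
proof (cases "\<forall>a\<in>subfield k. \<psi> (a * x) = 1")
  case False
  then obtain b where b: "b \<in> subfield k" "\<psi> (b * x) \<noteq> 1" by blast
  have "(\<Sum>a\<in>subfield k. \<psi> (a * x)) = (\<Sum>a\<in>subfield k. \<psi> ((a + b) * x))"
    by (rule sum.reindex_bij_witness[of _ "\<lambda>a. a + b" "\<lambda>a. a - b"])
      (use b(1) in \<open>simp_all add: subfield_add subfield_diff\<close>)
  also have "\<dots> = (\<Sum>a\<in>subfield k. \<psi> (a * x)) * \<psi> (b * x)"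
    by (simp add: distrib_right psi_add sum_distrib_right)
  finally have "(\<Sum>a\<in>subfield k. \<psi> (a * x)) = 0" using b(2) by simp
  then show ?thesis unfolding if_not_P[OF False] .
qed simp

end

subsection \<open>Gauss and Jacobi sums\<close>

lemma sum_lessThan_double:
  fixes g :: "nat \<Rightarrow> 'b::comm_monoid_add"
  shows "(\<Sum>k<2 * N. g k) = (\<Sum>k<N. g (2 * k)) + (\<Sum>k<N. g (2 * k + 1))"
  by (induction N) (simp_all add: algebra_simps)

lemma sum_lessThan_periodic:
  fixes g :: "nat \<Rightarrow> 'b::comm_semiring_1"
  assumes "\<And>k. g (k + M) = g k"
  shows "(\<Sum>k<e * M. g k) = of_nat e * (\<Sum>k<M. g k)"
proof (induction e)
  case (Suc e)
  have per: "g (k + e * M) = g k" for k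
  proof (induction e)
    case (Suc e)
    have "k + Suc e * M = (k + e * M) + M" by simp
    then show ?case using assms[of "k + e * M"] Suc by (simp only:)
  qed simp
  have "(\<Sum>k<Suc e * M. g k) = (\<Sum>k<e * M. g k) + (\<Sum>k\<in>{e * M..<e * M + M}. g k)"
    using sum.atLeastLessThan_concat[of 0 "e * M" "e * M + M" g]
    by (simp add: lessThan_atLeast0 add.commute)
  also have "(\<Sum>k\<in>{e * M..<e * M + M}. g k) = (\<Sum>k<M. g k)"
    using sum.shift_bounds_nat_ivl[of g 0 "e * M" M] by (simp add: lessThan_atLeast0 add.commute per)
  finally show ?case using Suc by (simp add: algebra_simps)
qed simp

lemma sum_powers_root_of_unity:
  assumes "e > 0"
  shows "(\<Sum>j<e. (root_of_unity e ^ k) ^ j) = (if e dvd k then of_nat e else 0)"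
proof (cases "e dvd k")
  case True
  then have "root_of_unity e ^ k = 1"
    using root_of_unity_power_self[OF assms] by (auto elim!: dvdE simp: power_mult)
  then show ?thesis using True by simp
next
  case False
  have "root_of_unity e ^ k \<noteq> 1"
  proof
    assume "root_of_unity e ^ k = 1"
    then have "cos (real k * (2 * pi / real e)) = 1"
      by (simp add: root_of_unity_eq_cis DeMoivre complex_eq_iff)
    then obtain x :: int where x: "real k * (2 * pi / real e) = of_int x * 2 * pi"
      using cos_one_2pi_int by blast
    have "2 * pi * real k = 2 * pi * (of_int x * real e)"
      using x assms by (simp add: field_simps)
    then have "real k = of_int x * real e" by simp
    then have "int k = x * int e" by (metis of_int_eq_iff of_int_mult of_int_of_nat_eq)
    then have "int e dvd int k" by simp
    then show False using False by simp
  qed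
  moreover have "(root_of_unity e ^ k) ^ e = 1"
    using root_of_unity_power_self[OF assms] by (simp add: power_commutes mult.commute flip: power_mult)
      (simp add: power_mult)
  ultimately show ?thesis using False by (simp add: geometric_sum)
qed

context generated_field
begin

text \<open>A multiplicative character is named by its value \<open>w\<close> at \<gamma>, so
  products and powers of characters become those of complex numbers. Its multiplicativity rests on
  \<open>w ^ q1 = 1\<close>, which makes the unspecified exponent chosen by \<open>dlog\<close>
  irrelevant.\<close>

definition mchar :: "complex \<Rightarrow> 'a \<Rightarrow> complex" where
  "mchar w x = (if x = 0 then 0 else w ^ dlog x)"

lemma mchar_0 [simp]: "mchar w 0 = 0"
  by (simp add: mchar_def)

lemma mchar_base_1: "mchar 1 x = (if x = 0 then 0 else 1)"
  by (simp add: mchar_def)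

lemma mchar_base_mult: "mchar (v * w) x = mchar v x * mchar w x"
  by (simp add: mchar_def power_mult_distrib)

lemma mchar_base_power: "k > 0 \<Longrightarrow> mchar (w ^ k) x = mchar w x ^ k"
  by (simp add: mchar_def power_0_left mult.commute flip: power_mult)

lemma mchar_base_cnj: "mchar (cnj w) x = cnj (mchar w x)"
  by (simp add: mchar_def)

lemma root_power_cong:
  assumes "(w::complex) ^ n = 1" "[a = b] (mod n)"
  shows "w ^ a = w ^ b"
proof -
  have "w ^ k = w ^ (k mod n)" for k
  proof -
    have "w ^ k = w ^ (n * (k div n) + k mod n)" by simp
    also have "\<dots> = w ^ (k mod n)" using assms(1) by (simp only: power_add power_mult) simp
    finally show ?thesis .
  qed
  then show ?thesis using assms(2) by (metis cong_def)
qed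

lemma mchar_gamma_power:
  assumes "w ^ q1 = 1"
  shows "mchar w (\<gamma> ^ k) = w ^ k"
proof -
  have "[dlog (\<gamma> ^ k) = k] (mod q1)"
    using gamma_power_dlog[of "\<gamma> ^ k"] by (simp flip: gamma_power_eq_iff)
  then show ?thesis using root_power_cong[OF assms] by (simp add: mchar_def)
qed

lemma mchar_mult:
  assumes "w ^ q1 = 1"
  shows "mchar w (x * y) = mchar w x * mchar w y"
proof (cases "x = 0 \<or> y = 0")
  case False
  then obtain a b where "x = \<gamma> ^ a" "y = \<gamma> ^ b" by (meson obtain_gamma_power)
  then show ?thesis using mchar_gamma_power[OF assms] by (metis power_add)
qed auto

lemma mchar_1 [simp]: "w ^ q1 = 1 \<Longrightarrow> mchar w 1 = 1"
  using mchar_gamma_power[of w 0] by simp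

lemma mchar_power: "w ^ q1 = 1 \<Longrightarrow> mchar w (x ^ n) = mchar w x ^ n"
  by (induction n) (simp_all add: mchar_mult)

lemma root_norm_1:
  assumes "(w::complex) ^ q1 = 1"
  shows "norm w = 1"
proof -
  have "norm w ^ q1 = 1" using assms by (metis norm_one norm_power)
  then show ?thesis using q1_pos power_eq_imp_eq_base[of "norm w" q1 1] by simp
qed

lemma root_mult_cnj:
  assumes "(w::complex) ^ q1 = 1"
  shows "w * cnj w = 1" "cnj w * w = 1"
  using root_norm_1[OF assms] by (simp_all add: complex_norm_square[symmetric] mult.commute)

lemma mchar_mult_cnj:
  assumes "w ^ q1 = 1" "x \<noteq> 0"
  shows "mchar w x * cnj (mchar w x) = 1"
  using root_mult_cnj[OF assms(1)] assms(2)
  by (simp add: mchar_def flip: power_mult_distrib)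

lemma sum_mchar:
  assumes "w ^ q1 = 1" "w \<noteq> 1"
  shows "(\<Sum>x\<in>UNIV. mchar w x) = 0"
proof -
  have "(\<Sum>x\<in>UNIV. mchar w x) = (\<Sum>x\<in>UNIV - {0}. mchar w x)"
    by (rule sum.mono_neutral_right) auto
  also have "\<dots> = (\<Sum>k<q1. w ^ k)"
    by (simp add: sum_nonzero_eq_sum_gamma mchar_gamma_power[OF assms(1)])
  also have "\<dots> = 0" using assms by (simp add: geometric_sum)
  finally show ?thesis .
qed

definition gauss :: "complex \<Rightarrow> complex" where
  "gauss w = (\<Sum>x\<in>UNIV. mchar w x * \<psi> x)"

definition jacobi :: "complex \<Rightarrow> complex \<Rightarrow> complex" where
  "jacobi v w = (\<Sum>x\<in>UNIV. mchar v x * mchar w (1 - x))"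

lemma gauss_base_1: "gauss 1 = -1"
proof -
  have "gauss 1 = (\<Sum>x\<in>UNIV - {0}. \<psi> x)"
    unfolding gauss_def by (rule sum.mono_neutral_cong_right) (auto simp: mchar_base_1)
  also have "\<dots> = -1" using sum_psi by (simp add: sum_diff1)
  finally show ?thesis .
qed

lemma gauss_scaled:
  assumes "w ^ q1 = 1" "a \<noteq> 0"
  shows "(\<Sum>x\<in>UNIV. mchar w x * \<psi> (a * x)) = cnj (mchar w a) * gauss w"
proof -
  have "gauss w = (\<Sum>x\<in>UNIV. mchar w (a * x) * \<psi> (a * x))"
    unfolding gauss_def
    by (rule sum.reindex_bij_witness[of _ "\<lambda>x. a * x" "\<lambda>x. x / a"]) (use assms in auto)
  also have "\<dots> = mchar w a * (\<Sum>x\<in>UNIV. mchar w x * \<psi> (a * x))"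
    by (simp add: mchar_mult assms sum_distrib_left mult.assoc)
  finally show ?thesis
    using mchar_mult_cnj[OF assms] by (simp add: mult.assoc[symmetric] mult.commute)
qed

text \<open>Frobenius permutes the field and preserves \<open>\<psi>\<close>, while it turns the
  character into its \<open>p\<close>-th power.\<close>

lemma gauss_frobenius:
  assumes "w ^ q1 = 1"
  shows "gauss (w ^ p ^ i) = gauss w"
proof (induction i)
  case (Suc i)
  have w: "(w ^ p ^ i) ^ q1 = 1" using assms by (metis power_commuting_commutes power_mult mult.commute power_one)
  have *: "(x ^ p) ^ (p ^ (s - 1)) = x" for x :: 'a
    using power_card[of x] s_pos by (simp flip: power_mult power_Suc)
  have "gauss (w ^ p ^ Suc i) = gauss ((w ^ p ^ i) ^ p)" by (simp flip: power_mult add: mult.commute)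
  also have "\<dots> = (\<Sum>x\<in>UNIV. mchar (w ^ p ^ i) (x ^ p) * \<psi> (x ^ p))"
    using psi_frobenius[of _ 1] p_gt_1 w by (simp add: gauss_def mchar_base_power mchar_power)
  also have "\<dots> = gauss (w ^ p ^ i)"
    unfolding gauss_def
    by (rule sum.reindex_bij_witness[of _ "\<lambda>x. x ^ p ^ (s - 1)" "\<lambda>x. x ^ p"])
      (use * in \<open>auto simp flip: power_mult simp: mult.commute\<close>)
  finally show ?case using Suc by simp
qed simp

lemma norm_gauss:
  assumes "w ^ q1 = 1" "w \<noteq> 1"
  shows "gauss w * cnj (gauss w) = of_nat (p ^ s)"
proof -
  have "gauss w * cnj (gauss w) = (\<Sum>y\<in>UNIV. cnj (mchar w y) * \<psi> (- y) * gauss w)"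
    by (simp add: gauss_def[of w] sum_distrib_left sum_distrib_right psi_minus mult_ac)
  also have "\<dots> = (\<Sum>y\<in>UNIV - {0}. \<psi> (- y) * (cnj (mchar w y) * gauss w))"
    by (rule sum.mono_neutral_cong_right) auto
  also have "\<dots> = (\<Sum>y\<in>UNIV - {0}. \<psi> (- y) * (\<Sum>x\<in>UNIV. mchar w x * \<psi> (y * x)))"
    using gauss_scaled[OF assms(1)] by (intro sum.cong) auto
  also have "\<dots> = (\<Sum>y\<in>UNIV - {0}. \<Sum>x\<in>UNIV. mchar w x * \<psi> ((x - 1) * y))"
    by (simp add: sum_distrib_left algebra_simps flip: psi_add)
  also have "\<dots> = (\<Sum>x\<in>UNIV. mchar w x * (\<Sum>y\<in>UNIV - {0}. \<psi> ((x - 1) * y)))"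
    unfolding sum_distrib_left by (rule sum.swap)
  also have "\<dots> = (\<Sum>x\<in>UNIV. mchar w x * (if x = 1 then of_nat (p ^ s) else 0) - mchar w x)"
  proof (rule sum.cong)
    fix x
    have "(\<Sum>y\<in>UNIV - {0}. \<psi> ((x - 1) * y)) = (if x = 1 then of_nat (p ^ s) else 0) - 1"
      using sum_psi_scaled[of "x - 1"] by (simp add: sum_diff1)
    then show "mchar w x * (\<Sum>y\<in>UNIV - {0}. \<psi> ((x - 1) * y))
        = mchar w x * (if x = 1 then of_nat (p ^ s) else 0) - mchar w x"
      by (simp add: right_diff_distrib)
  qed simp
  also have "\<dots> = of_nat (p ^ s)"
    using assms by (simp add: sum_subtractf sum_mchar if_distrib[of "(*) _"] sum.delta cong: if_cong)
  finally show ?thesis .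
qed

lemma gauss_nonzero: "w ^ q1 = 1 \<Longrightarrow> w \<noteq> 1 \<Longrightarrow> gauss w \<noteq> 0"
  using norm_gauss[of w] p_gt_1 by auto

lemma gauss_cnj:
  assumes "w ^ q1 = 1"
  shows "gauss (cnj w) = mchar w (-1) * cnj (gauss w)"
proof -
  have "cnj (gauss w) = (\<Sum>x\<in>UNIV. mchar (cnj w) x * \<psi> (-1 * x))"
    by (simp add: gauss_def mchar_base_cnj psi_minus)
  also have "\<dots> = cnj (mchar (cnj w) (-1)) * gauss (cnj w)"
    by (rule gauss_scaled) (use assms in \<open>simp_all flip: complex_cnj_power\<close>)
  finally have *: "cnj (gauss w) = mchar w (-1) * gauss (cnj w)" by (simp add: mchar_base_cnj)
  have "mchar w (-1) * mchar w (-1) = mchar w ((-1) * (-1))" by (simp only: mchar_mult[OF assms])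
  then have "mchar w (-1) * mchar w (-1) = 1" using assms by simp
  then show ?thesis unfolding * by (simp flip: mult.assoc)
qed

lemma gauss_mult_gauss:
  assumes v: "v ^ q1 = 1" and w: "w ^ q1 = 1" and vw: "v * w \<noteq> 1"
  shows "gauss v * gauss w = jacobi v w * gauss (v * w)"
proof -
  have vw1: "(v * w) ^ q1 = 1" using v w by (simp add: power_mult_distrib)
  have "gauss v * gauss w = (\<Sum>x\<in>UNIV. \<Sum>y\<in>UNIV. mchar v x * mchar w y * \<psi> (x + y))"
    by (simp add: gauss_def sum_product psi_add mult_ac)
  also have "\<dots> = (\<Sum>x\<in>UNIV. \<Sum>t\<in>UNIV. mchar v x * mchar w (t - x) * \<psi> t)"
  proof (rule sum.cong)
    show "(\<Sum>y\<in>UNIV. mchar v x * mchar w y * \<psi> (x + y)) = (\<Sum>t\<in>UNIV. mchar v x * mchar w (t - x) * \<psi> t)" for x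
      by (rule sum.reindex_bij_witness[of _ "\<lambda>t. t - x" "\<lambda>y. x + y"]) auto
  qed simp
  also have "\<dots> = (\<Sum>t\<in>UNIV. (\<Sum>x\<in>UNIV. mchar v x * mchar w (t - x)) * \<psi> t)"
    unfolding sum_distrib_right by (rule sum.swap)
  also have "\<dots> = (\<Sum>t\<in>UNIV. jacobi v w * (mchar (v * w) t * \<psi> t))"
  proof (rule sum.cong)
    fix t
    show "(\<Sum>x\<in>UNIV. mchar v x * mchar w (t - x)) * \<psi> t = jacobi v w * (mchar (v * w) t * \<psi> t)"
    proof (cases "t = 0")
      case True
      have "(\<Sum>x\<in>UNIV. mchar v x * mchar w (- x)) = (\<Sum>x\<in>UNIV. mchar w (-1) * mchar (v * w) x)"
      proof (rule sum.cong)
        fix x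
        have "mchar w (- x) = mchar w (-1) * mchar w x" using mchar_mult[OF w, of "-1" x] by simp
        then show "mchar v x * mchar w (- x) = mchar w (-1) * mchar (v * w) x"
          by (simp only: mchar_base_mult mult_ac)
      qed simp
      also have "\<dots> = 0" using sum_mchar[OF vw1 vw] by (simp flip: sum_distrib_left)
      finally show ?thesis using True by simp
    next
      case False
      have "(\<Sum>x\<in>UNIV. mchar v x * mchar w (t - x)) = (\<Sum>u\<in>UNIV. mchar v (t * u) * mchar w (t - t * u))"
        by (rule sum.reindex_bij_witness[of _ "\<lambda>u. t * u" "\<lambda>x. x / t"]) (use False in auto)
      also have "\<dots> = (\<Sum>u\<in>UNIV. mchar v (t * u) * mchar w (t * (1 - u)))"
        by (simp add: algebra_simps)
      also have "\<dots> = mchar (v * w) t * jacobi v w"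
        by (simp add: jacobi_def mchar_base_mult mchar_mult v w sum_distrib_left mult_ac)
      finally show ?thesis by simp
    qed
  qed simp
  also have "\<dots> = jacobi v w * gauss (v * w)" by (simp add: gauss_def sum_distrib_left)
  finally show ?thesis .
qed

lemma root_of_unity_power_q1:
  assumes "e dvd q1"
  shows "(root_of_unity e ^ j) ^ q1 = 1"
proof -
  obtain M where M: "q1 = e * M" using assms by blast
  have "e > 0" using q1_pos M by (intro gr0I) auto
  have "(root_of_unity e ^ j) ^ q1 = (root_of_unity e ^ e) ^ (M * j)"
    unfolding M by (simp add: mult_ac flip: power_mult)
  then show ?thesis using root_of_unity_power_self[OF \<open>e > 0\<close>] by simp
qed

text \<open>At a nonzero \<open>x\<close> the characters with bases
  \<open>root_of_unity e ^ j\<close> add up to the number of \<open>e\<close>-th roots of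
  \<open>x\<close>. They all vanish at 0, hence the separate summand \<open>f 0\<close>.\<close>

lemma sum_power_eq_sum_mchar:
  fixes f :: "'a \<Rightarrow> complex"
  assumes e: "e dvd q1"
  shows "(\<Sum>x\<in>UNIV. f (x ^ e)) = f 0 + (\<Sum>j<e. \<Sum>x\<in>UNIV. mchar (root_of_unity e ^ j) x * f x)"
proof -
  obtain M where M: "q1 = e * M" using e by blast
  have e0: "e > 0" using q1_pos M by (intro gr0I) auto
  note root = root_of_unity_power_q1[OF e]
  have "(\<Sum>j<e. \<Sum>x\<in>UNIV. mchar (root_of_unity e ^ j) x * f x)
      = (\<Sum>x\<in>UNIV. \<Sum>j<e. mchar (root_of_unity e ^ j) x * f x)"
    by (rule sum.swap)
  also have "\<dots> = (\<Sum>x\<in>UNIV - {0}. (\<Sum>j<e. mchar (root_of_unity e ^ j) x) * f x)"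
    by (rule sum.mono_neutral_cong_right) (auto simp: sum_distrib_right)
  also have "\<dots> = (\<Sum>k<q1. (\<Sum>j<e. (root_of_unity e ^ k) ^ j) * f (\<gamma> ^ k))"
  proof -
    have "mchar (root_of_unity e ^ j) (\<gamma> ^ k) = (root_of_unity e ^ k) ^ j" for j k
      by (simp add: mchar_gamma_power[OF root] mult.commute flip: power_mult)
    then show ?thesis by (simp add: sum_nonzero_eq_sum_gamma)
  qed
  also have "\<dots> = (\<Sum>k<q1. (if e dvd k then of_nat e else 0) * f (\<gamma> ^ k))"
    by (simp only: sum_powers_root_of_unity[OF e0])
  also have "\<dots> = (\<Sum>k\<in>(*) e ` {..<M}. of_nat e * f (\<gamma> ^ k))"
    by (rule sum.mono_neutral_cong_right) (use e0 in \<open>auto simp: M elim!: dvdE\<close>)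
  also have "\<dots> = of_nat e * (\<Sum>k<M. f (\<gamma> ^ (e * k)))"
    using e0 by (subst sum.reindex) (auto simp: inj_on_def sum_distrib_left)
  also have "\<dots> = (\<Sum>k<e * M. f (\<gamma> ^ (e * k)))"
  proof (rule sum_lessThan_periodic[symmetric])
    have "\<gamma> ^ (e * (k + M)) = \<gamma> ^ (e * k)" for k
      unfolding gamma_power_eq_iff by (simp add: M cong_def algebra_simps)
    then show "f (\<gamma> ^ (e * (k + M))) = f (\<gamma> ^ (e * k))" for k by simp
  qed
  also have "\<dots> = (\<Sum>x\<in>UNIV - {0}. f (x ^ e))"
    by (simp add: sum_nonzero_eq_sum_gamma M mult.commute flip: power_mult)
  also have "\<dots> = (\<Sum>x\<in>UNIV. f (x ^ e)) - f 0"
    using e0 by (simp add: sum_diff1 power_0_left)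
  finally show ?thesis by simp
qed

lemma reduced_period_eq_sum_psi: "reduced_period s \<gamma> e k = (\<Sum>x\<in>UNIV. \<psi> (\<gamma> ^ k * x ^ e))"
  by (simp add: reduced_period_def \<psi>_def char)

lemma reduced_period_eq_sum_gauss:
  assumes e: "e dvd q1"
  shows "reduced_period s \<gamma> e k = 1 + (\<Sum>j<e. cnj (root_of_unity e) ^ (j * k) * gauss (root_of_unity e ^ j))"
proof -
  note root = root_of_unity_power_q1[OF e]
  show ?thesis
    unfolding reduced_period_eq_sum_psi
    by (subst sum_power_eq_sum_mchar[OF e])
      (simp add: gauss_scaled[OF root] mchar_gamma_power[OF root] power_mult)
qed

lemma two_neq_0:
  assumes "odd p"
  shows "(2::'a) \<noteq> 0"
proof
  assume "(2::'a) = 0"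
  then have "p dvd 2" using of_nat_eq_0_iff_char_dvd[where ?'a = 'a, of 2] char by simp
  then have "p = 2" using prime_p two_is_prime_nat primes_dvd_imp_eq by blast
  then show False using assms by simp
qed

text \<open>Completing the square: with \<open>x = (1 + y) / 2\<close> one has
  \<open>4 * x * (1 - x) = 1 - y ^ 2\<close>, and the number of square roots of an element is 1 plus
  its quadratic character, whose base is \<open>-1\<close>.\<close>

lemma sum_mchar_square_shift:
  assumes "odd p" "w ^ q1 = 1" "w \<noteq> 1"
  shows "jacobi w w = cnj (mchar w 4) * jacobi w (-1)"
proof -
  have two: "(2::'a) \<noteq> 0" by (rule two_neq_0[OF assms(1)])
  then have four: "(4::'a) \<noteq> 0" by (metis mult_2 mult_eq_0_iff numeral_Bit0 numeral_One one_add_one)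
  have ev: "2 dvd q1"
  proof -
    have "odd (p ^ s)" using assms(1) by simp
    then show ?thesis by (simp add: q1_def)
  qed
  have r2: "root_of_unity 2 = -1" by (simp add: root_of_unity_eq_cis)
  have "jacobi w w = (\<Sum>x\<in>UNIV. mchar w (x * (1 - x)))"
    by (simp add: jacobi_def mchar_mult assms)
  also have "\<dots> = (\<Sum>y\<in>UNIV. mchar w ((1 + y) / 2 * (1 - (1 + y) / 2)))"
    by (rule sum.reindex_bij_witness[of _ "\<lambda>y. (1 + y) / 2" "\<lambda>x. 2 * x - 1"]) (use two in \<open>auto simp: field_simps\<close>)
  also have "\<dots> = (\<Sum>y\<in>UNIV. cnj (mchar w 4) * mchar w (1 - y ^ 2))"
  proof (rule sum.cong)
    fix y :: 'a
    define h where "h = (1 + y) / 2"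
    have h: "2 * h = 1 + y" using two by (simp add: h_def)
    have "4 * (h * (1 - h)) = 2 * h * (2 - 2 * h)" by (simp add: algebra_simps)
    also have "\<dots> = 1 - y ^ 2" unfolding h by (simp add: algebra_simps power2_eq_square)
    finally have "4 * ((1 + y) / 2 * (1 - (1 + y) / 2)) = 1 - y ^ 2" by (simp only: h_def)
    then have "mchar w 4 * mchar w ((1 + y) / 2 * (1 - (1 + y) / 2)) = mchar w (1 - y ^ 2)"
      by (simp only: mchar_mult[OF assms(2), symmetric])
    then have "(mchar w 4 * cnj (mchar w 4)) * mchar w ((1 + y) / 2 * (1 - (1 + y) / 2))
        = cnj (mchar w 4) * mchar w (1 - y ^ 2)"
      by (metis mult.assoc mult.commute)
    then show "mchar w ((1 + y) / 2 * (1 - (1 + y) / 2)) = cnj (mchar w 4) * mchar w (1 - y ^ 2)"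
      using mchar_mult_cnj[OF assms(2) four] by simp
  qed simp
  also have "\<dots> = cnj (mchar w 4) * (\<Sum>y\<in>UNIV. mchar w (1 - y ^ 2))"
    by (simp add: sum_distrib_left)
  also have "(\<Sum>y\<in>UNIV. mchar w (1 - y ^ 2))
      = mchar w (1 - 0) + (\<Sum>j<2. \<Sum>x\<in>UNIV. mchar (root_of_unity 2 ^ j) x * mchar w (1 - x))"
    by (rule sum_power_eq_sum_mchar[OF ev])
  also have "\<dots> = 1 + (\<Sum>x\<in>UNIV. mchar 1 x * mchar w (1 - x)) + (\<Sum>x\<in>UNIV. mchar (-1) x * mchar w (1 - x))"
    using assms by (simp add: numeral_2_eq_2 r2[unfolded numeral_2_eq_2])
  also have "(\<Sum>x\<in>UNIV. mchar 1 x * mchar w (1 - x)) = (\<Sum>x\<in>UNIV - {0}. mchar w (1 - x))"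
    by (rule sum.mono_neutral_cong_right) (auto simp: mchar_base_1)
  also have "\<dots> = (\<Sum>x\<in>UNIV. mchar w (1 - x)) - 1" using assms by (simp add: sum_diff1)
  also have "(\<Sum>x\<in>UNIV. mchar w (1 - x)) = (\<Sum>x\<in>UNIV. mchar w x)"
    by (rule sum.reindex_bij_witness[of _ "\<lambda>x. 1 - x" "\<lambda>x. 1 - x"]) auto
  also have "\<dots> = 0" using sum_mchar assms by blast
  also have "(\<Sum>x\<in>UNIV. mchar (-1) x * mchar w (1 - x)) = jacobi w (-1)"
    unfolding jacobi_def by (rule sum.reindex_bij_witness[of _ "\<lambda>x. 1 - x" "\<lambda>x. 1 - x"]) auto
  finally show ?thesis by simp
qed

text \<open>The duplication formula for Gauss sums, with the Jacobi sum left unevaluated; Frobenius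
  will evaluate it for characters of order at least 8.\<close>

lemma gauss_square:
  assumes "odd p" "w ^ q1 = 1" "w\<^sup>2 \<noteq> 1"
  shows "(gauss w)\<^sup>2 = cnj (mchar w 4) * jacobi w (-1) * gauss (w\<^sup>2)"
proof -
  have "w \<noteq> 1" using assms(3) by auto
  then show ?thesis
    using gauss_mult_gauss[OF assms(2,2)] sum_mchar_square_shift[OF assms(1,2)] assms(3)
    by (simp add: power2_eq_square)
qed

end

subsection \<open>Characters of 2-power order\<close>

lemma odd_power_two_adic:
  fixes x u :: nat
  assumes "x = 1 + 2 ^ Suc a * u" "odd u" "odd k"
  shows "\<exists>w. odd w \<and> x ^ k = 1 + 2 ^ Suc a * w"
proof -
  obtain l where l: "k = 2 * l + 1" using assms(3) by (elim oddE)
  have "\<exists>w. odd w \<and> x ^ (2 * l + 1) = 1 + 2 ^ Suc a * w"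
  proof (induction l)
    case 0
    then show ?case using assms by auto
  next
    case (Suc l)
    then obtain w where w: "odd w" "x ^ (2 * l + 1) = 1 + 2 ^ Suc a * w" by blast
    define z where "z = u + 2 ^ a * u\<^sup>2"
    have x2: "x\<^sup>2 = 1 + 2 ^ Suc a * (2 * z)"
      unfolding assms(1) z_def by (simp add: power2_eq_square algebra_simps)
    have "x ^ (2 * Suc l + 1) = x ^ (2 * l + 1) * x\<^sup>2"
      by (simp add: power2_eq_square algebra_simps)
    also have "\<dots> = 1 + 2 ^ Suc a * (w + 2 * (z * (1 + 2 ^ Suc a * w)))"
      unfolding w(2) x2 by (simp add: algebra_simps)
    finally show ?case using w(1) by (intro exI[of _ "w + 2 * (z * (1 + 2 ^ Suc a * w))"]) simp
  qed
  then show ?thesis by (simp only: l)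
qed

text \<open>Lifting the exponent at 2: the valuation of \<open>p ^ n - 1\<close> is that of
  \<open>n\<close> plus 2. This ties the available character orders to the power of 2 in
  \<open>s\<close>.\<close>

lemma power_minus_1_two_adic:
  fixes p :: nat
  assumes "[p = 5] (mod 8)" "odd k"
  shows "\<exists>w. odd w \<and> p ^ (2 ^ j * k) - 1 = 2 ^ (j + 2) * w"
proof -
  obtain u where u: "odd u" "p ^ 2 ^ j = 1 + 2 ^ Suc (Suc j) * u"
    using two_power_exact_dvd_pow_diff_1[OF assms(1), of j] by auto
  obtain w where "odd w" "(p ^ 2 ^ j) ^ k = 1 + 2 ^ Suc (Suc j) * w"
    using odd_power_two_adic[OF u(2,1) assms(2)] by blast
  then show ?thesis by (intro exI[of _ w]) (simp add: power_mult)
qed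

lemma even_card_involution:
  assumes "finite S" "\<And>x. x \<in> S \<Longrightarrow> f x \<in> S" "\<And>x. x \<in> S \<Longrightarrow> f (f x) = x"
  shows "even (card S) \<longleftrightarrow> even (card {x \<in> S. f x = x})"
  using assms
proof (induction "card S" arbitrary: S rule: less_induct)
  case less
  show ?case
  proof (cases "\<exists>x\<in>S. f x \<noteq> x")
    case True
    then obtain x where x: "x \<in> S" "f x \<noteq> x" by blast
    define T where "T = S - {x, f x}"
    have S: "S = insert x (insert (f x) T)" using x less.prems by (auto simp: T_def)
    have T: "finite T" "x \<notin> insert (f x) T" "f x \<notin> T" using less.prems x by (auto simp: T_def)
    then have card: "card S = Suc (Suc (card T))" by (subst S) simp
    have "even (card T) \<longleftrightarrow> even (card {x \<in> T. f x = x})"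
    proof (rule less.hyps)
      fix y assume y: "y \<in> T"
      then have "f y \<in> S" "y \<noteq> x" "y \<noteq> f x" "f (f y) = y" using less.prems by (auto simp: T_def)
      moreover have "f y \<noteq> x" "f y \<noteq> f x"
        using calculation less.prems(3)[of x] x(1) by metis+
      ultimately show "f y \<in> T" "f (f y) = y" by (auto simp: T_def)
    qed (use card T in auto)
    moreover have "{y \<in> T. f y = y} = {y \<in> S. f y = y}"
      using x less.prems(3)[of x] by (auto simp: T_def)
    ultimately show ?thesis using card by simp
  next
    case False
    then have "{x \<in> S. f x = x} = S" by auto
    then show ?thesis by simp
  qed
qed

abbreviation zt :: "nat \<Rightarrow> complex" where "zt n \<equiv> root_of_unity (2 ^ n)"

lemma zt_power_self [simp]: "zt n ^ 2 ^ n = 1"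
  by (rule root_of_unity_power_self) simp

lemma zt_Suc_square: "(zt (Suc n))\<^sup>2 = zt n"
  by (simp add: root_of_unity_eq_cis DeMoivre)

lemma zt_1: "zt 1 = -1"
  by (simp add: root_of_unity_eq_cis)

lemma zt_2: "zt 2 = \<i>"
  by (simp add: root_of_unity_eq_cis complex_eq_iff)

lemma zt_power_diff: "m \<le> n \<Longrightarrow> zt n ^ 2 ^ (n - m) = zt m"
proof (induction n rule: dec_induct)
  case (step n)
  have "zt (Suc n) ^ 2 ^ (Suc n - m) = ((zt (Suc n))\<^sup>2) ^ 2 ^ (n - m)"
    using step by (simp add: Suc_diff_le power_mult)
  then show ?case using step by (simp only: zt_Suc_square)
qed simp

lemma zt_power_half: "zt (Suc n) ^ 2 ^ n = -1"
  using zt_power_diff[of 1 "Suc n"] zt_1 by simp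

lemma zt_neq_1: "n > 0 \<Longrightarrow> zt n \<noteq> 1"
  using zt_power_half[of "n - 1"] by (auto simp: Suc_diff_1)

text \<open>\<open>v\<close> is the 2-adic valuation of \<open>s\<close>, so \<open>q1\<close> has
  valuation \<open>v + 2\<close> and \<open>zt n\<close> is the base of a character for
  \<open>n <= v + 2\<close>. The bound \<open>v >= 2\<close> is what \<open>m >= 4\<close> and
  \<open>m <= v + 2\<close> give.\<close>

locale field_5_mod_8 = generated_field \<gamma> p s for \<gamma> :: "'a::{field,finite}" and p s +
  fixes v :: nat
  assumes p5: "[p = 5] (mod 8)" and v: "2 ^ v dvd s" "\<not> 2 ^ Suc v dvd s" and v_ge_2: "v \<ge> 2"
begin

lemma odd_p: "odd p"
  using p5 unfolding cong_def by presburger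

lemma p_1_mod_4: "[p = 1] (mod 4)"
proof -
  have "p mod 8 = 5" using p5 unfolding cong_def by simp
  then have "p mod 4 = 1" by presburger
  then show ?thesis by (simp add: cong_def)
qed

lemma int_p_1_mod_4: "[int p = 1] (mod 4)"
proof -
  have "[int p = int 1] (mod int 4)" using p_1_mod_4 by (simp only: cong_int_iff)
  then show ?thesis by simp
qed

lemma four_dvd_s: "4 dvd s"
proof -
  have "(2::nat) ^ 2 dvd 2 ^ v" by (rule le_imp_power_dvd) (rule v_ge_2)
  then show ?thesis using v(1) by (auto intro: dvd_trans)
qed

lemmas p_power_two_adic = power_minus_1_two_adic[OF p5]

lemma odd_s_div: "odd (s div 2 ^ v)" and s_eq: "s = 2 ^ v * (s div 2 ^ v)"
proof -
  show s: "s = 2 ^ v * (s div 2 ^ v)" using v(1) by simp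
  show "odd (s div 2 ^ v)"
  proof
    assume "even (s div 2 ^ v)"
    then obtain k where "s div 2 ^ v = 2 * k" by blast
    then have "s = 2 ^ Suc v * k" using s by (metis mult.assoc mult.commute power_Suc)
    then show False using v(2) by simp
  qed
qed

lemma q1_two_adic: obtains u where "odd u" "q1 = 2 ^ (v + 2) * u"
  using p_power_two_adic[OF odd_s_div, of v] s_eq by (auto simp: q1_def)

lemma two_power_dvd_q1: "n \<le> v + 2 \<Longrightarrow> 2 ^ n dvd q1"
  by (metis q1_two_adic dvd_mult2 le_imp_power_dvd)

lemma zt_power_q1 [simp]: "n \<le> v + 2 \<Longrightarrow> zt n ^ q1 = 1"
  using two_power_dvd_q1[of n] by (auto elim!: dvdE simp: power_mult)

text \<open>For odd \<open>k\<close> the valuation of \<open>p ^ k - 1\<close> is only 2, so the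
  index of the multiplicative group of this subfield keeps exactly \<open>2 ^ v\<close>. Its
  elements are therefore \<open>2 ^ v\<close>-th powers in the big field.\<close>

lemma subfield_index_two_adic:
  assumes "odd k" "k dvd s"
  obtains u where "odd u" "q1 div (p ^ k - 1) = 2 ^ v * u"
proof -
  define N where "N = q1 div (p ^ k - 1)"
  obtain u where u: "odd u" "q1 = 2 ^ (v + 2) * u" by (rule q1_two_adic)
  obtain w where w: "odd w" "p ^ k - 1 = 4 * w" using p_power_two_adic[OF assms(1), of 0] by auto
  have "q1 = N * (p ^ k - 1)" unfolding N_def by (rule q_minus_1_factor[OF assms(2)])
  then have "2 ^ (v + 2) * u = N * (4 * w)" by (simp only: u(2) w(2))
  then have "4 * (N * w) = 4 * (2 ^ v * u)" by (simp add: mult_ac)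
  then have eq: "N * w = 2 ^ v * u" by simp
  then have "2 ^ v dvd N * w" by simp
  moreover have "coprime (2 ^ v) w" using w(1) by simp
  ultimately have "2 ^ v dvd N" by (simp add: coprime_dvd_mult_left_iff)
  then obtain N' where N': "N = 2 ^ v * N'" by blast
  then have "N' * w = u" using eq by simp
  then have "odd N'" using u(1) by auto
  then show ?thesis using that N' by (simp add: N_def)
qed

lemma gamma_power_half: "\<gamma> ^ (q1 div 2) = -1"
proof -
  have ev: "2 dvd q1" using two_power_dvd_q1[of 1] by simp
  have "(\<gamma> ^ (q1 div 2))\<^sup>2 = 1"
    using ev power_card_minus_1[OF gamma_nonzero] by (simp flip: power_mult)
  moreover have "\<gamma> ^ (q1 div 2) \<noteq> \<gamma> ^ 0"
    unfolding gamma_power_eq_iff using q1_pos ev by (auto simp: cong_def elim!: dvdE)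
  ultimately show ?thesis by (simp add: power2_eq_1_iff)
qed

text \<open>The exponent of \<open>-1\<close> as a power of \<gamma> has valuation exactly
  \<open>v + 1\<close>, so among these characters only the one of top order is odd.\<close>

lemma mchar_minus_1: "n \<le> v + 1 \<Longrightarrow> mchar (zt n) (-1) = 1"
  and mchar_minus_1_top: "mchar (zt (v + 2)) (-1) = -1"
proof -
  obtain u where u: "odd u" "q1 = 2 ^ (v + 2) * u" by (rule q1_two_adic)
  have *: "mchar (zt n) (-1) = zt n ^ (2 ^ (v + 1) * u)" if "n \<le> v + 2" for n
    using mchar_gamma_power[OF zt_power_q1[OF that], of "q1 div 2"]
    unfolding gamma_power_half by (simp add: u(2) mult_ac)
  show "mchar (zt n) (-1) = 1" if n: "n \<le> v + 1"
  proof -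
    have "(2::nat) ^ (v + 1) = 2 ^ n * 2 ^ (v + 1 - n)" using n by (simp flip: power_add)
    then show ?thesis using * n by (simp only: power_mult) simp
  qed
  show "mchar (zt (v + 2)) (-1) = -1"
    using *[of "v + 2"] zt_power_half[of "v + 1"] u(1) by (simp add: power_mult)
qed

text \<open>
  Since \<open>(1 + \<iota>)\<^sup>2 = 2 * \<iota>\<close> for a square root \<open>\<iota>\<close> of \<open>-1\<close>, and \<open>\<iota>\<close> is a nonsquare of the prime
  field because \<open>p\<close> is not \<open>1\<close> modulo \<open>8\<close>, the number \<open>2\<close> is a nonsquare there as well.
\<close>

lemma dlog_2_two_adic:
  obtains j where "odd j" "2 = \<gamma> ^ (2 ^ v * j)"
proof -
  define N where "N = q1 div (p - 1)"
  obtain u where u: "odd u" "N = 2 ^ v * u" using subfield_index_two_adic[of 1] by (auto simp: N_def)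
  obtain w where w: "odd w" "p - 1 = 4 * w" using p_power_two_adic[of 1 0] by auto
  have q1: "q1 = N * (p - 1)" using q_minus_1_factor[of 1] by (simp add: N_def)
  have sub: "\<exists>l. x = \<gamma> ^ (N * l)" if x: "x \<in> subfield 1" "x \<noteq> 0" for x
  proof -
    obtain k where k: "x = \<gamma> ^ k" using obtain_gamma_power[OF x(2)] by blast
    then have "N dvd k" using gamma_power_in_subfield_iff[of 1 k] x(1) by (simp add: N_def)
    then show ?thesis using k by (auto elim!: dvdE)
  qed
  define \<iota> where "\<iota> = \<gamma> ^ (N * w)"
  have \<iota>2: "\<iota>\<^sup>2 = -1"
  proof -
    have "q1 div 2 = N * w * 2" using q1 w(2) by simp
    then show ?thesis using gamma_power_half by (simp only: \<iota>_def power_mult)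
  qed
  have \<iota>1: "\<iota> \<in> subfield 1" using gamma_power_in_subfield_iff[of 1 "N * w"] by (simp add: \<iota>_def N_def)
  have "(2::'a) \<in> subfield 1" using subfield_of_nat[of 2 1] by simp
  then obtain j where j: "(2::'a) = \<gamma> ^ (N * j)" using sub two_neq_0[OF odd_p] by blast
  have sq: "(1 + \<iota>)\<^sup>2 = 2 * \<iota>" using \<iota>2 by (simp add: power2_eq_square algebra_simps)
  then have "1 + \<iota> \<noteq> 0" using two_neq_0[OF odd_p] by (auto simp: \<iota>_def)
  then obtain l where l: "1 + \<iota> = \<gamma> ^ (N * l)" using sub \<iota>1 subfield_add[of 1 1 \<iota>] by auto
  have "(\<gamma> ^ (N * l))\<^sup>2 = \<gamma> ^ (N * j) * \<gamma> ^ (N * w)"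
    using sq unfolding l unfolding j \<iota>_def .
  moreover have "(\<gamma> ^ (N * l))\<^sup>2 = \<gamma> ^ (N * (2 * l))"
    by (simp only: power_mult[symmetric] mult_ac)
  ultimately have "\<gamma> ^ (N * (2 * l)) = \<gamma> ^ (N * (j + w))"
    by (simp only: distrib_left power_add)
  \<comment> \<open>Exponents in \<open>(1 + \<iota>) ^ 2 = 2 * \<iota>\<close> are compared modulo
    the even number \<open>p - 1\<close>, after cancelling \<open>N\<close>: \<open>j + w\<close> is
    even and \<open>w\<close> is odd.\<close>
  then have "[N * (2 * l) = N * (j + w)] (mod (N * (p - 1)))"
    unfolding gamma_power_eq_iff q1 .
  then have "N * ((2 * l) mod (p - 1)) = N * ((j + w) mod (p - 1))"
    by (simp only: cong_def mult_mod_right)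
  moreover have "N > 0" using q1 q1_pos by (intro gr0I) simp
  ultimately have "(2 * l) mod (4 * w) = (j + w) mod (4 * w)" using w(2) by simp
  then have "(2 * l) mod (4 * w) mod 2 = (j + w) mod (4 * w) mod 2" by simp
  then have "(2 * l) mod 2 = (j + w) mod 2" by (simp add: mod_mod_cancel)
  then have "odd j" using w(1) by presburger
  then show ?thesis using that[of "u * j"] u j by (simp add: mult_ac)
qed

text \<open>The exponent of 2 has valuation exactly \<open>v\<close>, so that of 4 has valuation
  \<open>v + 1\<close>, as for \<open>-1\<close>. This is the source of the sign change in the
  duplication formula at \<open>n = v + 2\<close>.\<close>

lemma mchar_4: "n \<le> v + 1 \<Longrightarrow> mchar (zt n) 4 = 1"
  and mchar_4_top: "mchar (zt (v + 2)) 4 = -1"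
proof -
  obtain j where j: "odd j" "(2::'a) = \<gamma> ^ (2 ^ v * j)" by (rule dlog_2_two_adic)
  have four: "(4::'a) = \<gamma> ^ (2 ^ (v + 1) * j)"
  proof -
    have "(4::'a) = 2 * 2" by simp
    also have "\<dots> = \<gamma> ^ (2 ^ v * j + 2 ^ v * j)" by (simp only: j(2) power_add)
    also have "2 ^ v * j + 2 ^ v * j = 2 ^ (v + 1) * j" by simp
    finally show ?thesis .
  qed
  have *: "mchar (zt n) 4 = zt n ^ (2 ^ (v + 1) * j)" if "n \<le> v + 2" for n
    unfolding four by (rule mchar_gamma_power[OF zt_power_q1[OF that]])
  show "mchar (zt n) 4 = 1" if n: "n \<le> v + 1"
  proof -
    have "(2::nat) ^ (v + 1) = 2 ^ n * 2 ^ (v + 1 - n)" using n by (simp flip: power_add)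
    then show ?thesis using * n by (simp only: power_mult) simp
  qed
  show "mchar (zt (v + 2)) 4 = -1"
    using *[of "v + 2"] zt_power_half[of "v + 1"] j(1) by (simp add: power_mult)
qed

lemma gauss_power_1_mod_4:
  assumes "w ^ 2 ^ n = 1" "2 \<le> n" "n \<le> v + 2" "[j = 1] (mod 4)"
  shows "gauss (w ^ j) = gauss w"
proof -
  have w: "w ^ q1 = 1"
    using assms(1) two_power_dvd_q1[OF assms(3)] by (auto elim!: dvdE simp: power_mult)
  have n: "n - 2 + 2 = n" using assms(2) by simp
  obtain i where i: "[p ^ i = j] (mod 2 ^ (n - 2 + 2))"
    using cong_power_of_1_mod_4[OF p5 assms(4)] by blast
  have "w ^ p ^ i = w ^ j" by (rule root_power_cong[OF assms(1)]) (use i in \<open>simp only: n\<close>)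
  then show ?thesis using gauss_frobenius[OF w, of i] by simp
qed

text \<open>\<open>- zt n\<close> is \<open>zt n\<close> to the power
  \<open>2 ^ (n - 1) + 1\<close>, an exponent that is 1 modulo 4 only from \<open>n = 3\<close>
  on.\<close>

lemma gauss_minus_zt:
  assumes "3 \<le> n" "n \<le> v + 2"
  shows "gauss (- zt n) = gauss (zt n)"
proof -
  have n: "n = Suc (n - 1)" "n - 1 = 2 + (n - 3)" using assms by auto
  have "zt n ^ 2 ^ (n - 1) = -1" using zt_power_half[of "n - 1"] n(1) by simp
  then have "- zt n = zt n ^ (2 ^ (n - 1) + 1)" by simp
  moreover have "[2 ^ (n - 1) + 1 = (1::nat)] (mod 4)"
    unfolding n(2) by (simp add: cong_def power_add)
  ultimately show ?thesis using gauss_power_1_mod_4[of "zt n" n "2 ^ (n - 1) + 1"] assms by simp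
qed

lemma minus_1_power_q1: "(-1::complex) ^ q1 = 1"
  using zt_power_q1[of 1] zt_1 by simp

text \<open>As the quadratic twist leaves the Gauss sum unchanged, it cancels from both sides of the
  product formula for \<open>gauss (zt n) * gauss (-1)\<close>, and the Jacobi sum is
  \<open>gauss (-1)\<close> itself. Inserting this in the duplication formula gives the
  recursion.\<close>

lemma gauss_zt_square:
  assumes "3 \<le> n" "n \<le> v + 2"
  shows "(gauss (zt n))\<^sup>2 = (if n = v + 2 then -1 else 1) * gauss (-1) * gauss (zt (n - 1))"
proof -
  have n: "n = Suc (n - 1)" using assms by auto
  have ne: "(zt n)\<^sup>2 \<noteq> 1"
    using zt_Suc_square[of "n - 1"] zt_neq_1[of "n - 1"] n assms(1) by simp
  then have "zt n * (-1) \<noteq> 1" by (metis minus_equation_iff mult_minus1_right power2_minus power_one)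
  from gauss_mult_gauss[OF zt_power_q1[OF assms(2)] minus_1_power_q1 this]
  have "gauss (zt n) * gauss (-1) = jacobi (zt n) (-1) * gauss (zt n)"
    using gauss_minus_zt[OF assms] by simp
  moreover have "gauss (zt n) \<noteq> 0"
    using gauss_nonzero zt_neq_1[of n] assms by simp
  ultimately have "jacobi (zt n) (-1) = gauss (-1)" by (simp add: mult.commute)
  then show ?thesis
    using gauss_square[OF odd_p zt_power_q1[OF assms(2)] ne] mchar_4[of n] mchar_4_top
      zt_Suc_square[of "n - 1"] n assms by (auto split: if_splits)
qed

end

lemma two_power_dvd_mult_odd: "odd w \<Longrightarrow> (2::nat) ^ n dvd a * w \<Longrightarrow> 2 ^ n dvd a"
  by (simp add: coprime_dvd_mult_left_iff)

text \<open>Together with \<open>im4\<close>, the integer coordinates of the powers of a square root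
  of -1. They are meaningful in every commutative ring, so the same integers describe the quartic
  Jacobi sum over the complex numbers and its reduction in the finite field.\<close>

definition re4 :: "nat \<Rightarrow> int" where
  "re4 n = (if n mod 4 = 0 then 1 else if n mod 4 = 2 then -1 else 0)"

definition im4 :: "nat \<Rightarrow> int" where
  "im4 n = (if n mod 4 = 1 then 1 else if n mod 4 = 3 then -1 else 0)"

lemma re4_im4_Suc: "re4 (Suc n) = - im4 n" "im4 (Suc n) = re4 n"
  by (auto simp: re4_def im4_def mod_Suc split: if_splits)

lemma re4_im4_power:
  assumes "x\<^sup>2 = (-1 :: 'b::comm_ring_1)"
  shows "of_int (re4 n) + of_int (im4 n) * x = x ^ n"
proof (induction n)
  case (Suc n)
  have "x ^ Suc n = x * (of_int (re4 n) + of_int (im4 n) * x)" using Suc by simp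
  also have "\<dots> = of_int (re4 n) * x + of_int (im4 n) * x\<^sup>2"
    by (simp add: algebra_simps power2_eq_square)
  finally show ?case by (simp add: assms re4_im4_Suc)
qed (simp add: re4_def im4_def)

section \<open>The quadratic Gauss sum and the quartic Jacobi sum\<close>

context field_5_mod_8
begin

text \<open>
  The quadratic character is trivial on the subfield \<open>K\<close> of \<open>p ^ (s div 2)\<close> elements, so the sum
  collapses to the elements orthogonal to \<open>K\<close>, which form the line through a nonsquare \<open>\<delta>\<close>.
\<close>

lemma gauss_quadratic: "gauss (-1) = - of_nat (p ^ (s div 2))"
proof -
  define k where "k = s div 2"
  define r where "r = p ^ k"
  have s: "s = 2 * k" using four_dvd_s unfolding k_def by presburger
  have k: "k > 0" "k dvd s" using s s_pos by auto
  define K where "K = subfield k"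
  have cardK: "card K = r" using card_subfield[OF k(2,1)] by (simp add: K_def r_def)
  have r1: "r > 1" unfolding r_def using p_gt_1 k(1) by (rule one_less_power)
  have r4: "r mod 4 = 1" using cong_pow[OF p_1_mod_4, of k] by (simp add: r_def cong_def)
  have q: "p ^ s = r * r" by (simp add: r_def s mult_2 power_add)
  have q1: "q1 = (r - 1) * (r + 1)" using r1 by (simp add: q1_def q algebra_simps)
  have index: "q1 div (p ^ k - 1) = r + 1"
    unfolding r_def[symmetric] q1 using r1 by (intro nonzero_mult_div_cancel_left) simp
  \<comment> \<open>As \<open>r\<close> is 1 modulo 4, the exponent is odd and
    \<open>\<delta>\<close> is a nonsquare. Moreover \<open>\<delta> ^ (r - 1) = -1\<close>, so the
    nontrivial automorphism over \<open>K\<close> negates it.\<close>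
  define \<delta> where "\<delta> = \<gamma> ^ ((r + 1) div 2)"
  have r2: "r + 1 = 2 * ((r + 1) div 2)" "odd ((r + 1) div 2)" using r4 by presburger+
  have \<delta>: "\<delta> ^ r = - \<delta>"
  proof -
    have "\<delta> ^ (r - 1) = -1"
    proof -
      have "q1 div 2 = (r + 1) div 2 * (r - 1)"
        unfolding q1 by (subst r2(1)) simp
      then show ?thesis using gamma_power_half by (simp only: \<delta>_def power_mult)
    qed
    moreover have "\<delta> ^ r = \<delta> ^ (r - 1) * \<delta>" using r1 by (simp flip: power_Suc2)
    ultimately show ?thesis by simp
  qed
  have \<delta>0: "\<delta> \<noteq> 0" by (simp add: \<delta>_def)
  have rho_K: "mchar (-1) a = 1" if "a \<in> K" "a \<noteq> 0" for a
  proof -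
    obtain j where j: "a = \<gamma> ^ j" using obtain_gamma_power[OF \<open>a \<noteq> 0\<close>] by blast
    then have "r + 1 dvd j" using gamma_power_in_subfield_iff[OF k(2,1), of j] \<open>a \<in> K\<close>
      unfolding index K_def by simp
    then have "even j" using r2(1) by (metis dvd_trans dvd_triv_left)
    then show ?thesis using mchar_gamma_power[OF minus_1_power_q1, of j] by (simp add: j)
  qed
  have rho_\<delta>: "mchar (-1) \<delta> = -1"
    using mchar_gamma_power[OF minus_1_power_q1] r2(2) by (simp add: \<delta>_def)
  \<comment> \<open>The conjugate of \<open>a * \<delta>\<close> over \<open>K\<close> is its
    negative, so its value under \<open>\<psi>\<close> is its own inverse; being a
    \<open>p\<close>-th root of unity with \<open>p\<close> odd, it is not -1.\<close>
  have psi_\<delta>: "\<psi> (a * \<delta>) = 1" if "a \<in> K" for a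
  proof -
    have "(a * \<delta>) ^ p ^ k = - (a * \<delta>)"
      using that \<delta> by (simp add: K_def subfield_def r_def power_mult_distrib)
    then have "\<psi> (- (a * \<delta>)) = \<psi> (a * \<delta>)" using psi_frobenius[of "a * \<delta>" k] by simp
    then have "\<psi> (a * \<delta>) * \<psi> (a * \<delta>) = 1" using psi_add[of "a * \<delta>" "- (a * \<delta>)"] by simp
    then have "\<psi> (a * \<delta>) = 1 \<or> \<psi> (a * \<delta>) = -1" by (simp add: square_eq_1_iff)
    moreover have "\<psi> (a * \<delta>) \<noteq> -1" using psi_power_p[of "a * \<delta>"] odd_p by auto
    ultimately show ?thesis by blast
  qed
  define Z where "Z = {x. \<forall>a\<in>K. \<psi> (a * x) = 1}"
  have sumK: "(\<Sum>a\<in>K. \<psi> (a * x)) = (if x \<in> Z then of_nat r else 0)" for x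
    using sum_psi_subfield[where k = k and x = x] cardK by (simp add: K_def Z_def)
  \<comment> \<open>Double counting of the values \<open>\<psi> (a * x)\<close> gives the size of
    \<open>Z\<close>; the line through \<open>\<delta>\<close> inside \<open>Z\<close> then fills
    it.\<close>
  have "of_nat (card Z) * of_nat r = (\<Sum>x\<in>UNIV. if x \<in> Z then of_nat r else (0::complex))"
    by (simp add: sum.If_cases)
  also have "\<dots> = (\<Sum>a\<in>K. \<Sum>x\<in>UNIV. \<psi> (a * x))"
    unfolding sumK[symmetric] by (rule sum.swap)
  also have "\<dots> = (\<Sum>a\<in>K. if a = 0 then of_nat (p ^ s) else 0)" by (simp only: sum_psi_scaled)
  also have "\<dots> = of_nat (p ^ s)" by (simp add: K_def)
  finally have "of_nat (card Z * r) = (of_nat (r * r) :: complex)" using q by simp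
  then have cardZ: "card Z = r" using r1 by (simp only: of_nat_eq_iff) simp
  have inj: "inj_on (\<lambda>a. a * \<delta>) K" using \<delta>0 by (simp add: inj_on_def)
  have Z: "(\<lambda>a. a * \<delta>) ` K = Z"
  proof (rule card_subset_eq)
    show "(\<lambda>a. a * \<delta>) ` K \<subseteq> Z"
      using psi_\<delta> subfield_mult by (auto simp: Z_def K_def mult.assoc[symmetric])
    show "card ((\<lambda>a. a * \<delta>) ` K) = card Z" using inj cardK cardZ by (simp add: card_image)
  qed simp
  have shift: "(\<Sum>x\<in>UNIV. mchar (-1) x * \<psi> (a * x)) = gauss (-1)" if "a \<in> K - {0}" for a
    using gauss_scaled[OF minus_1_power_q1, of a] rho_K[of a] that by simp
  \<comment> \<open>Every nonzero \<open>a\<close> in \<open>K\<close> is a square, so scaling by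
    \<open>a\<close> repeats the same Gauss sum, and summing over \<open>a\<close> first detects
    \<open>Z\<close>.\<close>
  have "of_nat (r - 1) * gauss (-1) = (\<Sum>a\<in>K - {0}. \<Sum>x\<in>UNIV. mchar (-1) x * \<psi> (a * x))"
    using shift cardK by (simp add: K_def card_Diff_singleton)
  also have "\<dots> = (\<Sum>x\<in>UNIV. mchar (-1) x * (\<Sum>a\<in>K - {0}. \<psi> (a * x)))"
    unfolding sum_distrib_left by (rule sum.swap)
  also have "\<dots> = (\<Sum>x\<in>UNIV. (if x \<in> Z then of_nat r * mchar (-1) x else 0) - mchar (-1) x)"
  proof (rule sum.cong)
    fix x
    have "(\<Sum>a\<in>K - {0}. \<psi> (a * x)) = (\<Sum>a\<in>K. \<psi> (a * x)) - 1" by (simp add: sum_diff1 K_def)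
    then show "mchar (-1) x * (\<Sum>a\<in>K - {0}. \<psi> (a * x))
        = (if x \<in> Z then of_nat r * mchar (-1) x else 0) - mchar (-1) x"
      by (simp only: sumK) (simp add: algebra_simps)
  qed simp
  also have "\<dots> = (\<Sum>x\<in>UNIV. if x \<in> Z then of_nat r * mchar (-1) x else 0)"
    using sum_mchar[OF minus_1_power_q1] by (simp add: sum_subtractf)
  also have "\<dots> = (\<Sum>x\<in>Z. of_nat r * mchar (-1) x)" by (simp add: sum.If_cases)
  also have "\<dots> = of_nat r * (\<Sum>a\<in>K. mchar (-1) (a * \<delta>))"
    unfolding Z[symmetric] by (simp add: sum.reindex[OF inj] sum_distrib_left)
  also have "(\<Sum>a\<in>K. mchar (-1) (a * \<delta>)) = (\<Sum>a\<in>K - {0}. -1)"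
    by (rule sum.mono_neutral_cong_right)
      (auto simp: K_def mchar_mult[OF minus_1_power_q1] rho_\<delta> rho_K[unfolded K_def])
  also have "\<dots> = - of_nat (r - 1)" using cardK by (simp add: K_def card_Diff_singleton)
  finally have "of_nat (r - 1) * gauss (-1) = of_nat (r - 1) * - of_nat r" by simp
  moreover have "of_nat (r - 1) \<noteq> (0::complex)" using r1 by simp
  ultimately have "gauss (-1) = - of_nat r" by (simp only: mult_cancel_left) simp
  then show ?thesis by (simp add: r_def k_def)
qed

lemma sum_powers_field:
  assumes "j > 0"
  shows "(\<Sum>x\<in>UNIV. (x::'a) ^ j) = (if q1 dvd j then -1 else 0)"
proof -
  have "(\<Sum>x\<in>UNIV. (x::'a) ^ j) = (\<Sum>x\<in>UNIV - {0}. x ^ j)"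
    by (rule sum.mono_neutral_right) (use assms in auto)
  also have "\<dots> = (\<Sum>k<q1. (\<gamma> ^ j) ^ k)"
    by (simp add: sum_nonzero_eq_sum_gamma mult.commute flip: power_mult)
  also have "\<dots> = (if q1 dvd j then -1 else 0)"
  proof (cases "q1 dvd j")
    case True
    then have "\<gamma> ^ j = 1" using power_card_minus_1[OF gamma_nonzero] by (auto elim!: dvdE simp: power_mult)
    moreover have "of_nat q1 = (-1 :: 'a)"
    proof -
      have "of_nat q1 + 1 = (of_nat (p ^ s) :: 'a)" by (simp add: q_eq_Suc_q1)
      also have "\<dots> = 0" using s_pos char of_nat_CHAR[where ?'a = 'a] by (simp add: power_0_left)
      finally show ?thesis by (simp add: eq_neg_iff_add_eq_0)
    qed
    ultimately show ?thesis using True by simp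
  next
    case False
    then have "\<gamma> ^ j \<noteq> 1" using gamma_power_eq_iff[of j 0] by (simp add: cong_0_iff)
    moreover have "(\<gamma> ^ j) ^ q1 = 1" by (simp add: power_card_minus_1)
    ultimately show ?thesis using False by (simp add: geometric_sum)
  qed
  finally show ?thesis .
qed

text \<open>The norm comes from the absolute values of Gauss sums and the residue modulo 4 from
  evenness of the summands. Non-divisibility by \<open>p\<close> comes from reducing the sum in the
  finite field, where it becomes, up to sign, a central binomial coefficient.\<close>

lemma jacobi_quartic:
  obtains a b :: int where "jacobi \<i> (-1) = - (of_int a + of_int b * \<i>)" "[a = 1] (mod 4)"
    "\<not> int p dvd a" "a\<^sup>2 + b\<^sup>2 = int p ^ s"
proof -
  define Qi where "Qi = int p ^ s"
  define X where "X = UNIV - {0, 1 :: 'a}"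
  define e where "e x = (-1 :: int) ^ dlog (1 - x)" for x
  define A where "A = (\<Sum>x\<in>X. re4 (dlog x) * e x)"
  define B where "B = (\<Sum>x\<in>X. im4 (dlog x) * e x)"
  have root_i: "\<i> ^ q1 = 1" using zt_power_q1[of 2] zt_2 by simp
  have X_sum: "(\<Sum>x\<in>X. re4 (dlog x) * e x) = A" "(\<Sum>x\<in>X. im4 (dlog x) * e x) = B"
    by (simp_all add: A_def B_def)
  have J: "jacobi \<i> (-1) = of_int A + of_int B * \<i>"
  proof -
    have "jacobi \<i> (-1) = (\<Sum>x\<in>X. \<i> ^ dlog x * (-1) ^ dlog (1 - x))"
      unfolding jacobi_def by (rule sum.mono_neutral_cong_right) (auto simp: X_def mchar_def)
    also have "\<dots> = (\<Sum>x\<in>X. of_int (re4 (dlog x) * e x) + of_int (im4 (dlog x) * e x) * \<i>)"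
      by (rule sum.cong) (simp_all add: e_def algebra_simps flip: re4_im4_power[of \<i>])
    finally show ?thesis by (simp add: A_def B_def sum.distrib sum_distrib_right)
  qed
  have sums: "(\<Sum>x\<in>X. re4 (dlog x)) = -1" "(\<Sum>x\<in>X. im4 (dlog x)) = 0"
  proof -
    have "(\<Sum>x\<in>UNIV. mchar \<i> x) = 0" using sum_mchar[OF root_i] by (simp add: complex_eq_iff)
    also have "(\<Sum>x\<in>UNIV. mchar \<i> x) = mchar \<i> 0 + (mchar \<i> 1 + (\<Sum>x\<in>X. mchar \<i> x))"
    proof -
      have "(UNIV :: 'a set) = insert 0 (insert 1 X)" by (auto simp: X_def)
      then have "sum (mchar \<i>) UNIV = sum (mchar \<i>) (insert 0 (insert 1 X))" by simp
      then show ?thesis by (simp add: X_def)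
    qed
    finally have "(\<Sum>x\<in>X. mchar \<i> x) = -1" using root_i by (simp add: eq_neg_iff_add_eq_0 add.commute)
    moreover have "(\<Sum>x\<in>X. mchar \<i> x) = (\<Sum>x\<in>X. of_int (re4 (dlog x)) + of_int (im4 (dlog x)) * \<i>)"
      by (rule sum.cong) (auto simp: X_def mchar_def re4_im4_power)
    ultimately have "of_int (\<Sum>x\<in>X. re4 (dlog x)) + of_int (\<Sum>x\<in>X. im4 (dlog x)) * \<i> = (-1 :: complex)"
      by (simp add: sum.distrib sum_distrib_right)
    then have "real_of_int (\<Sum>x\<in>X. re4 (dlog x)) = real_of_int (-1)"
      "real_of_int (\<Sum>x\<in>X. im4 (dlog x)) = real_of_int 0"
      by (auto simp: complex_eq_iff simp del: of_int_sum)
    then show "(\<Sum>x\<in>X. re4 (dlog x)) = -1" "(\<Sum>x\<in>X. im4 (dlog x)) = 0"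
      by (simp_all only: of_int_eq_iff)
  qed
  have sum_e: "(\<Sum>x\<in>X. e x) = -1"
  proof -
    have "(\<Sum>x\<in>UNIV. mchar (-1) (1 - x)) = (\<Sum>x\<in>UNIV. mchar (-1) x)"
      by (rule sum.reindex_bij_witness[of _ "\<lambda>x. 1 - x" "\<lambda>x. 1 - x"]) auto
    also have "\<dots> = 0" using sum_mchar[OF minus_1_power_q1] by simp
    also have "(\<Sum>x\<in>UNIV. mchar (-1) (1 - x)) = mchar (-1) 1 + (mchar (-1) 0 + (\<Sum>x\<in>X. mchar (-1) (1 - x)))"
    proof -
      have "(UNIV :: 'a set) = insert 0 (insert 1 X)" by (auto simp: X_def)
      then have "(\<Sum>x\<in>UNIV. mchar (-1) (1 - x)) = (\<Sum>x\<in>insert 0 (insert 1 X). mchar (-1) (1 - x))" by simp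
      then show ?thesis by (simp add: X_def)
    qed
    finally have "(\<Sum>x\<in>X. mchar (-1) (1 - x)) = -1"
      using minus_1_power_q1 by (simp add: eq_neg_iff_add_eq_0 add.commute)
    moreover have "(\<Sum>x\<in>X. mchar (-1) (1 - x)) = (\<Sum>x\<in>X. of_int (e x))"
      by (rule sum.cong) (auto simp: X_def mchar_def e_def)
    ultimately have "of_int (\<Sum>x\<in>X. e x) = (of_int (-1) :: complex)" by simp
    then show ?thesis by (simp only: of_int_eq_iff)
  qed
  have cardX: "int (card X) = Qi - 2"
  proof -
    have "card X = CARD('a) - 2" unfolding X_def by (subst card_Diff_subset) auto
    then show ?thesis using q_gt_1 by (simp add: card of_nat_diff Qi_def)
  qed
  have S: "(\<Sum>x\<in>X. (re4 (dlog x) - 1) * (e x - 1)) = A + Qi"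
    by (simp add: algebra_simps sum.distrib sum_subtractf X_sum[simplified algebra_simps] sums sum_e cardX)
  have S': "(\<Sum>x\<in>X. im4 (dlog x) * (e x - 1)) = B"
    using sums by (simp add: algebra_simps sum_subtractf B_def)
  have e_even: "2 dvd e x - 1" for x by (simp add: e_def)
  have q8: "Qi mod 8 = 1"
  proof -
    have "[Qi = 1] (mod 2 ^ (2 + 2))"
      unfolding Qi_def by (rule pow_cong_1_mod_2_power[OF int_p_1_mod_4]) (use four_dvd_s in simp)
    then have "[Qi = 1] (mod 8)" by (rule cong_dvd_modulus) simp
    then show ?thesis by (simp add: cong_def)
  qed
  have "2 dvd A + Qi"
    unfolding S[symmetric] by (rule dvd_sum) (use e_even in \<open>auto intro: dvd_mult\<close>)
  moreover have odd_Q: "odd Qi" using q8 by presburger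
  ultimately have oddA: "odd A" by simp
  \<comment> \<open>Both factors of each summand are even: \<open>re4 + im4\<close> takes only the
    values 1 and -1, and so does \<open>e\<close>.\<close>
  have "4 dvd (\<Sum>x\<in>X. (re4 (dlog x) - 1 + im4 (dlog x)) * (e x - 1))"
  proof (rule dvd_sum)
    fix x
    have "2 dvd re4 (dlog x) - 1 + im4 (dlog x)" by (auto simp: re4_def im4_def)
    then have "2 * 2 dvd (re4 (dlog x) - 1 + im4 (dlog x)) * (e x - 1)" using e_even by (rule mult_dvd_mono)
    then show "4 dvd (re4 (dlog x) - 1 + im4 (dlog x)) * (e x - 1)" by simp
  qed
  also have "(\<Sum>x\<in>X. (re4 (dlog x) - 1 + im4 (dlog x)) * (e x - 1)) = A + Qi + B"
    unfolding S[symmetric] S'[symmetric] sum.distrib[symmetric] by (simp add: algebra_simps)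
  finally have AB4: "4 dvd A + Qi + B" .
  have norm: "A\<^sup>2 + B\<^sup>2 = Qi"
  proof -
    have ne: "\<i> \<noteq> 1" "-1 \<noteq> (1::complex)" "\<i> * (-1) \<noteq> 1" by (simp_all add: complex_eq_iff)
    have ne4: "(\<i> * (-1)) ^ q1 = 1"
      unfolding power_mult_distrib root_i minus_1_power_q1 by simp
    define Q where "Q = (of_nat (p ^ s) :: complex)"
    have "(jacobi \<i> (-1) * cnj (jacobi \<i> (-1))) * (gauss (\<i> * (-1)) * cnj (gauss (\<i> * (-1))))
        = (gauss \<i> * gauss (-1)) * cnj (gauss \<i> * gauss (-1))"
      by (simp only: gauss_mult_gauss[OF root_i minus_1_power_q1 ne(3)] complex_cnj_mult mult_ac)
    also have "\<dots> = (gauss \<i> * cnj (gauss \<i>)) * (gauss (-1) * cnj (gauss (-1)))"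
      by (simp only: complex_cnj_mult mult_ac)
    finally have "(jacobi \<i> (-1) * cnj (jacobi \<i> (-1))) * Q = Q * Q"
      using norm_gauss[OF root_i ne(1)] norm_gauss[OF minus_1_power_q1 ne(2)] norm_gauss[OF ne4 ne(3)]
      by (simp only: Q_def)
    moreover have "Q \<noteq> 0" using p_gt_1 by (simp add: Q_def)
    ultimately have "jacobi \<i> (-1) * cnj (jacobi \<i> (-1)) = Q" by simp
    then have "of_int (A\<^sup>2 + B\<^sup>2) = (of_int (Qi) :: complex)"
      unfolding J Q_def Qi_def by (simp add: power2_eq_square algebra_simps)
    then show ?thesis by (simp only: of_int_eq_iff)
  qed
  \<comment> \<open>Modulo 8 the norm equation with \<open>A\<close> odd forces 4 to divide
    \<open>B\<close>. Then 4 divides \<open>A + Qi\<close> too, so \<open>- A\<close> is 1 modulo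
    4.\<close>
  have "even B" using norm oddA q8 by (metis even_add even_power odd_Q oddA pos2)
  then obtain B' where B': "B = 2 * B'" by blast
  obtain A' where A': "A = 2 * A' + 1" using oddA by (elim oddE)
  have "even (A' * (A' + 1))" by simp
  then obtain A'' where A'': "A' * (A' + 1) = 2 * A''" by blast
  have "A\<^sup>2 = 4 * (A' * (A' + 1)) + 1" unfolding A' by (simp add: power2_eq_square algebra_simps)
  then have "8 * A'' + 1 + 4 * B'\<^sup>2 = Qi" using norm A'' B' by simp
  then have "(8 * A'' + 1 + 4 * B'\<^sup>2) mod 8 = 1" using q8 by simp
  moreover have "even b" if "(8 * a + 1 + 4 * b) mod 8 = 1" for a b :: int
    using that by presburger
  ultimately have "even (B'\<^sup>2)" by blast
  then have "4 dvd B" using B' by auto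
  then have A4: "[- A = 1] (mod 4)" using AB4 q8 unfolding cong_def by presburger
  have "\<not> int p dvd A"
  proof
    assume pA: "int p dvd A"
    then have "int p dvd Qi - A\<^sup>2"
      using s_pos by (intro dvd_diff) (auto simp: Qi_def power2_eq_square dvd_power)
    then have "int p dvd B\<^sup>2" unfolding norm[symmetric] by simp
    then have pB: "int p dvd B" using prime_p prime_dvd_power[of "int p" B 2] by simp
    define n where "n = q1 div 4"
    have "(2::nat) ^ 2 dvd q1" by (rule two_power_dvd_q1) simp
    then have n: "q1 = 4 * n" by (simp add: n_def)
    then have n0: "n > 0" using q1_pos by simp
    \<comment> \<open>The choice of \<open>3 * n\<close> instead of \<open>n\<close> matters. The
      exponents occurring in \<open>x ^ (3 * n) * (1 - x) ^ (2 * n)\<close> run from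
      \<open>3 * n\<close> to \<open>5 * n\<close> and meet the multiple \<open>4 * n\<close> of
      \<open>q1\<close> exactly once; with \<open>n\<close> they would all stay below
      \<open>q1\<close> and the power sum would vanish.\<close>
    define \<iota> where "\<iota> = \<gamma> ^ (3 * n)"
    have half: "\<gamma> ^ (2 * n) = -1" using gamma_power_half n by simp
    have "\<iota>\<^sup>2 = (\<gamma> ^ (2 * n)) ^ 3" by (simp add: \<iota>_def flip: power_mult)
    then have \<iota>2: "\<iota>\<^sup>2 = -1" by (simp add: half)
    have "of_int A + of_int B * \<iota> = (\<Sum>x\<in>X. (of_int (re4 (dlog x)) + of_int (im4 (dlog x)) * \<iota>) * of_int (e x))"
      by (simp add: A_def B_def sum.distrib sum_distrib_left algebra_simps)
    also have "\<dots> = (\<Sum>x\<in>X. x ^ (3 * n) * (1 - x) ^ (2 * n))"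
    proof (rule sum.cong)
      fix x assume x: "x \<in> X"
      have "\<iota> ^ dlog x = (\<gamma> ^ dlog x) ^ (3 * n)" by (simp add: \<iota>_def mult.commute flip: power_mult)
      moreover have "(-1) ^ dlog (1 - x) = (\<gamma> ^ dlog (1 - x)) ^ (2 * n)"
        unfolding half[symmetric] by (simp only: power_mult[symmetric] mult.commute)
      ultimately show "(of_int (re4 (dlog x)) + of_int (im4 (dlog x)) * \<iota>) * of_int (e x)
          = x ^ (3 * n) * (1 - x) ^ (2 * n)"
        using x by (simp add: re4_im4_power[OF \<iota>2] e_def X_def gamma_power_dlog)
    qed simp
    also have "\<dots> = (\<Sum>x\<in>UNIV. x ^ (3 * n) * (1 - x) ^ (2 * n))"
      by (rule sum.mono_neutral_left) (use n0 in \<open>auto simp: X_def power_0_left\<close>)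
    also have "\<dots> = (\<Sum>x\<in>UNIV. \<Sum>k\<le>2 * n. of_nat (2 * n choose k) * (-1) ^ k * x ^ (3 * n + k))"
    proof (rule sum.cong)
      fix x :: 'a
      have "(1 - x) ^ (2 * n) = (- x + 1) ^ (2 * n)" by simp
      also have "\<dots> = (\<Sum>k\<le>2 * n. of_nat (2 * n choose k) * (- x) ^ k * 1 ^ (2 * n - k))"
        by (rule binomial_ring)
      finally show "x ^ (3 * n) * (1 - x) ^ (2 * n)
          = (\<Sum>k\<le>2 * n. of_nat (2 * n choose k) * (-1) ^ k * x ^ (3 * n + k))"
        by (simp add: sum_distrib_left power_add power_minus[of x] mult_ac)
    qed simp
    also have "\<dots> = (\<Sum>k\<le>2 * n. of_nat (2 * n choose k) * (-1) ^ k * (\<Sum>x\<in>UNIV. x ^ (3 * n + k)))"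
      unfolding sum_distrib_left by (rule sum.swap)
    also have "\<dots> = (\<Sum>k\<le>2 * n. if k = n then - (of_nat (2 * n choose k) * (-1) ^ k) else 0)"
    proof (rule sum.cong)
      fix k assume k: "k \<in> {..2 * n}"
      have "q1 dvd 3 * n + k \<longleftrightarrow> k = n"
      proof
        assume "q1 dvd 3 * n + k"
        then obtain l where l: "3 * n + k = 4 * n * l" unfolding n by blast
        have "k \<le> 2 * n" using k by simp
        then have "4 * n * l < 4 * n * 2" using l n0 by linarith
        then have "l < 2" using n0 by (metis mult_less_cancel1)
        moreover have "l \<noteq> 0" using l n0 by (intro notI) simp
        ultimately have "l = 1" by simp
        then show "k = n" using l by simp
      qed (simp add: n)
      then show "of_nat (2 * n choose k) * (-1) ^ k * (\<Sum>x\<in>UNIV. (x::'a) ^ (3 * n + k))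
          = (if k = n then - (of_nat (2 * n choose k) * (-1) ^ k) else 0)"
        using sum_powers_field[of "3 * n + k"] n0 by simp
    qed simp
    also have "\<dots> = - (of_nat (2 * n choose n) * (-1) ^ n)" by (simp add: sum.delta)
    finally have "of_int A + of_int B * \<iota> = - (of_nat (2 * n choose n) * (-1) ^ n)" .
    moreover have "of_int A = (0::'a)" "of_int B = (0::'a)"
      using pA pB of_int_eq_0_iff_char_dvd[where ?'a = 'a] char by auto
    ultimately have "of_nat (2 * n choose n) = (0::'a)" by simp
    then have "p dvd (2 * n choose n)" using of_nat_eq_0_iff_char_dvd[where ?'a = 'a] char by metis
    then show False using not_dvd_central_binomial[OF prime_p p_1_mod_4, of s] by (simp add: n_def q1_def)
  qed
  then have "\<not> int p dvd - A" by simp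
  moreover have "(- A)\<^sup>2 + (- B)\<^sup>2 = int p ^ s" using norm by (simp add: Qi_def)
  moreover have "jacobi \<i> (-1) = - (of_int (- A) + of_int (- B) * \<i>)" unfolding J by simp
  ultimately show ?thesis using that A4 by blast
qed

end

section \<open>Periods of 2-power order and their value at 0\<close>

context field_5_mod_8
begin

text \<open>
  Write \<open>t\<close> as the sum of \<open>\<psi>\<close> over the group \<open>U\<close> of nonzero \<open>2 ^ r\<close>-th powers. Since \<open>U\<close> is stable
  under the prime field, \<open>t\<close> has the parity of the number of \<open>u \<in> U\<close> of trace \<open>1\<close>. The
  automorphisms of 2-power order act on these, and the points fixed by all of them form a fibre of
  a trace on a subfield of odd degree, whose size is a power of \<open>p\<close>.
\<close>

lemma reduced_period_at_0:
  assumes r: "r \<le> v"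
  obtains t :: int where "odd t" "reduced_period s \<gamma> (2 ^ r) 0 = 1 + 2 ^ r * of_int t"
proof -
  define e :: nat where "e = 2 ^ r"
  define M where "M = q1 div e"
  have e0: "e > 0" by (simp add: e_def)
  \<comment> \<open>As \<open>r <= v\<close>, a spare factor of 2 remains in \<open>M\<close>, the
    order of \<open>U\<close>. Since \<open>p - 1\<close> is even as well, the number
    \<open>N 0\<close> of elements of trace 0 is even.\<close>
  have "2 ^ Suc r dvd q1" by (rule two_power_dvd_q1) (use r in simp)
  then have M: "q1 = e * M" "even M" by (auto simp: M_def e_def elim!: dvdE)
  define U where "U = (\<lambda>k. \<gamma> ^ (e * k)) ` {..<M}"
  have in_U: "\<gamma> ^ j \<in> U \<longleftrightarrow> e dvd j" for j
  proof
    assume "\<gamma> ^ j \<in> U"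
    then obtain k where "[j = e * k] (mod q1)" by (auto simp: U_def gamma_power_eq_iff)
    then have "[j = e * k] (mod e)" by (rule cong_dvd_modulus_nat) (simp add: M(1))
    then show "e dvd j" by (simp add: cong_def mod_eq_0_iff_dvd)
  next
    assume "e dvd j"
    then obtain i where i: "j = e * i" by blast
    have "\<gamma> ^ j = \<gamma> ^ (e * (i mod M))"
      unfolding gamma_power_eq_iff i M(1) mult_mod_right by (simp add: cong_def)
    moreover have "i mod M < M" using q1_pos M(1) by (intro mod_less_divisor gr0I) simp
    ultimately show "\<gamma> ^ j \<in> U" unfolding U_def by blast
  qed
  have U0: "u \<noteq> 0" if "u \<in> U" for u using that by (auto simp: U_def)
  have U_mult: "u * w \<in> U" if u: "u \<in> U" and w: "w \<in> U" for u w
  proof -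
    obtain a b where ab: "u = \<gamma> ^ a" "w = \<gamma> ^ b" using u w U0 by (meson obtain_gamma_power)
    then have "e dvd a + b" using u w in_U by simp
    then show ?thesis using ab in_U[of "a + b"] by (simp add: power_add)
  qed
  have U_power: "u ^ n \<in> U" if u: "u \<in> U" for u n
  proof -
    obtain a where a: "u = \<gamma> ^ a" using u U0 by (meson obtain_gamma_power)
    then have "e dvd a * n" using u in_U by simp
    then show ?thesis using a in_U[of "a * n"] by (simp add: power_mult)
  qed
  have subfield_U: "a \<in> U" if a: "a \<in> subfield k" "a \<noteq> 0" and k: "odd k" "k dvd s" for a k
  proof -
    obtain j where j: "a = \<gamma> ^ j" using obtain_gamma_power[OF a(2)] by blast
    obtain u where u: "q1 div (p ^ k - 1) = 2 ^ v * u" using subfield_index_two_adic[OF k] by blast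
    have "k > 0" using k(1) by (rule odd_pos)
    then have "2 ^ v * u dvd j" using gamma_power_in_subfield_iff[OF k(2), of j] a(1) j u by simp
    moreover have "e dvd 2 ^ v * u" unfolding e_def using r by (intro dvd_mult2 le_imp_power_dvd)
    ultimately have "e dvd j" by (rule dvd_trans[rotated])
    then show ?thesis by (simp add: j in_U)
  qed
  define F where "F c = {u \<in> U. field_trace s u = c}" for c
  define N where "N c = card (F c)" for c
  have fin: "finite (F c)" for c by simp
  \<comment> \<open>Nonzero elements of the prime field lie in \<open>U\<close>, so scaling by them
    shows that all nonzero traces occur equally often in \<open>U\<close>.\<close>
  have N_scale: "N c = N 1" if c: "c \<in> subfield 1" "c \<noteq> 0" for c
  proof -
    have c1: "inverse c \<in> subfield 1" using c by (simp add: subfield_def power_inverse)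
    have cU: "c \<in> U" "inverse c \<in> U" using subfield_U[of _ 1] c c1 by simp_all
    have "bij_betw (\<lambda>u. c * u) (F 1) (F c)"
      by (rule bij_betw_byWitness[where f' = "\<lambda>u. inverse c * u"])
        (use c(2) U_mult[OF cU(1)] U_mult[OF cU(2)] field_trace_scale[OF c(1)] field_trace_scale[OF c1]
          in \<open>auto simp: F_def mult.assoc[symmetric]\<close>)
    then show ?thesis by (simp add: N_def bij_betw_same_card)
  qed
  have N_nat: "N (of_nat j) = N 1" if "j \<in> {1..<p}" for j
  proof (rule N_scale)
    show "of_nat j \<noteq> (0::'a)"
      using that of_nat_eq_0_iff_char_dvd[where ?'a = 'a, of j] char by (auto dest: dvd_imp_le)
  qed simp
  have split: "(\<Sum>u\<in>U. g u) = (\<Sum>j<p. \<Sum>u\<in>F (of_nat j). g u)" for g :: "'a \<Rightarrow> 'c::comm_monoid_add"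
  proof -
    have "(\<Sum>u\<in>U. g u) = (\<Sum>c\<in>subfield 1. \<Sum>u\<in>F c. g u)"
    proof (subst sum.UNION_disjoint[symmetric])
      show "sum g U = sum g (\<Union> (F ` subfield 1))"
        using field_trace_in_prime_subfield[of _ s] s_pos by (intro sum.cong) (auto simp: F_def)
    qed (auto simp: F_def)
    then show ?thesis unfolding prime_subfield_eq by (simp add: sum.reindex[OF inj_of_nat])
  qed
  have p_split: "{..<p} = insert 0 {1..<p}" using p_gt_1 by auto
  have "(\<Sum>u\<in>U. \<psi> u) = (\<Sum>j<p. of_nat (N (of_nat j)) * root_of_unity p ^ j)"
    unfolding split by (rule sum.cong) (simp_all add: F_def N_def psi_eq)
  also have "\<dots> = of_nat (N 0) + of_nat (N 1) * (\<Sum>j\<in>{1..<p}. root_of_unity p ^ j)"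
    unfolding p_split by (simp add: N_nat sum_distrib_left)
  also have "(\<Sum>j\<in>{1..<p}. root_of_unity p ^ j) = -1"
    using sum_root_of_unity_powers[OF p_gt_1] unfolding p_split by (simp add: eq_neg_iff_add_eq_0 add.commute)
  finally have psi_U: "(\<Sum>u\<in>U. \<psi> u) = of_int (int (N 0) - int (N 1))" by simp
  have inj_U: "inj_on (\<lambda>k. \<gamma> ^ (e * k)) {..<M}"
  proof (rule inj_onI)
    fix a b assume ab: "a \<in> {..<M}" "b \<in> {..<M}" "\<gamma> ^ (e * a) = \<gamma> ^ (e * b)"
    then have "e * (a mod M) = e * (b mod M)"
      unfolding gamma_power_eq_iff M(1) by (simp only: cong_def mult_mod_right)
    then show "a = b" using ab e0 by simp
  qed
  have "M = card U" by (simp add: U_def card_image inj_U)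
  also have "\<dots> = N 0 + (p - 1) * N 1"
    using split[of "\<lambda>_. 1::nat"] unfolding p_split by (simp add: N_nat flip: N_def)
  finally have "even (N 0)" using M(2) odd_p by simp
  have "odd (N 1)"
  proof -
    define k where "k = s div 2 ^ v"
    have k: "odd k" "s = 2 ^ v * k" "k > 0" using odd_s_div s_eq by (auto simp: k_def odd_pos)
    \<comment> \<open>Descent along the tower of subfields: the \<open>p ^ l\<close>-th power map is
      an involution of \<open>S (l + l)\<close> with fixed points \<open>S l\<close>, so the parity
      survives down to the odd degree \<open>k\<close>.\<close>
    define S where "S l = F 1 \<inter> subfield l" for l
    have "even (card (S (2 ^ i * k))) = even (card (S k))" if "i \<le> v" for i
      using that
    proof (induction i)
      case (Suc i)
      define l where "l = 2 ^ i * k"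
      define f where "f x = x ^ p ^ l" for x :: 'a
      have l2: "2 ^ Suc i * k = l + l" by (simp add: l_def)
      have "even (card (S (2 ^ Suc i * k))) = even (card {x \<in> S (2 ^ Suc i * k). f x = x})"
      proof (rule even_card_involution)
        fix x assume x: "x \<in> S (2 ^ Suc i * k)"
        then show ffx: "f (f x) = x"
          unfolding l2 by (simp add: S_def f_def subfield_def power_add power_mult)
        have "field_trace s (f x) = field_trace s x"
        proof -
          have "field_trace s (x ^ p ^ i) = field_trace s x" for i
          proof (induction i)
            case (Suc i)
            have "field_trace s (x ^ p ^ Suc i) = field_trace s ((x ^ p ^ i) ^ p)"
              by (simp flip: power_mult add: mult.commute)
            then show ?case using Suc field_trace_frobenius[of "x ^ p ^ i" s] s_pos by simp
          qed simp
          then show ?thesis by (simp add: f_def)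
        qed
        moreover have "f x \<in> subfield (l + l)"
          using ffx by (simp add: f_def subfield_def power_add power_mult)
        ultimately show "f x \<in> S (2 ^ Suc i * k)"
          using x U_power unfolding l2 by (simp add: S_def F_def f_def)
      qed simp
      also have "{x \<in> S (2 ^ Suc i * k). f x = x} = S l"
        unfolding l2 using subfield_mono_dvd[of l "l + l"] by (auto simp: S_def f_def subfield_def)
      finally show ?case using Suc by (simp add: l_def)
    qed simp
    from this[of v] have "even (card (S s)) = even (card (S k))" using k(2) by simp
    moreover have "S s = F 1" by (simp add: S_def)
    ultimately have N1: "even (N 1) = even (card (S k))" by (simp add: N_def)
    define c :: 'a where "c = inverse (2 ^ v)"
    have c0: "(2::'a) ^ v \<noteq> 0" using two_neq_0[OF odd_p] by simp
    have c1: "c \<in> subfield 1"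
    proof -
      have "(2::'a) ^ v \<in> subfield 1" using subfield_of_nat[of "2 ^ v" 1] by simp
      then show ?thesis by (simp add: c_def subfield_def power_inverse)
    qed
    \<comment> \<open>On the subfield of degree \<open>k\<close> the conjugates repeat with period
      \<open>k\<close>, and the trace runs through \<open>2 ^ v\<close> such periods.\<close>
    have tr: "field_trace s x = 2 ^ v * field_trace k x" if "x \<in> subfield k" for x
    proof -
      have "(\<Sum>i<2 ^ v * k. x ^ p ^ i) = of_nat (2 ^ v) * (\<Sum>i<k. x ^ p ^ i)"
      proof (rule sum_lessThan_periodic)
        have "x ^ p ^ (i + k) = (x ^ p ^ k) ^ p ^ i" for i
          by (simp add: power_add mult.commute flip: power_mult)
        then show "x ^ p ^ (i + k) = x ^ p ^ i" for i using that by (simp add: subfield_def)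
      qed
      then show ?thesis by (simp add: field_trace_def char flip: k(2))
    qed
    have "S k = {x \<in> subfield k. field_trace k x = c}"
    proof (intro equalityI subsetI)
      fix x assume "x \<in> S k"
      then have "x \<in> subfield k" "2 ^ v * field_trace k x = 1" using tr[of x] by (auto simp: S_def F_def)
      then show "x \<in> {x \<in> subfield k. field_trace k x = c}"
        using c0 by (simp add: c_def inverse_eq_divide eq_divide_eq mult.commute)
    next
      fix x assume x: "x \<in> {x \<in> subfield k. field_trace k x = c}"
      then have t: "field_trace s x = 1" using tr[of x] c0 by (simp add: c_def)
      then have "x \<noteq> 0" using p_gt_1 by (auto simp: field_trace_def char power_0_left)
      \<comment> \<open>Membership in \<open>U\<close> is automatic for nonzero elements of a
        subfield of odd degree, so \<open>S k\<close> is a whole trace fibre.\<close>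
      then have "x \<in> U" using subfield_U[of x k] x k by simp
      then show "x \<in> S k" using x t by (simp add: S_def F_def)
    qed
    then have "card (S k) = p ^ (k - 1)" using card_trace_fibre[OF _ k(3) c1] k(2) by simp
    then show ?thesis using N1 odd_p by simp
  qed
  have "reduced_period s \<gamma> e 0 = (\<Sum>x\<in>UNIV. \<psi> (x ^ e))"
    by (simp add: reduced_period_eq_sum_psi)
  also have "\<dots> = 1 + (\<Sum>x\<in>UNIV - {0}. \<psi> (x ^ e))"
    using e0 by (simp add: sum_diff1 power_0_left)
  also have "(\<Sum>x\<in>UNIV - {0}. \<psi> (x ^ e)) = (\<Sum>k<e * M. \<psi> (\<gamma> ^ (e * k)))"
    by (simp add: sum_nonzero_eq_sum_gamma M(1) mult.commute flip: power_mult)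
  also have "\<dots> = of_nat e * (\<Sum>k<M. \<psi> (\<gamma> ^ (e * k)))"
  proof (rule sum_lessThan_periodic)
    have "\<gamma> ^ (e * (k + M)) = \<gamma> ^ (e * k)" for k
      unfolding gamma_power_eq_iff by (simp add: M(1) cong_def algebra_simps)
    then show "\<psi> (\<gamma> ^ (e * (k + M))) = \<psi> (\<gamma> ^ (e * k))" for k by simp
  qed
  also have "(\<Sum>k<M. \<psi> (\<gamma> ^ (e * k))) = (\<Sum>u\<in>U. \<psi> u)"
    unfolding U_def by (simp add: sum.reindex[OF inj_U])
  finally show ?thesis
    using that[of "int (N 0) - int (N 1)"] \<open>even (N 0)\<close> \<open>odd (N 1)\<close> by (simp add: psi_U e_def)
qed

text \<open>The joint contribution of the characters of exact order \<open>2 ^ n\<close>, meant for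
  \<open>n >= 2\<close>. The two terms belong to the exponents that are 1 and 3 modulo 4.\<close>

definition period_step :: "nat \<Rightarrow> nat \<Rightarrow> complex" where
  "period_step n k = (if 2 ^ (n - 2) dvd k then 2 ^ (n - 2) *
     ((-\<i>) ^ (k div 2 ^ (n - 2)) * gauss (zt n) + \<i> ^ (k div 2 ^ (n - 2)) * gauss (cnj (zt n))) else 0)"

lemma reduced_period_2: "reduced_period s \<gamma> 2 k = (-1) ^ k * gauss (-1)"
proof -
  have "2 dvd q1" using two_power_dvd_q1[of 1] by simp
  then have "reduced_period s \<gamma> 2 k = 1 + (\<Sum>j<2. cnj (root_of_unity 2) ^ (j * k) * gauss (root_of_unity 2 ^ j))"
    by (rule reduced_period_eq_sum_gauss)
  moreover have "{..<2::nat} = {0, 1}" by auto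
  ultimately show ?thesis using zt_1 by (simp add: gauss_base_1)
qed

text \<open>The even \<open>j\<close> give the characters already present in the period of order
  \<open>2 ^ (n - 1)\<close>. The odd \<open>j\<close> split modulo 4; on each class Frobenius makes
  the Gauss sum constant, which leaves a geometric sum that vanishes unless
  \<open>2 ^ (n - 2)\<close> divides \<open>k\<close>.\<close>

lemma reduced_period_double:
  assumes n: "2 \<le> n" "n \<le> v + 2"
  shows "reduced_period s \<gamma> (2 ^ n) k = reduced_period s \<gamma> (2 ^ (n - 1)) k + period_step n k"
proof -
  define a where "a j = cnj (zt n) ^ (j * k) * gauss (zt n ^ j)" for j
  define l where "l = n - 2"
  have nl: "n = l + 2" using n by (simp add: l_def)
  have z4: "zt n ^ 4 = zt l"
    using zt_power_diff[of l n] by (simp add: nl)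
  have zl: "zt n ^ 2 ^ l = \<i>"
    using zt_power_diff[of 2 n] zt_2 by (simp add: nl)
  have "reduced_period s \<gamma> (2 ^ n) k = 1 + (\<Sum>j<2 * 2 ^ (n - 1). a j)"
    using reduced_period_eq_sum_gauss[OF two_power_dvd_q1[OF n(2)]] by (simp add: nl a_def)
  also have "\<dots> = 1 + (\<Sum>j<2 ^ (n - 1). a (2 * j)) + (\<Sum>j<2 * 2 ^ l. a (2 * j + 1))"
    by (subst sum_lessThan_double) (simp add: nl)
  also have "1 + (\<Sum>j<2 ^ (n - 1). a (2 * j)) = reduced_period s \<gamma> (2 ^ (n - 1)) k"
  proof -
    have "(zt n)\<^sup>2 = zt (n - 1)" using zt_Suc_square[of "n - 1"] by (simp add: nl)
    then have "a (2 * j) = cnj (zt (n - 1)) ^ (j * k) * gauss (zt (n - 1) ^ j)" for j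
      unfolding a_def by (simp add: power_mult mult.assoc flip: complex_cnj_power)
    moreover have "2 ^ (n - 1) dvd q1" by (rule two_power_dvd_q1) (use n in simp)
    ultimately show ?thesis using reduced_period_eq_sum_gauss by simp
  qed
  also have "(\<Sum>j<2 * 2 ^ l. a (2 * j + 1)) = (\<Sum>u<2 ^ l. a (4 * u + 1)) + (\<Sum>u<2 ^ l. a (4 * u + 3))"
  proof -
    have "2 * (2 * u) + 1 = 4 * u + 1" "2 * (2 * u + 1) + 1 = 4 * u + 3" for u :: nat by simp_all
    then show ?thesis by (simp only: sum_lessThan_double)
  qed
  also have "(\<Sum>u<2 ^ l. a (4 * u + 1)) = cnj (zt n) ^ k * gauss (zt n) * (\<Sum>u<2 ^ l. (cnj (zt l) ^ k) ^ u)"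
    unfolding sum_distrib_left
  proof (rule sum.cong)
    fix u
    have "gauss (zt n ^ (4 * u + 1)) = gauss (zt n)"
      by (rule gauss_power_1_mod_4[OF zt_power_self n]) (simp add: cong_def)
    moreover have "cnj (zt n) ^ ((4 * u + 1) * k) = cnj (zt n) ^ k * (cnj (zt n ^ 4) ^ k) ^ u"
      by (simp add: algebra_simps power_add flip: power_mult)
    ultimately show "a (4 * u + 1) = cnj (zt n) ^ k * gauss (zt n) * (cnj (zt l) ^ k) ^ u"
      unfolding a_def z4 by simp
  qed simp
  also have "(\<Sum>u<2 ^ l. a (4 * u + 3)) = cnj (zt n) ^ (3 * k) * gauss (cnj (zt n)) * (\<Sum>u<2 ^ l. (cnj (zt l) ^ k) ^ u)"
    unfolding sum_distrib_left
  proof (rule sum.cong)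
    fix u :: nat
    \<comment> \<open>A power of \<open>zt n\<close> is rewritten as the power \<open>j\<close> of
      its conjugate; both factors of \<open>j\<close> are 3 modulo 4, so \<open>j\<close> is 1
      modulo 4.\<close>
    define j where "j = (2 ^ n - 1) * (4 * u + 3)"
    have cz: "cnj (zt n) ^ 2 ^ n = 1" by (simp flip: complex_cnj_power)
    have zz: "cnj (zt n) * zt n = 1" using root_mult_cnj[OF zt_power_q1[OF n(2)]] by simp
    have "cnj (zt n) ^ (2 ^ n - 1) * cnj (zt n) = 1" using cz by (simp flip: power_Suc2)
    then have "cnj (zt n) ^ (2 ^ n - 1) = zt n" using zz
      by (metis mult.assoc mult.commute mult.right_neutral)
    then have "zt n ^ (4 * u + 3) = cnj (zt n) ^ j" by (simp add: j_def power_mult)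
    moreover have "[j = 1] (mod 4)"
    proof -
      obtain x where "(2::nat) ^ l = Suc x" by (metis not0_implies_Suc power_not_zero zero_neq_numeral)
      then have "2 ^ n - 1 = 4 * x + 3" by (simp add: nl)
      then have "j = 4 * (4 * x * u + 3 * x + 3 * u + 2) + 1" by (simp add: j_def algebra_simps)
      then show ?thesis by (simp only: cong_def mod_mult_self4)
    qed
    then have "gauss (cnj (zt n) ^ j) = gauss (cnj (zt n))"
      by (rule gauss_power_1_mod_4[OF cz n])
    moreover have "cnj (zt n) ^ ((4 * u + 3) * k) = cnj (zt n) ^ (3 * k) * (cnj (zt n ^ 4) ^ k) ^ u"
      by (simp add: algebra_simps power_add flip: power_mult)
    ultimately show "a (4 * u + 3) = cnj (zt n) ^ (3 * k) * gauss (cnj (zt n)) * (cnj (zt l) ^ k) ^ u"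
      unfolding a_def z4 by simp
  qed simp
  also have "(\<Sum>u<2 ^ l. (cnj (zt l) ^ k) ^ u) = (if 2 ^ l dvd k then 2 ^ l else 0)"
  proof -
    have "(\<Sum>u<2 ^ l. (cnj (zt l) ^ k) ^ u) = cnj (\<Sum>u<2 ^ l. (zt l ^ k) ^ u)" by simp
    also have "\<dots> = (if 2 ^ l dvd k then 2 ^ l else 0)"
      by (subst sum_powers_root_of_unity) simp_all
    finally show ?thesis .
  qed
  also have "cnj (zt n) ^ k * gauss (zt n) * (if 2 ^ l dvd k then 2 ^ l else 0)
      + cnj (zt n) ^ (3 * k) * gauss (cnj (zt n)) * (if 2 ^ l dvd k then 2 ^ l else 0) = period_step n k"
  proof (cases "2 ^ l dvd k")
    case True
    then obtain k' where k': "k = 2 ^ l * k'" by blast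
    have "cnj (zt n) ^ k = (-\<i>) ^ k'"
      unfolding k' power_mult by (simp flip: complex_cnj_power add: zl)
    moreover have "cnj (zt n) ^ (3 * k) = (cnj (zt n) ^ k) ^ 3" by (simp add: mult.commute flip: power_mult)
    moreover have "((-\<i>) ^ k') ^ 3 = \<i> ^ k'"
    proof -
      have "((-\<i>) ^ k') ^ 3 = ((-\<i>) ^ 3) ^ k'" by (simp only: power_mult[symmetric] mult.commute)
      then show ?thesis by (simp add: power3_eq_cube)
    qed
    ultimately show ?thesis using k' by (simp add: period_step_def l_def[symmetric] algebra_simps)
  next
    case False
    then show ?thesis by (simp add: period_step_def l_def[symmetric])
  qed
  finally show ?thesis by (simp add: add.assoc)
qed

end

lemma power_mod_4:
  assumes "(w::complex) ^ 4 = 1"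
  shows "w ^ n = w ^ (n mod 4)"
proof -
  have "w ^ n = w ^ (4 * (n div 4) + n mod 4)" by simp
  also have "\<dots> = w ^ (n mod 4)" using assms by (simp only: power_add power_mult) simp
  finally show ?thesis .
qed

section \<open>Values of the Gauss sums\<close>

context field_5_mod_8
begin

text \<open>When \<open>2 ^ (r - 1)\<close> divides \<open>s\<close> this is \<open>q\<close> to the
  power \<open>(2 ^ (r - 1) - 1) / 2 ^ r\<close>. Writing it with \<open>sqrt p\<close> includes
  \<open>r = v + 1\<close>, where the exponent is odd and the number irrational.\<close>

definition radix :: "nat \<Rightarrow> real" where
  "radix r = sqrt (real p) ^ (s - s div 2 ^ (r - 1))"

lemma two_power_dvd_s: "n \<le> v \<Longrightarrow> 2 ^ n dvd s"
  using v(1) by (meson dvd_trans le_imp_power_dvd)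

lemma radix_square: "(radix r)\<^sup>2 = real p ^ (s - s div 2 ^ (r - 1))"
  unfolding radix_def by (simp add: power_mult[symmetric] mult.commute) (simp add: power_mult)

lemma radix_eq_power:
  assumes "1 \<le> r" "r \<le> v"
  shows "radix r = real p ^ (s * (2 ^ (r - 1) - 1) div 2 ^ r)"
proof -
  obtain k where k: "s = 2 ^ r * k" using two_power_dvd_s[OF assms(2)] by blast
  obtain r' where r: "r = Suc r'" using assms(1) by (cases r) auto
  have "s * (2 ^ (r - 1) - 1) = 2 ^ r * (k * (2 ^ r' - 1))" by (simp only: k r mult.assoc diff_Suc_1)
  then have "s * (2 ^ (r - 1) - 1) div 2 ^ r = k * (2 ^ r' - 1)" by simp
  moreover have "s - s div 2 ^ (r - 1) = 2 * (k * (2 ^ r' - 1))"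
    by (simp add: k r mult.assoc algebra_simps)
  ultimately have "s - s div 2 ^ (r - 1) = 2 * (s * (2 ^ (r - 1) - 1) div 2 ^ r)" by simp
  then show ?thesis unfolding radix_def by (simp add: power_mult)
qed

lemma reduced_period_eq_sum_steps:
  assumes "1 \<le> n" "n \<le> v + 2"
  shows "reduced_period s \<gamma> (2 ^ n) k = (-1) ^ k * gauss (-1) + (\<Sum>r=2..n. period_step r k)"
  using assms
proof (induction n rule: dec_induct)
  case base
  then show ?case by (simp add: reduced_period_2)
next
  case (step n)
  then show ?case using reduced_period_double[of "Suc n" k] by (simp add: add.assoc)
qed

lemma gauss_cnj_zt: "n \<le> v + 1 \<Longrightarrow> gauss (cnj (zt n)) = cnj (gauss (zt n))"
  using gauss_cnj[of "zt n"] mchar_minus_1[of n] by simp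

lemma gauss_cnj_zt_top: "gauss (cnj (zt (v + 2))) = - cnj (gauss (zt (v + 2)))"
  using gauss_cnj[OF zt_power_q1[of "v + 2"]] mchar_minus_1_top by simp

lemma period_step_eq_0: "\<not> 2 ^ (n - 2) dvd k \<Longrightarrow> period_step n k = 0"
  by (simp add: period_step_def)

lemma period_step_eq:
  "period_step n (2 ^ (n - 2) * j) = 2 ^ (n - 2) *
     ((-\<i>) ^ (j mod 4) * gauss (zt n) + \<i> ^ (j mod 4) * gauss (cnj (zt n)))"
proof -
  have "(-\<i>) ^ 4 = 1" "\<i> ^ 4 = 1" by (simp_all add: eval_nat_numeral)
  then have "(-\<i>) ^ j = (-\<i>) ^ (j mod 4)" "\<i> ^ j = \<i> ^ (j mod 4)" by (blast intro: power_mod_4)+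
  then show ?thesis by (simp add: period_step_def)
qed

text \<open>A step with \<open>r - 2 > t\<close> vanishes at an odd multiple of
  \<open>2 ^ t\<close>, and every other step sees the odd part only modulo 4. This feeds
  \<open>prod_two_adic_class\<close>.\<close>

lemma reduced_period_two_adic:
  assumes "1 \<le> n" "n \<le> v + 2" "[i = j] (mod 4)" "odd i"
  shows "reduced_period s \<gamma> (2 ^ n) (2 ^ t * i) = reduced_period s \<gamma> (2 ^ n) (2 ^ t * j)"
proof -
  have "odd j"
  proof -
    have "i mod 4 mod 2 = j mod 4 mod 2" using assms(3) by (simp add: cong_def)
    then have "i mod 2 = j mod 2" by (simp add: mod_mod_cancel)
    then show ?thesis using assms(4) by presburger
  qed
  have step: "period_step r (2 ^ t * i) = period_step r (2 ^ t * j)" for r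
  proof (cases "r - 2 \<le> t")
    case True
    have eq: "2 ^ t * x = 2 ^ (r - 2) * (2 ^ (t - (r - 2)) * x)" for x :: nat
      using True by (simp flip: power_add mult.assoc)
    have "(2 ^ (t - (r - 2)) * i) mod 4 = (2 ^ (t - (r - 2)) * j) mod 4"
      using assms(3) unfolding cong_def by (metis mod_mult_right_eq)
    then show ?thesis by (simp only: eq period_step_eq)
  next
    case False
    have "\<not> 2 ^ (r - 2) dvd 2 ^ t * x" if "odd x" for x :: nat
    proof
      assume "2 ^ (r - 2) dvd 2 ^ t * x"
      moreover have "(2::nat) ^ Suc t dvd 2 ^ (r - 2)" using False by (intro le_imp_power_dvd) simp
      ultimately have "2 ^ Suc t dvd 2 ^ t * x" by (rule dvd_trans[rotated])
      then show False using that by simp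
    qed
    then show ?thesis using period_step_eq_0 assms(4) \<open>odd j\<close> by simp
  qed
  have "(-1::complex) ^ (2 ^ t * i) = (-1) ^ (2 ^ t * j)"
    using assms(4) \<open>odd j\<close> by (simp add: minus_one_power_iff)
  then show ?thesis unfolding reduced_period_eq_sum_steps[OF assms(1,2)] by (simp only: step)
qed

text \<open>
  For \<open>r \<le> v\<close> the sign of the Gauss sum is known, so that \<open>gauss_zt_square\<close> identifies the
  square of the next one; its square root is taken among the Gaussian integers \<open>c r + d r * \<i>\<close>.
\<close>

lemma gauss_values:
  obtains c d sg :: "nat \<Rightarrow> int" where
    "\<And>n. n \<le> v \<Longrightarrow> [c n = 1] (mod 4) \<and> \<not> int p dvd c n \<and> (c n)\<^sup>2 + (d n)\<^sup>2 = int p ^ (s div 2 ^ n)"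
    "\<And>r. sg r = 1 \<or> sg r = -1" "\<And>r. 2 \<le> r \<Longrightarrow> r \<le> v \<Longrightarrow> sg r = 1"
    "\<And>r. 2 \<le> r \<Longrightarrow> r \<le> v + 1 \<Longrightarrow>
       gauss (zt r) = - of_real (of_int (sg r) * radix r) * (of_int (c (r - 1)) + of_int (d (r - 1)) * \<i>)"
proof -
  obtain a b :: int where ab: "jacobi \<i> (-1) = - (of_int a + of_int b * \<i>)" "[a = 1] (mod 4)"
    "\<not> int p dvd a" "a\<^sup>2 + b\<^sup>2 = int p ^ s"
    by (rule jacobi_quartic)
  have pint: "prime (int p)" using prime_p by simp
  obtain c d where cd: "c 0 = a" "d 0 = b"
    and sq: "\<And>n. n \<le> v \<Longrightarrow> [c n = 1] (mod 4) \<and> \<not> int p dvd c n \<and> (c n)\<^sup>2 + (d n)\<^sup>2 = int p ^ (s div 2 ^ n)"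
    and step: "\<And>n. n < v \<Longrightarrow> c n = (c (Suc n))\<^sup>2 - (d (Suc n))\<^sup>2 \<and> d n = 2 * c (Suc n) * d (Suc n)"
    by (rule two_squares_chain[OF pint int_p_1_mod_4 ab(2,3,4) s_pos v(1)]) blast
  define z where "z n = (of_int (c n) + of_int (d n) * \<i> :: complex)" for n
  have z_step: "z n = (z (Suc n))\<^sup>2" if "n < v" for n
    unfolding z_def conjunct1[OF step[OF that]] conjunct2[OF step[OF that]]
    by (simp add: power2_eq_square algebra_simps)
  \<comment> \<open>The default -1 becomes meaningful once the squares of both sides are known to
    agree, which is the premise of \<open>sgI\<close>.\<close>
  define sg :: "nat \<Rightarrow> int" where "sg r = (if gauss (zt r) = - of_real (radix r) * z (r - 1) then 1 else -1)" for r
  have sg: "sg r = 1 \<or> sg r = -1" for r by (simp add: sg_def)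
  have sgI: "gauss (zt r) = - of_real (of_int (sg r) * radix r) * z (r - 1)"
    if "(gauss (zt r))\<^sup>2 = (of_real (radix r) * z (r - 1))\<^sup>2" for r
    using that unfolding power2_eq_iff by (auto simp: sg_def)
  \<comment> \<open>Value and sign are proved together: the value at \<open>r\<close> uses the sign
    at \<open>r - 1\<close>, and the sign at \<open>r\<close> uses all values up to
    \<open>r\<close>. At \<open>r = v + 1\<close> only the value is claimed, with its sign
    open.\<close>
  have main: "gauss (zt r) = - of_real (of_int (sg r) * radix r) * z (r - 1) \<and> (r \<le> v \<longrightarrow> sg r = 1)"
    if "2 \<le> r" "r \<le> v + 1" for r
    using that
  proof (induction r rule: less_induct)
    case (less r)
    have val: "gauss (zt r) = - of_real (of_int (sg r) * radix r) * z (r - 1)"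
    proof (cases "r = 2")
      case True
      have root_i: "\<i> ^ q1 = 1" using zt_power_q1[of 2] zt_2 by simp
      have "mchar \<i> 4 = 1" using mchar_4[of 2] zt_2 v_ge_2 by simp
      then have "(gauss \<i>)\<^sup>2 = jacobi \<i> (-1) * gauss (-1)"
        using gauss_square[OF odd_p root_i] by simp
      also have "\<dots> = of_nat (p ^ (s div 2)) * z 0"
        by (simp add: ab(1) gauss_quadratic z_def cd algebra_simps)
      also have "\<dots> = of_nat (p ^ (s div 2)) * (z 1)\<^sup>2" using z_step[of 0] v_ge_2 by simp
      also have "of_nat (p ^ (s div 2)) = (of_real (radix 2))\<^sup>2"
      proof -
        have "s - s div 2 = s div 2" using four_dvd_s by presburger
        then have "real (p ^ (s div 2)) = (radix 2)\<^sup>2" by (simp add: radix_square)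
        then show ?thesis by (metis of_real_of_nat_eq of_real_power)
      qed
      finally have "(gauss (zt 2))\<^sup>2 = (of_real (radix 2) * z (2 - 1))\<^sup>2"
        using zt_2 by (simp add: power_mult_distrib)
      then show ?thesis unfolding True by (rule sgI)
    next
      case False
      then have r: "3 \<le> r" using less.prems by simp
      have IH: "gauss (zt (r - 1)) = - of_real (radix (r - 1)) * z (r - 2)"
        using less.IH[of "r - 1"] r less.prems by (simp add: diff_diff_eq numeral_2_eq_2)
      have "(gauss (zt r))\<^sup>2 = gauss (-1) * gauss (zt (r - 1))"
        using gauss_zt_square[of r] r less.prems by simp
      also have "\<dots> = of_real (real p ^ (s div 2) * radix (r - 1)) * z (r - 2)"
        unfolding IH gauss_quadratic by simp
      also have "z (r - 2) = (z (r - 1))\<^sup>2"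
        using z_step[of "r - 2"] r less.prems by (simp add: Suc_diff_Suc numeral_2_eq_2)
      \<comment> \<open>Exponents of \<open>sqrt p\<close>: with
        \<open>k = s div 2 ^ (r - 1)\<close> the two factors contribute \<open>s\<close> and
        \<open>s - 2 * k\<close>, together twice \<open>s - k\<close>.\<close>
      also have "real p ^ (s div 2) * radix (r - 1) = (radix r)\<^sup>2"
      proof -
        have "2 ^ (r - 1) dvd s" using two_power_dvd_s[of "r - 1"] less.prems by simp
        then obtain k where k: "s = 2 ^ (r - 1) * k" by (elim dvdE)
        obtain r' where r': "r = r' + 3" using r by (metis add.commute le_Suc_ex)
        have s2: "s div 2 ^ (r - 2) = 2 * k" "s div 2 ^ (r - 1) = k" "s = 2 * (s div 2)"
          by (simp_all add: k r')
        have "k \<le> s" by (simp add: k)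
        then have e: "s + (s - 2 * k) = 2 * (s - k)" if "2 * k \<le> s" using that by simp
        have "real p ^ (s div 2) = sqrt (real p) ^ s" using arg_cong[OF s2(3), of "\<lambda>n. sqrt (real p) ^ n"] by (simp add: power_mult)
        moreover have "radix (r - 1) = sqrt (real p) ^ (s - 2 * k)"
          unfolding radix_def s2(1)[symmetric] by (simp add: r')
        ultimately have "real p ^ (s div 2) * radix (r - 1) = sqrt (real p) ^ (s + (s - 2 * k))"
          by (simp only: power_add)
        also have "\<dots> = sqrt (real p) ^ (2 * (s - k))" by (subst e) (simp_all add: k r')
        also have "\<dots> = (radix r)\<^sup>2" unfolding radix_def s2(2) by (simp only: power_mult[symmetric] mult.commute)
        finally show ?thesis .
      qed
      finally have "(gauss (zt r))\<^sup>2 = (of_real (radix r) * z (r - 1))\<^sup>2"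
        by (simp add: power_mult_distrib)
      then show ?thesis by (rule sgI)
    qed
    moreover have "sg r = 1" if "r \<le> v"
    proof -
      define t where "t i = (SOME t. odd t \<and> reduced_period s \<gamma> (2 ^ i) 0 = 1 + 2 ^ i * of_int t)" for i
      have t: "odd (t i) \<and> reduced_period s \<gamma> (2 ^ i) 0 = 1 + 2 ^ i * of_int (t i)" if "i \<le> v" for i
        unfolding t_def by (rule someI_ex) (use reduced_period_at_0[OF that] in blast)
      show ?thesis
      proof (rule sign_determination[where v = r and c = c and d = d and t = t and sg = sg,
            OF pint int_p_1_mod_4 two_power_dvd_s[OF \<open>r \<le> v\<close>]])
        show "[c n = 1] (mod 4) \<and> (c n)\<^sup>2 + (d n)\<^sup>2 = int p ^ (s div 2 ^ n)" if "n \<le> r" for n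
          using sq[of n] that \<open>r \<le> v\<close> by simp
        show "c n = (c (Suc n))\<^sup>2 - (d (Suc n))\<^sup>2 \<and> d n = 2 * c (Suc n) * d (Suc n)" if "n < r" for n
          using step[of n] that \<open>r \<le> v\<close> by simp
        fix k assume k: "2 \<le> k" "k \<le> r"
        have "of_int (1 + 2 ^ k * t k) = reduced_period s \<gamma> (2 ^ k) 0"
          using t[of k] k \<open>r \<le> v\<close> by simp
        also have "\<dots> = gauss (-1) + (\<Sum>i=2..k. period_step i 0)"
          using reduced_period_eq_sum_steps[of k 0] k \<open>r \<le> v\<close> by simp
        also have "(\<Sum>i=2..k. period_step i 0) =
            (\<Sum>i=2..k. of_int (- (2 ^ (i - 1) * (sg i * c (i - 1)) * int p ^ (s * (2 ^ (i - 1) - 1) div 2 ^ i))))"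
        proof (rule sum.cong)
          fix i assume i: "i \<in> {2..k}"
          then have iv: "2 \<le> i" "i \<le> r" "i \<le> v" using k \<open>r \<le> v\<close> by auto
          have G: "gauss (zt i) = - of_real (of_int (sg i) * radix i) * z (i - 1)"
          proof (cases "i = r")
            case False
            then have "i < r" "i \<le> v + 1" using iv by simp_all
            then show ?thesis using less.IH[of i] iv(1) by blast
          qed (use val in \<open>simp only:\<close>)
          obtain i' where i': "i = 2 + i'" using iv(1) le_Suc_ex by blast
          have "period_step i 0 = 2 ^ (i - 2) * (gauss (zt i) + cnj (gauss (zt i)))"
            using period_step_eq[of i 0] gauss_cnj_zt[of i] iv(3) by simp
          also have "\<dots> = of_real (2 ^ (i - 2) * (2 * Re (gauss (zt i))))"
            by (simp add: complex_add_cnj)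
          also have "Re (gauss (zt i)) = - (of_int (sg i) * radix i * of_int (c (i - 1)))"
            unfolding G by (simp add: z_def)
          also have "radix i = real_of_int (int p ^ (s * (2 ^ (i - 1) - 1) div 2 ^ i))"
            using radix_eq_power[of i] iv by simp
          finally show "period_step i 0
              = of_int (- (2 ^ (i - 1) * (sg i * c (i - 1)) * int p ^ (s * (2 ^ (i - 1) - 1) div 2 ^ i)))"
            by (simp add: i' mult_ac)
        qed simp
        also have "gauss (-1) = of_int (- (int p ^ (s div 2)))" by (simp add: gauss_quadratic)
        finally have "(of_int (1 + 2 ^ k * t k) :: complex) = of_int (- (int p ^ (s div 2))
            - (\<Sum>i=2..k. 2 ^ (i - 1) * (sg i * c (i - 1)) * int p ^ (s * (2 ^ (i - 1) - 1) div 2 ^ i)))"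
          by (simp add: sum_negf)
        then have "1 + 2 ^ k * t k = - (int p ^ (s div 2))
            - (\<Sum>i=2..k. 2 ^ (i - 1) * (sg i * c (i - 1)) * int p ^ (s * (2 ^ (i - 1) - 1) div 2 ^ i))"
          by (simp only: of_int_eq_iff)
        then show "odd (t k) \<and> - (int p ^ (s div 2))
            - (\<Sum>i=2..k. 2 ^ (i - 1) * (sg i * c (i - 1)) * int p ^ (s * (2 ^ (i - 1) - 1) div 2 ^ i))
            = 1 + 2 ^ k * t k"
          using t[of k] k \<open>r \<le> v\<close> by simp
      qed (use sg less.prems in auto)
    qed
    ultimately show ?case by blast
  qed
  show ?thesis
    by (rule that[OF sq sg]) (use main in \<open>auto simp: z_def\<close>)
qed

end

subsection \<open>Irreducible rational polynomials\<close>

abbreviation complex_poly :: "rat poly \<Rightarrow> complex poly" where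
  "complex_poly \<equiv> map_poly of_rat"

lemma complex_poly_simps:
  "complex_poly (P * Q) = complex_poly P * complex_poly Q"
  "complex_poly (P + Q) = complex_poly P + complex_poly Q"
  "complex_poly (P - Q) = complex_poly P - complex_poly Q"
  "complex_poly (Polynomial.smult x P) = Polynomial.smult (of_rat x) (complex_poly P)"
  "complex_poly 1 = 1"
  by (auto intro!: poly_eqI simp: coeff_map_poly Polynomial.coeff_mult of_rat_sum of_rat_mult of_rat_add of_rat_diff)

lemma complex_poly_power: "complex_poly (P ^ n) = complex_poly P ^ n"
  by (induction n) (simp_all add: complex_poly_simps)

lemma complex_poly_prod: "complex_poly (\<Prod>i\<in>A. F i) = (\<Prod>i\<in>A. complex_poly (F i))"
  by (induction A rule: infinite_finite_induct) (simp_all add: complex_poly_simps)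

lemma complex_poly_pCons: "complex_poly (pCons a P) = pCons (of_rat a) (complex_poly P)"
  by (rule poly_eqI) (simp add: coeff_map_poly Polynomial.coeff_pCons split: nat.split)

lemma complex_poly_inject: "complex_poly P = complex_poly Q \<longleftrightarrow> P = Q"
  by (auto simp: poly_eq_iff coeff_map_poly)

lemma poly_complex_poly_of_rat: "poly (complex_poly P) (of_rat x) = of_rat (poly P x)"
  by (induction P) (simp_all add: complex_poly_pCons of_rat_add of_rat_mult)

lemma of_rat_complex: "(of_rat x :: complex) = of_real (of_rat x)"
  by (cases x) (simp add: of_rat_rat)

lemma prod_mset_repeat_mset: "prod_mset (repeat_mset n M) = prod_mset M ^ n"
  by (induction n) (simp_all add: ac_simps)

lemma prod_mset_sum: "prod_mset (\<Sum>t\<in>A. F t) = (\<Prod>t\<in>A. prod_mset (F t))"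
  by (induction A rule: infinite_finite_induct) simp_all

text \<open>Monic irreducible rational polynomials are normalised primes, so any decomposition is
  the multiset of the prime factorization; the embedding into complex polynomials is
  injective.\<close>

lemma unique_irreducible_decompositionI:
  assumes P: "P = complex_poly (\<Prod>\<^sub># M)" and M: "\<And>f. f \<in># M \<Longrightarrow> irreducible f \<and> lead_coeff f = 1"
  shows "unique_irreducible_decomposition P M"
proof -
  have prime: "prime f" if "irreducible f" "lead_coeff f = 1" for f :: "rat poly"
  proof -
    have "normalize f = f" unfolding normalize_poly_def that(2) by (simp add: pCons_one)
    then show ?thesis using irreducible_imp_prime_elem[OF that(1)] by (simp add: prime_def)
  qed
  have "N = M" if N: "irreducible_decomposition P N" for N
  proof -
    have "complex_poly (\<Prod>\<^sub># N) = complex_poly (\<Prod>\<^sub># M)"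
      using N P by (simp add: irreducible_decomposition_def)
    then have eq: "\<Prod>\<^sub># N = \<Prod>\<^sub># M" by (simp only: complex_poly_inject)
    have "prime_factorization (\<Prod>\<^sub># N) = N"
    proof (rule prime_factorization_prod_mset_primes)
      show "prime f" if "f \<in># N" for f
        using N that unfolding irreducible_decomposition_def by (intro prime) blast+
    qed
    then have "N = prime_factorization (\<Prod>\<^sub># N)" by (rule sym)
    also have "\<dots> = prime_factorization (\<Prod>\<^sub># M)" by (rule arg_cong[OF eq])
    also have "\<dots> = M"
    proof (rule prime_factorization_prod_mset_primes)
      show "prime f" if "f \<in># M" for f using M[OF that] by (intro prime) blast+
    qed
    finally show ?thesis .
  qed
  moreover have "irreducible_decomposition P M"
    unfolding irreducible_decomposition_def using M by (intro conjI ballI) (rule P, simp_all)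
  ultimately show ?thesis unfolding unique_irreducible_decomposition_def by (intro conjI allI impI)
qed

lemma irreducible_by_degreeI:
  fixes f :: "rat poly"
  assumes "degree f > 0" "\<And>a b. f = a * b \<Longrightarrow> degree a > 0 \<Longrightarrow> degree b > 0 \<Longrightarrow> degree a \<le> degree b \<Longrightarrow> False"
  shows "irreducible f"
proof (rule irreducibleI)
  show f0: "f \<noteq> 0" using assms(1) by auto
  show "\<not> is_unit f" using assms(1) is_unit_iff_degree[OF f0] by simp
  fix a b assume ab: "f = a * b"
  show "is_unit a \<or> is_unit b"
  proof (rule ccontr)
    assume "\<not> (is_unit a \<or> is_unit b)"
    then have "degree a > 0" "degree b > 0"
      using ab assms(1) by (metis is_unit_iff_degree degree_0 gr0I mult_eq_0_iff less_irrefl)+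
    then show False
      using assms(2)[of a b] assms(2)[of b a] ab by (metis mult.commute nat_le_linear)
  qed
qed

lemma degree_1_root:
  fixes a :: "rat poly"
  assumes "degree a = 1"
  obtains x where "poly a x = 0"
proof -
  obtain u w where "a = [:u, w:]" "w \<noteq> 0" using degree1_coeffs[OF assms] by metis
  then have "poly a (- u / w) = 0" by simp
  then show ?thesis using that by blast
qed

lemma irreducible_no_root:
  fixes f :: "rat poly"
  assumes "degree f = 2" "\<And>x. poly f x \<noteq> 0"
  shows "irreducible f"
proof (rule irreducible_by_degreeI)
  fix a b assume ab: "f = a * b" "degree a > 0" "degree b > 0" "degree a \<le> degree b"
  then have "degree a + degree b = 2" using assms(1) by (metis degree_mult_eq degree_0 less_irrefl)
  then have "degree a = 1" using ab by simp
  then obtain x where "poly a x = 0" using degree_1_root by blast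
  then show False using assms(2)[of x] ab(1) by simp
qed (use assms in simp)

text \<open>After clearing the denominator, compare \<open>p\<close>-adic valuations.\<close>

lemma rational_power_even:
  fixes x :: rat
  assumes "prime p" "x\<^sup>2 = of_nat p ^ h"
  shows "even h"
proof -
  obtain a b :: int where ab: "x = of_int a / of_int b" "b > 0" 
    using Fract_of_int_quotient by (cases x) auto
  have "(of_int (a\<^sup>2) :: rat) = of_int (int p ^ h * b\<^sup>2)"
    using assms(2) ab(2) unfolding ab(1) by (simp add: field_simps)
  then have eq: "a\<^sup>2 = int p ^ h * b\<^sup>2" by (simp only: of_int_eq_iff)
  have p: "prime_elem (int p)" "int p \<noteq> 0" using assms(1) by (auto simp: prime_gt_0_nat)
  have "a \<noteq> 0" using eq ab(2) p(2) by auto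
  have "multiplicity (int p) (a\<^sup>2) = 2 * multiplicity (int p) a"
    using prime_elem_multiplicity_power_distrib[OF p(1) \<open>a \<noteq> 0\<close>] by simp
  moreover have "multiplicity (int p) (int p ^ h * b\<^sup>2) = h + 2 * multiplicity (int p) b"
    using ab(2) p
    by (simp add: prime_elem_multiplicity_mult_distrib prime_elem_multiplicity_power_distrib)
  ultimately have "2 * multiplicity (int p) a = h + 2 * multiplicity (int p) b" using eq by simp
  then show ?thesis by presburger
qed

lemma irreducible_quadratic:
  fixes y e :: rat
  assumes "prime p" "odd h" "e \<noteq> 0"
  shows "irreducible ([:y, 1:]\<^sup>2 - [:e\<^sup>2 * of_nat p ^ h:])"
proof (rule irreducible_no_root)
  show "degree ([:y, 1:]\<^sup>2 - [:e\<^sup>2 * of_nat p ^ h:]) = 2"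
    by (simp add: power2_eq_square)
  show "poly ([:y, 1:]\<^sup>2 - [:e\<^sup>2 * of_nat p ^ h:]) x \<noteq> 0" for x
  proof
    assume "poly ([:y, 1:]\<^sup>2 - [:e\<^sup>2 * of_nat p ^ h:]) x = 0"
    then have "((y + x) / e)\<^sup>2 = of_nat p ^ h" using assms(3) by (simp add: power_divide)
    then show False using rational_power_even[OF assms(1)] assms(2) by blast
  qed
qed

text \<open>A linear factor would give a real root. For a quadratic factor with a nonreal root
  \<open>z\<close>, the imaginary part of the equation expresses \<open>Re z\<close> by its
  coefficients, as half the sum of conjugate roots, so \<open>Re z\<close> would be
  rational.\<close>

lemma irreducible_no_rational_real_part:
  fixes f :: "rat poly"
  assumes "degree f = 4"
    and root: "\<And>z. poly (complex_poly f) z = 0 \<Longrightarrow> Im z \<noteq> 0 \<and> Re z \<notin> \<rat>"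
  shows "irreducible f"
proof (rule irreducible_by_degreeI)
  fix a b assume ab: "f = a * b" "degree a > 0" "degree b > 0" "degree a \<le> degree b"
  then have "degree a + degree b = 4" using assms(1) by (metis degree_mult_eq degree_0 less_irrefl)
  then consider "degree a = 1" | "degree a = 2" using ab by linarith
  then show False
  proof cases
    case 1
    then obtain x where "poly a x = 0" using degree_1_root by blast
    then have "poly (complex_poly f) (of_rat x) = 0"
      using ab(1) by (simp add: poly_complex_poly_of_rat)
    then have "Im (of_rat x) \<noteq> 0" using root by blast
    then show False by (simp add: of_rat_complex)
  next
    case 2
    obtain u w t where a: "a = [:u, w, t:]" and t0: "t \<noteq> 0" using degree2_coeffs[OF 2] by metis
    have "\<not> constant (poly (complex_poly a))"
      using 2 by (simp add: constant_degree degree_map_poly)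
    then obtain z where z: "poly (complex_poly a) z = 0" using fundamental_theorem_of_algebra by blast
    then have "poly (complex_poly f) z = 0" by (simp add: ab(1) complex_poly_simps)
    then have im: "Im z \<noteq> 0" and re: "Re z \<notin> \<rat>" using root by blast+
    have "of_rat u + z * (of_rat w + z * of_rat t) = 0"
      using z by (simp add: a complex_poly_pCons)
    then have "Im (of_real (of_rat u) + z * (of_real (of_rat w) + z * of_real (of_rat t))) = 0"
      by (simp add: of_rat_complex)
    then have "Im z * (of_rat w + 2 * Re z * of_rat t) = 0" by (simp add: algebra_simps)
    then have "of_rat w + 2 * Re z * of_rat t = 0" using im by simp
    then have "Re z = of_rat (- w / (2 * t))"
      using t0 by (simp add: of_rat_divide of_rat_minus of_rat_mult field_simps)
    then show False using re by simp
  qed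
qed (use assms in simp)

text \<open>As a difference of squares the quartic splits over the reals into two quadratics with
  the irrational coefficient \<open>sqrt B\<close>. Completing the square shows that the roots have
  real part \<open>- y\<close> plus or minus \<open>sqrt B / 2\<close>; the last two assumptions
  make the remaining constant negative, so no root is real.\<close>

lemma irreducible_quartic:
  fixes y A B M :: rat
  assumes "B > 0" "\<And>x. x\<^sup>2 \<noteq> B" "A - B / 4 > 0" "B * M\<^sup>2 < (A - B / 4)\<^sup>2"
  shows "irreducible (([:y, 1:]\<^sup>2 + [:A:])\<^sup>2 - [:B:] * [:y + M, 1:]\<^sup>2)"
proof (rule irreducible_no_rational_real_part)
  let ?f = "([:y, 1:]\<^sup>2 + [:A:])\<^sup>2 - [:B:] * [:y + M, 1:]\<^sup>2"
  show "degree ?f = 4" by (simp add: power2_eq_square)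
  define b where "b = sqrt (of_rat B)"
  have b2: "b\<^sup>2 = of_rat B" using assms(1) by (simp add: b_def)
  have b_irr: "b \<notin> \<rat>"
  proof
    assume "b \<in> \<rat>"
    then obtain x where "b = of_rat x" by (elim Rats_cases)
    then have "(of_rat (x\<^sup>2) :: real) = of_rat B" using b2 by (simp add: of_rat_power)
    then show False using assms(2)[of x] by (simp only: of_rat_eq_iff)
  qed
  define \<delta> :: real where "\<delta> = of_rat (A - B / 4)"
  have \<delta>: "\<delta> > 0" "\<bar>b * of_rat M\<bar> < \<delta>"
  proof -
    show "\<delta> > 0" using assms(3) by (simp add: \<delta>_def)
    have "\<bar>b * of_rat M\<bar>\<^sup>2 < \<delta>\<^sup>2"
    proof -
      have "\<bar>b * of_rat M\<bar>\<^sup>2 = of_rat (B * M\<^sup>2)"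
        by (simp add: power_mult_distrib b2 of_rat_mult of_rat_power)
      also have "\<dots> < of_rat ((A - B / 4)\<^sup>2)" using assms(4) by (simp only: of_rat_less)
      finally show ?thesis by (simp add: \<delta>_def of_rat_power)
    qed
    then show "\<bar>b * of_rat M\<bar> < \<delta>" using \<open>\<delta> > 0\<close> by (simp add: power2_less_imp_less)
  qed
  fix x assume root: "poly (complex_poly ?f) x = 0"
  define z where "z = x + of_real (of_rat y)"
  have "(z\<^sup>2 + of_real (of_rat A))\<^sup>2 = of_real (of_rat B) * (z + of_real (of_rat M))\<^sup>2"
    using root by (simp add: complex_poly_simps complex_poly_power complex_poly_pCons z_def
        of_rat_complex of_rat_add algebra_simps)
  also have "\<dots> = (of_real b * (z + of_real (of_rat M)))\<^sup>2"
    by (simp add: power_mult_distrib flip: b2)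
  finally obtain \<sigma> :: real where \<sigma>: "\<sigma> = 1 \<or> \<sigma> = -1"
    and eq: "z\<^sup>2 + of_real (of_rat A) = of_real \<sigma> * (of_real b * (z + of_real (of_rat M)))"
    unfolding power2_eq_iff by (metis mult_1 mult_minus1 of_real_1 of_real_minus)
  have \<sigma>2: "\<sigma>\<^sup>2 = 1" using \<sigma> by auto
  define u where "u = z - of_real (\<sigma> * b / 2)"
  define \<epsilon> where "\<epsilon> = \<sigma> * (b * of_rat M) - \<delta>"
  have "\<epsilon> < 0" using \<sigma> \<delta>(2) by (auto simp: \<epsilon>_def abs_less_iff)
  have "u\<^sup>2 = z\<^sup>2 - of_real (\<sigma> * b) * z + of_real (\<sigma>\<^sup>2 * b\<^sup>2 / 4)"
    by (simp add: u_def power2_eq_square algebra_simps)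
  also have "\<dots> = of_real \<epsilon>"
    using eq by (simp add: \<sigma>2 b2 \<epsilon>_def \<delta>_def of_rat_diff of_rat_divide algebra_simps)
  finally have u2: "u\<^sup>2 = of_real \<epsilon>" .
  have "Im (u\<^sup>2) = 0" "Re (u\<^sup>2) < 0" using \<open>\<epsilon> < 0\<close> by (simp_all add: u2)
  then have "Re u * Im u = 0" "(Re u)\<^sup>2 < (Im u)\<^sup>2" by (auto simp: power2_eq_square)
  then have u: "Im u \<noteq> 0" "Re u = 0" by auto
  then have "Im x \<noteq> 0" and re: "Re x = \<sigma> * b / 2 - of_rat y" by (simp_all add: u_def z_def)
  moreover have "Re x \<notin> \<rat>"
  proof
    assume "Re x \<in> \<rat>"
    then have "\<sigma> * (2 * (Re x + of_rat y)) \<in> \<rat>" using \<sigma> by auto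
    also have "\<sigma> * (2 * (Re x + of_rat y)) = \<sigma>\<^sup>2 * b" by (simp add: re power2_eq_square)
    finally show False using b_irr \<sigma>2 by simp
  qed
  ultimately show "Im x \<noteq> 0 \<and> Re x \<notin> \<rat>" by blast
qed

subsection \<open>Factors of the period polynomial\<close>

text \<open>The shift in \<open>C r = c (r - 1)\<close> reflects that \<open>C r\<close> belongs to
  the exponent \<open>s div 2 ^ (r - 1)\<close>. \<open>D\<close> is tied to \<open>d\<close> only
  up to sign and \<open>sg (v + 1)\<close> stays open; the rational factors are, singly or in pairs,
  invariant under these signs.\<close>

locale gauss_data = field_5_mod_8 \<gamma> p s v for \<gamma> :: "'a::{field,finite}" and p s v +
  fixes c d sg C D :: "nat \<Rightarrow> int"
  assumes sq: "n \<le> v \<Longrightarrow> [c n = 1] (mod 4) \<and> \<not> int p dvd c n \<and> (c n)\<^sup>2 + (d n)\<^sup>2 = int p ^ (s div 2 ^ n)"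
    and sg: "sg r = 1 \<or> sg r = -1"
    and sg_1: "2 \<le> r \<Longrightarrow> r \<le> v \<Longrightarrow> sg r = 1"
    and gauss_zt: "2 \<le> r \<Longrightarrow> r \<le> v + 1 \<Longrightarrow> gauss (zt r) =
      - of_real (of_int (sg r) * radix r) * (of_int (c (r - 1)) + of_int (d (r - 1)) * \<i>)"
    and C: "2 \<le> r \<Longrightarrow> r \<le> v + 1 \<Longrightarrow> C r = c (r - 1)"
    and D: "2 \<le> r \<Longrightarrow> r \<le> v + 1 \<Longrightarrow> \<bar>D r\<bar> = \<bar>d (r - 1)\<bar>"
begin

declare One_nat_def [simp del] add_2_eq_Suc [simp del] add_2_eq_Suc' [simp del]

definition amp :: "nat \<Rightarrow> real" where "amp r = 2 ^ (r - 1) * of_int (sg r) * radix r"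

text \<open>For \<open>1 <= t <= v\<close>, \<open>- Y t\<close> is the period of order
  \<open>2 ^ t\<close> at multiples of \<open>2 ^ t\<close>.\<close>

definition Y :: "nat \<Rightarrow> real" where
  "Y t = real p ^ (s div 2) + (\<Sum>r=2..t. 2 ^ (r - 1) * of_int (c (r - 1)) * radix r)"

lemma period_step_gauss:
  assumes r: "2 \<le> r" "r \<le> v + 1"
  shows "period_step r (2 ^ (r - 2) * j) = of_real (amp r * of_int
    (if j mod 4 = 0 then - c (r - 1) else if j mod 4 = 1 then - d (r - 1)
     else if j mod 4 = 2 then c (r - 1) else d (r - 1)))"
proof -
  obtain r' where r': "r = 2 + r'" using r(1) le_Suc_ex by blast
  have "j mod 4 = 0 \<or> j mod 4 = 1 \<or> j mod 4 = 2 \<or> j mod 4 = 3" by presburger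
  then show ?thesis
    unfolding period_step_eq gauss_cnj_zt[OF r(2)] gauss_zt[OF r]
    by (elim disjE) (simp_all add: complex_eq_iff amp_def r' power2_eq_square power3_eq_cube algebra_simps)
qed

lemma sum_period_step_low:
  assumes "2 ^ t dvd k" "t \<le> v"
  shows "(\<Sum>r=2..t. period_step r k) = of_real (real p ^ (s div 2) - Y t)"
proof -
  have "(\<Sum>r=2..t. period_step r k) = (\<Sum>r=2..t. of_real (- (2 ^ (r - 1) * of_int (c (r - 1)) * radix r)))"
  proof (rule sum.cong)
    fix r assume r: "r \<in> {2..t}"
    obtain k' where k': "k = 2 ^ t * k'" using assms(1) by blast
    have "k = 2 ^ (r - 2) * (2 ^ (t - r) * 4 * k')"
    proof -
      have e: "r - 2 + (t - r) + 2 = t" using r by simp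
      have "(2::nat) ^ (r - 2) * 2 ^ (t - r) * 2 ^ 2 = 2 ^ t" by (simp only: power_add[symmetric] e)
      then show ?thesis by (simp add: k' mult.assoc[symmetric])
    qed
    then have "period_step r k = of_real (amp r * of_int (- c (r - 1)))"
      using period_step_gauss[of r "2 ^ (t - r) * 4 * k'"] r assms(2) by (simp add: mult.assoc)
    then show "period_step r k = of_real (- (2 ^ (r - 1) * of_int (c (r - 1)) * radix r))"
      using sg_1[of r] r assms(2) by (simp add: amp_def)
  qed simp
  then show ?thesis by (simp add: Y_def sum_negf)
qed

text \<open>Up to sign the centre of the two period values at odd multiples of \<open>2 ^ t\<close>;
  \<open>dev t\<close> is their deviation from it. At \<open>t = 0\<close> the odd index reverses
  the quadratic Gauss sum, hence the separate value.\<close>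

definition mid :: "nat \<Rightarrow> real" where
  "mid t = (if t = 0 then - (real p ^ (s div 2)) else Y t - amp (t + 1) * of_int (c t))"

definition dev :: "nat \<Rightarrow> real" where "dev t = amp (t + 2) * of_int (d (t + 1))"

text \<open>At \<open>2 ^ t * j\<close> the step \<open>t + 1\<close> enters with the sign of its
  \<open>c\<close> term reversed, the step \<open>t + 2\<close> contributes a \<open>d\<close> term
  whose sign depends on \<open>j\<close> modulo 4, and all later steps vanish.\<close>

lemma period_odd_multiple:
  assumes m: "t + 2 \<le> m" "m \<le> v + 2" "t + 1 \<le> v" "odd j"
  shows "reduced_period s \<gamma> (2 ^ m) (2 ^ t * j)
    = of_real (- mid t + (if j mod 4 = 1 then - dev t else dev t))"
proof -
  have j4: "j mod 4 = 1 \<or> j mod 4 = 3" using m(4) by presburger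
  have step2: "period_step (t + 2) (2 ^ t * j) = of_real (if j mod 4 = 1 then - dev t else dev t)"
  proof -
    have idx: "t + 2 - 2 = t" "t + 2 - 1 = t + 1" by simp_all
    show ?thesis using period_step_gauss[of "t + 2" j, unfolded idx] m(3) j4 by (auto simp: dev_def)
  qed
  have "period_step r (2 ^ t * j) = 0" if "r > t + 2" for r
  proof (rule period_step_eq_0)
    show "\<not> 2 ^ (r - 2) dvd 2 ^ t * j"
    proof
      assume "2 ^ (r - 2) dvd 2 ^ t * j"
      moreover have "(2::nat) ^ Suc t dvd 2 ^ (r - 2)" using that by (intro le_imp_power_dvd) simp
      ultimately have "2 ^ Suc t dvd 2 ^ t * j" by (rule dvd_trans[rotated])
      then show False using m(4) by simp
    qed
  qed
  then have "(\<Sum>r=2..m. period_step r (2 ^ t * j)) = (\<Sum>r=2..t + 2. period_step r (2 ^ t * j))"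
    by (intro sum.mono_neutral_right) (use m(1) in auto)
  also have "\<dots> = (\<Sum>r=2..t + 1. period_step r (2 ^ t * j)) + period_step (t + 2) (2 ^ t * j)"
  proof -
    have "t + 2 = Suc (t + 1)" by simp
    then show ?thesis by (simp only: sum.cl_ivl_Suc) simp
  qed
  also have "(-1) ^ (2 ^ t * j) * gauss (-1) + \<dots> = of_real (- mid t) + period_step (t + 2) (2 ^ t * j)"
  proof (cases "t = 0")
    case True
    then show ?thesis using m(4) by (simp add: gauss_quadratic mid_def)
  next
    case False
    then obtain t' where t': "t = Suc t'" by (cases t) auto
    have "(2 * j) mod 4 = 2" using m(4) by presburger
    moreover have idx: "t + 1 - 2 = t'" "t + 1 - 1 = t" "2 ^ t' * (2 * j) = 2 ^ t * j" using t' by simp_all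
    ultimately have "period_step (t + 1) (2 ^ t * j) = of_real (amp (t + 1) * of_int (c t))"
      using period_step_gauss[of "t + 1" "2 * j", unfolded idx] m(3) t' by simp
    moreover have "(\<Sum>r=2..t. period_step r (2 ^ t * j)) = of_real (real p ^ (s div 2) - Y t)"
      by (rule sum_period_step_low) (use m(3) in auto)
    moreover have "(\<Sum>r=2..t + 1. period_step r (2 ^ t * j))
        = (\<Sum>r=2..t. period_step r (2 ^ t * j)) + period_step (t + 1) (2 ^ t * j)"
      using t' by (simp only: Suc_eq_plus1[symmetric] sum.cl_ivl_Suc) simp
    ultimately show ?thesis using t' by (simp add: gauss_quadratic mid_def)
  qed
  finally show ?thesis
    using reduced_period_eq_sum_steps[of m "2 ^ t * j"] m by (simp add: step2)
qed

lemma period_0: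
  assumes "2 \<le> m" "m \<le> v + 1"
  shows "reduced_period s \<gamma> (2 ^ m) 0 = of_real (- Y (m - 1) - amp m * of_int (c (m - 1)))"
    and "reduced_period s \<gamma> (2 ^ m) (2 ^ (m - 1)) = of_real (- Y (m - 1) + amp m * of_int (c (m - 1)))"
proof -
  have split: "(\<Sum>r=2..m. F r) = (\<Sum>r=2..m - 1. F r) + F m" for F :: "nat \<Rightarrow> complex"
    using assms(1) sum.cl_ivl_Suc[of F 2 "m - 1"] by simp
  have low: "(\<Sum>r=2..m - 1. period_step r k) = of_real (real p ^ (s div 2) - Y (m - 1))"
    if "2 ^ (m - 1) dvd k" for k
    by (rule sum_period_step_low[OF that]) (use assms in auto)
  have "period_step m 0 = of_real (- amp m * of_int (c (m - 1)))"
    using period_step_gauss[of m 0] assms by simp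
  then show "reduced_period s \<gamma> (2 ^ m) 0 = of_real (- Y (m - 1) - amp m * of_int (c (m - 1)))"
    using reduced_period_eq_sum_steps[of m 0] assms low[of 0] by (simp add: split gauss_quadratic)
  have pow: "2 ^ (m - 2) * 2 = (2::nat) ^ (m - 1)"
  proof -
    have "m - 1 = Suc (m - 2)" using assms(1) by simp
    then show ?thesis by (simp only: power_Suc mult.commute)
  qed
  have "period_step m (2 ^ (m - 1)) = of_real (amp m * of_int (c (m - 1)))"
    using period_step_gauss[of m 2, unfolded pow] assms by simp
  moreover have "even ((2::nat) ^ (m - 1))" using assms(1) by simp
  ultimately show "reduced_period s \<gamma> (2 ^ m) (2 ^ (m - 1)) = of_real (- Y (m - 1) + amp m * of_int (c (m - 1)))"
    using reduced_period_eq_sum_steps[of m "2 ^ (m - 1)"] assms low[of "2 ^ (m - 1)"]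
    by (simp add: split gauss_quadratic)
qed

definition factor :: "nat \<Rightarrow> nat \<Rightarrow> complex poly" where
  "factor m k = [:- reduced_period s \<gamma> (2 ^ m) k, 1:]"

lemma factor_pair:
  assumes "t + 2 \<le> m" "m \<le> v + 2" "t + 1 \<le> v"
  shows "factor m (2 ^ t) * factor m (2 ^ t * 3)
    = [:of_real (mid t + dev t), 1:] * [:of_real (mid t - dev t), 1:]"
  using period_odd_multiple[OF assms, of 1] period_odd_multiple[OF assms, of 3]
  by (simp add: factor_def)

lemma of_rat_qpow_half: "(of_rat (qpow p s 1 2) :: real) = real p ^ (s div 2)"
  by (simp add: qpow_def of_rat_power)

lemma of_rat_qpow_radix:
  assumes "1 \<le> r" "r \<le> v"
  shows "(of_rat (qpow p s (2 ^ (r - 1) - 1) (2 ^ r)) :: real) = radix r"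
  using radix_eq_power[OF assms] by (simp add: qpow_def of_rat_power)

lemma qpow_eq_power:
  assumes "r \<le> v"
  shows "qpow p s (2 ^ r - 1) (2 ^ r) = of_nat p ^ (s - s div 2 ^ r)"
proof -
  obtain k where k: "s = 2 ^ r * k" using two_power_dvd_s[OF assms] by blast
  have "s * (2 ^ r - 1) = 2 ^ r * (k * (2 ^ r - 1))" by (simp only: k mult.assoc)
  then have "s * (2 ^ r - 1) div 2 ^ r = 2 ^ r * (k * (2 ^ r - 1)) div 2 ^ r" by (simp only:)
  then have "s * (2 ^ r - 1) div 2 ^ r = k * (2 ^ r - 1)" by simp
  moreover have "s - s div 2 ^ r = k * (2 ^ r - 1)" by (simp add: k algebra_simps)
  ultimately show ?thesis by (simp add: qpow_def)
qed

lemma of_rat_qpow_radix_square: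
  assumes "r \<le> v"
  shows "(of_rat (qpow p s (2 ^ r - 1) (2 ^ r)) :: real) = (radix (r + 1))\<^sup>2"
  unfolding qpow_eq_power[OF assms] radix_square by (simp add: of_rat_power)

lemma of_rat_Y:
  assumes "t \<le> v"
  shows "of_rat (qpow p s 1 2 + S_sum p s C t) = Y t"
proof -
  have "of_rat (S_sum p s C t) = (\<Sum>r=2..t. 2 ^ (r - 1) * of_int (c (r - 1)) * radix r)"
    unfolding S_sum_def of_rat_sum
    by (rule sum.cong)
      (use assms C of_rat_qpow_radix in \<open>auto simp: of_rat_mult of_rat_power\<close>)
  then show ?thesis by (simp only: Y_def of_rat_add of_rat_qpow_half)
qed

lemma linear_pair_sign:
  assumes "\<sigma> = 1 \<or> \<sigma> = (-1 :: int)"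
  shows "[:of_real (a + of_int \<sigma> * x) :: complex, 1:] * [:of_real (a - of_int \<sigma> * x), 1:]
    = [:of_real (a + x), 1:] * [:of_real (a - x), 1:]"
  using assms
proof
  assume "\<sigma> = -1"
  then show ?thesis by (simp add: algebra_simps)
qed simp

lemma D_sign:
  assumes "2 \<le> r" "r \<le> v + 1"
  obtains \<sigma> :: int where "\<sigma> = 1 \<or> \<sigma> = -1" "D r = \<sigma> * d (r - 1)"
  using D[OF assms] by (metis abs_eq_iff mult_1 mult_minus1)

text \<open>The sign by which \<open>D\<close> may differ from \<open>d\<close> only swaps the two
  factors. The bound \<open>t + 2 <= v\<close> keeps both radices rational.\<close>

lemma R_factors_eq:
  assumes "1 \<le> t" "t + 2 \<le> v"
  shows "complex_poly (\<Prod>\<^sub># (R_factors p s C D t))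
    = [:of_real (mid t + dev t), 1:] * [:of_real (mid t - dev t), 1:]"
proof -
  define a where "a = qpow p s 1 2 + S_sum p s C t
           - 2 ^ t * of_int (C (t + 1)) * qpow p s (2 ^ t - 1) (2 ^ (t + 1))"
  define e where "e = 2 ^ (t + 1) * of_int (D (t + 2)) * qpow p s (2 ^ (t + 1) - 1) (2 ^ (t + 2))"
  have idx: "t + 1 - 1 = t" "t + 2 - 1 = t + 1" by simp_all
  have C1: "C (t + 1) = c t" using C[of "t + 1", unfolded idx] assms by simp
  have sg1: "sg (t + 1) = 1" "sg (t + 2) = 1" using sg_1 assms by simp_all
  have amp1: "amp (t + 1) = 2 ^ t * radix (t + 1)" "amp (t + 2) = 2 ^ (t + 1) * radix (t + 2)"
    unfolding amp_def idx sg1 by simp_all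
  have q1: "of_rat (qpow p s (2 ^ t - 1) (2 ^ (t + 1))) = radix (t + 1)"
    by (rule of_rat_qpow_radix[of "t + 1", unfolded idx]) (use assms in simp_all)
  have q2: "of_rat (qpow p s (2 ^ (t + 1) - 1) (2 ^ (t + 2))) = radix (t + 2)"
    by (rule of_rat_qpow_radix[of "t + 2", unfolded idx]) (use assms in simp_all)
  obtain \<sigma> where \<sigma>: "\<sigma> = 1 \<or> \<sigma> = -1" "D (t + 2) = \<sigma> * d (t + 1)"
    by (rule D_sign[of "t + 2", unfolded idx]) (use assms in simp_all)
  have "t \<noteq> 0" "t \<le> v" using assms by simp_all
  then have a: "of_rat a = mid t"
    by (simp only: a_def of_rat_diff of_rat_Y mid_def if_False of_rat_mult of_rat_power of_rat_numeral_eq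
        of_rat_of_int_eq q1 C1 amp1 mult_ac)
  have e: "of_rat e = of_int \<sigma> * dev t"
    by (simp only: e_def of_rat_mult of_rat_power of_rat_numeral_eq
        of_rat_of_int_eq q2 \<sigma>(2) of_int_mult dev_def amp1 mult_ac)
  have "\<Prod>\<^sub># (R_factors p s C D t) = [:a + e, 1:] * [:a - e, 1:]"
    by (simp only: R_factors_def a_def e_def prod_mset.add_mset prod_mset_empty mult_1_right)
  then have "complex_poly (\<Prod>\<^sub># (R_factors p s C D t))
      = [:of_real (mid t + of_int \<sigma> * dev t), 1:] * [:of_real (mid t - of_int \<sigma> * dev t), 1:]"
    by (simp only: complex_poly_simps complex_poly_pCons map_poly_0 of_rat_1 of_real_1 of_rat_complex of_rat_add of_rat_diff a e)
  then show ?thesis by (simp only: linear_pair_sign[OF \<sigma>(1)])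
qed

lemma first_factors_eq:
  "complex_poly ([:- qpow p s 1 2 + 2 * of_int (D 2) * qpow p s 1 4, 1:]
      * [:- qpow p s 1 2 - 2 * of_int (D 2) * qpow p s 1 4, 1:])
    = [:of_real (mid 0 + dev 0), 1:] * [:of_real (mid 0 - dev 0), 1:]"
proof -
  define e where "e = 2 * of_int (D 2) * qpow p s 1 4"
  have idx: "2 - 1 = (1::nat)" "0 + 2 = (2::nat)" "0 + 1 = (1::nat)" by simp_all
  obtain \<sigma> where \<sigma>: "\<sigma> = 1 \<or> \<sigma> = -1" "D 2 = \<sigma> * d 1"
    by (rule D_sign[of 2, unfolded idx]) (use v_ge_2 in simp_all)
  have q4: "of_rat (qpow p s 1 4) = radix 2"
    using of_rat_qpow_radix[of 2] v_ge_2 by (simp add: One_nat_def)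
  have amp: "amp 2 = 2 * radix 2" using sg_1[of 2] v_ge_2 by (simp add: amp_def)
  have e: "of_rat e = of_int \<sigma> * dev 0"
    by (simp only: e_def dev_def idx amp q4 \<sigma>(2) of_rat_mult of_rat_numeral_eq of_rat_of_int_eq of_int_mult mult_ac)
  have "complex_poly ([:- qpow p s 1 2 + e, 1:] * [:- qpow p s 1 2 - e, 1:])
      = [:of_real (mid 0 + of_int \<sigma> * dev 0), 1:] * [:of_real (mid 0 - of_int \<sigma> * dev 0), 1:]"
    by (simp only: complex_poly_simps complex_poly_pCons map_poly_0 of_rat_1 of_real_1 of_rat_complex of_rat_add of_rat_diff
        of_rat_minus of_rat_qpow_half e mid_def if_True simp_thms)
  then show ?thesis unfolding e_def by (simp only: linear_pair_sign[OF \<sigma>(1)])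
qed

text \<open>The part common to all three cases; \<open>T\<close> is the last \<open>t\<close> whose
  pair of periods is listed through \<open>R_factors\<close>.\<close>

definition linear_factors :: "nat \<Rightarrow> nat \<Rightarrow> rat poly multiset" where
  "linear_factors m T = replicate_mset (2 ^ (m - 2)) [:- qpow p s 1 2 + 2 * of_int (D 2) * qpow p s 1 4, 1:]
     + replicate_mset (2 ^ (m - 2)) [:- qpow p s 1 2 - 2 * of_int (D 2) * qpow p s 1 4, 1:]
     + (\<Sum>t=1..T. repeat_mset (2 ^ (m - t - 2)) (R_factors p s C D t))"

lemma in_repeat_msetD: "x \<in># repeat_mset n M \<Longrightarrow> x \<in># M"
  by (induction n) auto

lemma linear_factors_irreducible:
  assumes "f \<in># linear_factors m T"
  shows "irreducible f \<and> lead_coeff f = 1"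
proof -
  have "\<exists>t\<in>A. f \<in># F t" if "f \<in># (\<Sum>t\<in>A. F t)" for A :: "nat set" and F
    using that by (induction A rule: infinite_finite_induct) auto
  then have "\<exists>t\<in>{1..T}. f \<in># R_factors p s C D t"
    if "f \<in># (\<Sum>t=1..T. repeat_mset (2 ^ (m - t - 2)) (R_factors p s C D t))"
    using that by (force dest: in_repeat_msetD)
  then have "\<exists>a. f = [:a, 1:]"
    if "f \<in># (\<Sum>t=1..T. repeat_mset (2 ^ (m - t - 2)) (R_factors p s C D t))"
    using that by (force simp: R_factors_def)
  moreover have "f \<in># replicate_mset n g \<Longrightarrow> f = g" for n g by (simp add: in_replicate_mset split: if_splits)
  ultimately obtain a where "f = [:a, 1:]"
    using assms unfolding linear_factors_def union_iff by blast
  then show ?thesis by (simp add: irreducible_linear_field_poly)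
qed

lemma reduced_period_poly_split:
  assumes m: "4 \<le> m" "m \<le> v + 2" and T: "T \<le> m - 2" "T + 2 \<le> v"
  shows "reduced_period_poly s \<gamma> (2 ^ m) = complex_poly (\<Prod>\<^sub># (linear_factors m T))
    * (\<Prod>t\<in>{T + 1..<m - 1}. (factor m (2 ^ t) * factor m (2 ^ t * 3)) ^ 2 ^ (m - 2 - t))
    * factor m (2 ^ (m - 1)) * factor m 0"
proof -
  define pair where "pair t = factor m (2 ^ t) * factor m (2 ^ t * 3)" for t
  have "reduced_period_poly s \<gamma> (2 ^ m) = (\<Prod>k<2 ^ Suc (m - 1). factor m k)"
    using m by (simp add: reduced_period_poly_def factor_def)
  also have "\<dots> = (\<Prod>t<m - 1. pair t ^ 2 ^ (m - 1 - 1 - t)) * factor m (2 ^ (m - 1)) * factor m 0"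
    unfolding pair_def
  proof (rule prod_two_adic_class)
    show "factor m (2 ^ t * j) = factor m (2 ^ t)" if "[j = 1] (mod 4)" for t j
    proof -
      have "[1 = j] (mod 4)" using that by (rule cong_sym)
      then have "reduced_period s \<gamma> (2 ^ m) (2 ^ t * 1) = reduced_period s \<gamma> (2 ^ m) (2 ^ t * j)"
        using m by (intro reduced_period_two_adic) auto
      then show ?thesis by (simp add: factor_def)
    qed
    show "factor m (2 ^ t * j) = factor m (2 ^ t * 3)" if "[j = 3] (mod 4)" for t j
    proof -
      have "[3 = j] (mod 4)" using that by (rule cong_sym)
      then have "reduced_period s \<gamma> (2 ^ m) (2 ^ t * 3) = reduced_period s \<gamma> (2 ^ m) (2 ^ t * j)"
        using m by (intro reduced_period_two_adic) auto
      then show ?thesis by (simp add: factor_def)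
    qed
  qed
  also have "(\<Prod>t<m - 1. pair t ^ 2 ^ (m - 1 - 1 - t)) = (\<Prod>t<m - 1. pair t ^ 2 ^ (m - 2 - t))"
    by (simp add: numeral_2_eq_2)
  also have "\<dots> = pair 0 ^ 2 ^ (m - 2) * (\<Prod>t=1..T. pair t ^ 2 ^ (m - 2 - t))
      * (\<Prod>t\<in>{T + 1..<m - 1}. pair t ^ 2 ^ (m - 2 - t))"
  proof -
    have eq: "{..<m - 1} = {0} \<union> {1..T} \<union> {T + 1..<m - 1}" using m T by auto
    have "({0} \<union> {1..T}) \<inter> {T + 1..<m - 1} = {}" "{0} \<inter> {1..T} = {}" by auto
    then show ?thesis unfolding eq by (simp only: prod.union_disjoint finite_Un finite.intros
        finite_atLeastAtMost finite_atLeastLessThan simp_thms prod.insert prod.empty empty_iff) simp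
  qed
  also have "pair 0 ^ 2 ^ (m - 2) * (\<Prod>t=1..T. pair t ^ 2 ^ (m - 2 - t)) = complex_poly (\<Prod>\<^sub># (linear_factors m T))"
  proof -
    have "pair 0 = complex_poly ([:- qpow p s 1 2 + 2 * of_int (D 2) * qpow p s 1 4, 1:]
      * [:- qpow p s 1 2 - 2 * of_int (D 2) * qpow p s 1 4, 1:])"
      unfolding first_factors_eq using factor_pair[of 0 m] m v_ge_2 by (simp add: pair_def)
    moreover have "(\<Prod>t=1..T. pair t ^ 2 ^ (m - 2 - t))
        = (\<Prod>t=1..T. complex_poly (\<Prod>\<^sub># (R_factors p s C D t)) ^ 2 ^ (m - t - 2))"
    proof (rule prod.cong)
      fix t assume "t \<in> {1..T}"
      then have t: "1 \<le> t" "t + 2 \<le> m" "t + 1 \<le> v" "t + 2 \<le> v" using m T by auto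
      have "pair t = complex_poly (\<Prod>\<^sub># (R_factors p s C D t))"
        unfolding pair_def R_factors_eq[OF t(1,4)] by (rule factor_pair[OF t(2) m(2) t(3)])
      then show "pair t ^ 2 ^ (m - 2 - t) = complex_poly (\<Prod>\<^sub># (R_factors p s C D t)) ^ 2 ^ (m - t - 2)"
        by (simp only: diff_commute)
    qed simp
    ultimately show ?thesis
      by (simp only: linear_factors_def prod_mset_Un prod_mset_replicate_mset prod_mset_sum
          prod_mset_repeat_mset complex_poly_simps complex_poly_power complex_poly_prod power_mult_distrib)
  qed
  finally show ?thesis by (simp only: pair_def)
qed

lemma s_div_pos: "n \<le> v \<Longrightarrow> s div 2 ^ n > 0"
  using two_power_dvd_s[of n] s_pos by (auto elim!: dvdE)

lemma d_nonzero:
  assumes "n \<le> v"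
  shows "d n \<noteq> 0"
proof
  assume "d n = 0"
  then have "(c n)\<^sup>2 = int p ^ (s div 2 ^ n)" using sq[OF assms] by simp
  then have "int p dvd (c n)\<^sup>2" using s_div_pos[OF assms] by (simp add: dvd_power)
  then show False using sq[OF assms] prime_p prime_dvd_power[of "int p"] by simp
qed

lemma c_nonzero: "n \<le> v \<Longrightarrow> c n \<noteq> 0"
  using sq[of n] by auto

text \<open>The source of all irrationality: \<open>radix (v + 1)\<close> is \<open>sqrt p\<close>
  to this exponent.\<close>

lemma odd_exponent: "odd (s - s div 2 ^ v)"
proof -
  have "even s" using four_dvd_s by (meson dvd_trans even_numeral)
  moreover have "s div 2 ^ v \<le> s" by simp
  ultimately show ?thesis using odd_s_div by (simp add: even_diff_nat not_less)
qed

lemma irreducible_quadratic_factor: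
  assumes "e \<noteq> 0"
  shows "irreducible ([:y, 1:]\<^sup>2 - [:2 ^ (2 * k) * (of_int e)\<^sup>2 * qpow p s (2 ^ v - 1) (2 ^ v):])"
    and "lead_coeff ([:y, 1:]\<^sup>2 - [:2 ^ (2 * k) * (of_int e)\<^sup>2 * qpow p s (2 ^ v - 1) (2 ^ v):]) = 1"
proof -
  have "(2 ^ k * of_int e)\<^sup>2 * of_nat p ^ (s - s div 2 ^ v)
      = (2 ^ (2 * k) * (of_int e)\<^sup>2 * qpow p s (2 ^ v - 1) (2 ^ v) :: rat)"
    unfolding qpow_eq_power[OF order_refl] by (simp add: power_mult_distrib mult.commute flip: power_mult)
  moreover have "irreducible ([:y, 1:]\<^sup>2 - [:(2 ^ k * of_int e :: rat)\<^sup>2 * of_nat p ^ (s - s div 2 ^ v):])"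
    by (rule irreducible_quadratic[OF prime_p odd_exponent]) (use assms in simp)
  ultimately show "irreducible ([:y, 1:]\<^sup>2 - [:2 ^ (2 * k) * (of_int e)\<^sup>2 * qpow p s (2 ^ v - 1) (2 ^ v):])"
    by (simp only:)
qed (simp add: power2_eq_square)

text \<open>Squaring removes both the open sign \<open>sg (v + 1)\<close> and the odd power of
  \<open>sqrt p\<close>.\<close>

lemma amp_square: "(amp (v + 1))\<^sup>2 = of_rat (2 ^ (2 * v) * qpow p s (2 ^ v - 1) (2 ^ v))"
proof -
  have "(of_int (sg (v + 1)) :: real)\<^sup>2 = 1" using sg[of "v + 1"] by auto
  then show ?thesis
    using of_rat_qpow_radix_square[of v]
    by (simp add: amp_def power_mult_distrib of_rat_mult of_rat_power mult.commute flip: power_mult)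
qed

lemma linear_pair_quadratic:
  "[:of_real (a + e), 1:] * [:of_real (a - e), 1:] = [:of_real a, 1:]\<^sup>2 - [:of_real (e\<^sup>2) :: complex:]"
  by (simp add: power2_eq_square algebra_simps)

text \<open>For \<open>m <= v\<close> no radix beyond \<open>radix v\<close> occurs, so every period
  is rational and every factor linear.\<close>

lemma reduced_period_poly_case_a:
  assumes m: "4 \<le> m" "m \<le> v"
  shows "unique_irreducible_decomposition (reduced_period_poly s \<gamma> (2 ^ m))
    (linear_factors m (m - 2)
     + {#[:qpow p s 1 2 + S_sum p s C (m - 1) - 2 ^ (m - 1) * of_int (C m) * qpow p s (2 ^ (m - 1) - 1) (2 ^ m), 1:]#}
     + {#[:qpow p s 1 2 + S_sum p s C m, 1:]#})"
    (is "unique_irreducible_decomposition _ ?M")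
proof (rule unique_irreducible_decompositionI)
  have amp: "amp m * of_int (c (m - 1)) = of_rat (2 ^ (m - 1) * of_int (C m) * qpow p s (2 ^ (m - 1) - 1) (2 ^ m))"
    using of_rat_qpow_radix[of m] sg_1[of m] C[of m] m by (simp add: amp_def of_rat_mult of_rat_power)
  have 1: "factor m (2 ^ (m - 1)) = complex_poly [:qpow p s 1 2 + S_sum p s C (m - 1)
      - 2 ^ (m - 1) * of_int (C m) * qpow p s (2 ^ (m - 1) - 1) (2 ^ m), 1:]"
    using period_0(2)[of m] of_rat_Y[of "m - 1"] amp m
    by (simp add: factor_def complex_poly_pCons of_rat_complex of_rat_diff)
  obtain m' where m': "m = Suc m'" "2 \<le> Suc m'" using m(1) by (cases m) auto
  have "Y m = Y (m - 1) + 2 ^ (m - 1) * of_int (c (m - 1)) * radix m"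
    unfolding m'(1) Y_def using m'(2) by (simp only: sum.cl_ivl_Suc) simp
  then have "Y m = Y (m - 1) + amp m * of_int (c (m - 1))" using sg_1[of m] m by (simp add: amp_def)
  then have 2: "factor m 0 = complex_poly [:qpow p s 1 2 + S_sum p s C m, 1:]"
    using period_0(1)[of m] of_rat_Y[of m] m
    by (simp add: factor_def complex_poly_pCons of_rat_complex)
  have "{m - 2 + 1..<m - 1} = {}" using m by auto
  then have "reduced_period_poly s \<gamma> (2 ^ m) = complex_poly (\<Prod>\<^sub># (linear_factors m (m - 2)))
      * factor m (2 ^ (m - 1)) * factor m 0"
    using reduced_period_poly_split[of m "m - 2"] m by simp
  then show "reduced_period_poly s \<gamma> (2 ^ m) = complex_poly (\<Prod>\<^sub># ?M)"
    by (simp only: 1 2 complex_poly_simps prod_mset_Un prod_mset_singleton)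
next
  fix f assume "f \<in># ?M"
  then have "f \<in># linear_factors m (m - 2) \<or> (\<exists>a. f = [:a, 1:])"
    unfolding union_iff set_mset_single singleton_iff by blast
  then show "irreducible f \<and> lead_coeff f = 1"
    using linear_factors_irreducible by (auto simp: irreducible_linear_field_poly)
qed

text \<open>The index \<open>t = v - 1\<close> is the first whose deviation involves
  \<open>radix (v + 1)\<close>; its two conjugate linear factors merge into a rational
  quadratic.\<close>

lemma middle_quadratic:
  assumes "v + 1 \<le> m" "m \<le> v + 2"
  shows "factor m (2 ^ (v - 1)) * factor m (2 ^ (v - 1) * 3)
    = complex_poly ([:qpow p s 1 2 + S_sum p s C (v - 1)
        - 2 ^ (v - 1) * of_int (C v) * qpow p s (2 ^ (v - 1) - 1) (2 ^ v), 1:]\<^sup>2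
      - [:2 ^ (2 * v) * (of_int (D (v + 1)))\<^sup>2 * qpow p s (2 ^ v - 1) (2 ^ v):])"
proof -
  have idx: "v - 1 + 1 = v" "v - 1 + 2 = v + 1" "v - 1 \<noteq> 0" "v - 1 \<le> v" using v_ge_2 by auto
  have "of_rat (2 ^ (v - 1) * of_int (C v) * qpow p s (2 ^ (v - 1) - 1) (2 ^ v)) = amp v * of_int (c (v - 1))"
    using of_rat_qpow_radix[of v] C[of v] sg_1[of v] v_ge_2
    by (simp add: amp_def of_rat_mult of_rat_power)
  then have mid: "of_rat (qpow p s 1 2 + S_sum p s C (v - 1)
      - 2 ^ (v - 1) * of_int (C v) * qpow p s (2 ^ (v - 1) - 1) (2 ^ v)) = mid (v - 1)"
    by (simp only: of_rat_diff mid_def of_rat_Y idx if_False)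
  have "(D (v + 1))\<^sup>2 = (d v)\<^sup>2" using D[of "v + 1"] v_ge_2 by (auto simp: abs_eq_iff)
  then have "(of_int (D (v + 1)) :: real)\<^sup>2 = (of_int (d v))\<^sup>2" by (metis of_int_power)
  then have dev: "of_rat (2 ^ (2 * v) * (of_int (D (v + 1)))\<^sup>2 * qpow p s (2 ^ v - 1) (2 ^ v)) = (dev (v - 1))\<^sup>2"
    by (simp only: dev_def idx power_mult_distrib of_rat_mult of_rat_power amp_square of_rat_of_int_eq mult_ac)
  have "factor m (2 ^ (v - 1)) * factor m (2 ^ (v - 1) * 3) = [:of_real (mid (v - 1)), 1:]\<^sup>2 - [:of_real ((dev (v - 1))\<^sup>2):]"
    using factor_pair[of "v - 1" m] assms v_ge_2 linear_pair_quadratic by simp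
  then show ?thesis
    by (simp only: complex_poly_simps complex_poly_power complex_poly_pCons map_poly_0 of_rat_1 of_real_1 of_rat_complex mid dev)
qed

text \<open>Two conjugate pairs involve \<open>radix (v + 1)\<close>: the one at
  \<open>t = v - 1\<close>, with deviation from \<open>d v\<close>, and the periods at
  \<open>2 ^ v\<close> and 0, which differ in the sign of the \<open>c v\<close> term.\<close>

lemma reduced_period_poly_case_b:
  assumes m: "4 \<le> m" "m = v + 1"
  shows "unique_irreducible_decomposition (reduced_period_poly s \<gamma> (2 ^ m))
    (linear_factors m (m - 3)
     + {#[:qpow p s 1 2 + S_sum p s C (m - 1), 1:]\<^sup>2
          - [:2 ^ (2 * (m - 1)) * (of_int (C m))\<^sup>2 * qpow p s (2 ^ (m - 1) - 1) (2 ^ (m - 1)):]#}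
     + {#[:qpow p s 1 2 + S_sum p s C (m - 2)
            - 2 ^ (m - 2) * of_int (C (m - 1)) * qpow p s (2 ^ (m - 2) - 1) (2 ^ (m - 1)), 1:]\<^sup>2
          - [:2 ^ (2 * (m - 1)) * (of_int (D m))\<^sup>2 * qpow p s (2 ^ (m - 1) - 1) (2 ^ (m - 1)):]#})"
    (is "unique_irreducible_decomposition _ ?M")
proof (rule unique_irreducible_decompositionI)
  have idx: "m - 1 = v" "m - 2 = v - 1" "m - 3 = v - 2" using m by auto
  let ?Q1 = "[:qpow p s 1 2 + S_sum p s C v, 1:]\<^sup>2
          - [:2 ^ (2 * v) * (of_int (C (v + 1)))\<^sup>2 * qpow p s (2 ^ v - 1) (2 ^ v):]"
  let ?Q2 = "[:qpow p s 1 2 + S_sum p s C (v - 1)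
            - 2 ^ (v - 1) * of_int (C v) * qpow p s (2 ^ (v - 1) - 1) (2 ^ v), 1:]\<^sup>2
          - [:2 ^ (2 * v) * (of_int (D (v + 1)))\<^sup>2 * qpow p s (2 ^ v - 1) (2 ^ v):]"
  have e: "of_rat (2 ^ (2 * v) * (of_int (C (v + 1)))\<^sup>2 * qpow p s (2 ^ v - 1) (2 ^ v))
      = (amp (v + 1) * of_int (c v))\<^sup>2"
    using amp_square C[of "v + 1"] v_ge_2 by (simp add: power_mult_distrib of_rat_mult of_rat_power)
  have "factor m (2 ^ (m - 1)) * factor m 0 = [:of_real (Y v), 1:]\<^sup>2 - [:of_real ((amp (v + 1) * of_int (c v))\<^sup>2):]"
  proof -
    have "factor m (2 ^ (m - 1)) = [:of_real (Y v - amp (v + 1) * of_int (c v)), 1:]"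
      "factor m 0 = [:of_real (Y v + amp (v + 1) * of_int (c v)), 1:]"
      using period_0[of m] m by (simp_all add: factor_def)
    then show ?thesis by (simp only: linear_pair_quadratic[symmetric] mult.commute)
  qed
  also have "\<dots> = complex_poly ?Q1"
    by (simp only: complex_poly_simps complex_poly_power complex_poly_pCons map_poly_0 of_rat_1 of_real_1 of_rat_complex e of_rat_Y[OF order_refl])
  finally have Q1: "factor m (2 ^ (m - 1)) * factor m 0 = complex_poly ?Q1" .
  have "{v - 2 + 1..<m - 1} = {v - 1}" using m by auto
  then have "reduced_period_poly s \<gamma> (2 ^ m) = complex_poly (\<Prod>\<^sub># (linear_factors m (v - 2)))
      * (factor m (2 ^ (v - 1)) * factor m (2 ^ (v - 1) * 3)) * (factor m (2 ^ (m - 1)) * factor m 0)"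
    using reduced_period_poly_split[of m "v - 2"] m by (simp add: mult.assoc)
  also have "\<dots> = complex_poly (\<Prod>\<^sub># (linear_factors m (v - 2) + {#?Q1#} + {#?Q2#}))"
    unfolding Q1 using middle_quadratic[of m] m
    by (simp only: complex_poly_simps prod_mset_Un prod_mset_singleton mult_ac)
  finally show "reduced_period_poly s \<gamma> (2 ^ m) = complex_poly (\<Prod>\<^sub># ?M)"
    unfolding idx unfolding m(2) .
  have "C (v + 1) \<noteq> 0" "D (v + 1) \<noteq> 0"
    using C[of "v + 1"] D[of "v + 1"] c_nonzero[of v] d_nonzero[of v] v_ge_2 by auto
  then have irr: "irreducible ?Q1 \<and> lead_coeff ?Q1 = 1" "irreducible ?Q2 \<and> lead_coeff ?Q2 = 1"
    using irreducible_quadratic_factor by blast+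
  fix f assume "f \<in># ?M"
  then have "f \<in># linear_factors m (v - 2) \<or> f = ?Q1 \<or> f = ?Q2"
    unfolding idx unfolding m(2) by (simp only: union_iff set_mset_single singleton_iff disj_assoc set_mset_add_mset_insert set_mset_empty)
  then show "irreducible f \<and> lead_coeff f = 1"
    using linear_factors_irreducible irr by blast
qed

end

section \<open>The top level \<open>m = v + 2\<close>\<close>

context gauss_data
begin

text \<open>The norm equation at level \<open>v\<close>, rescaled to \<open>q\<close>. As
  \<open>d v\<close> is nonzero, it gives the strict bound on the \<open>c v\<close> term that the
  quartic irreducibility criterion asks for.\<close>

lemma qpow_decompose:
  "(of_int (c v))\<^sup>2 * qpow p s (2 ^ v - 1) (2 ^ v) + (of_int (d v))\<^sup>2 * qpow p s (2 ^ v - 1) (2 ^ v)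
    = of_nat (p ^ s)"
proof -
  have "(of_int ((c v)\<^sup>2 + (d v)\<^sup>2) :: rat) = of_nat p ^ (s div 2 ^ v)"
    using sq[of v] by simp
  moreover have "(of_nat p :: rat) ^ (s div 2 ^ v) * of_nat p ^ (s - s div 2 ^ v) = of_nat (p ^ s)"
    by (simp flip: power_add)
  ultimately show ?thesis by (simp add: qpow_eq_power flip: distrib_right)
qed

text \<open>
  At the top level \<open>m = v + 2\<close> the character takes the value \<open>-1\<close> at \<open>-1\<close>, so the periods are
  not real; only the squares of the real and imaginary part of the Gauss sum are needed.
\<close>

lemma top_factors:
  defines "h \<equiv> amp (v + 1) * of_int (c v)" and "w \<equiv> real p ^ (s div 2)"
  shows "factor (v + 2) (2 ^ (v + 1)) * factor (v + 2) 0
      = [:of_real (Y v + h), 1:]\<^sup>2 + [:of_real (2 ^ (2 * v + 1) * w\<^sup>2 + 2 * h * (2 ^ v * w)):]"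
    and "factor (v + 2) (2 ^ v) * factor (v + 2) (2 ^ v * 3)
      = [:of_real (Y v - h), 1:]\<^sup>2 + [:of_real (2 ^ (2 * v + 1) * w\<^sup>2 - 2 * h * (2 ^ v * w)):]"
proof -
  define g where "g = of_int (sg (v + 1)) * radix (v + 1) * of_int (c v)"
  have h: "h = 2 ^ v * g" by (simp add: h_def g_def amp_def)
  define G where "G = gauss (zt (v + 2))"
  have idx: "v + 2 - 2 = v" "v + 2 - 1 = v + 1" "v + 1 - 1 = v" "v + 1 - 2 = v - 1" by simp_all
  have "(Re G)\<^sup>2 + (Im G)\<^sup>2 = w\<^sup>2"
  proof -
    have "of_real ((Re G)\<^sup>2 + (Im G)\<^sup>2) = G * cnj G" by (simp add: complex_mult_cnj)
    also have "\<dots> = of_nat (p ^ s)"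
      unfolding G_def by (rule norm_gauss) (use zt_neq_1[of "v + 2"] in simp_all)
    also have "\<dots> = of_real (w\<^sup>2)"
    proof -
      have "s = s div 2 * 2" using four_dvd_s by presburger
      then have "w\<^sup>2 = real p ^ s" unfolding w_def by (metis power_mult)
      then show ?thesis by simp
    qed
    finally show ?thesis by (simp only: of_real_eq_iff)
  qed
  moreover have "(Re G)\<^sup>2 - (Im G)\<^sup>2 = - (w * g)"
  proof -
    have "G\<^sup>2 = - gauss (-1) * gauss (zt (v + 1))"
      using gauss_zt_square[of "v + 2"] v_ge_2 by (simp add: G_def idx)
    also have "\<dots> = of_real w * gauss (zt (v + 1))" by (simp add: gauss_quadratic w_def)
    finally have "Re (G\<^sup>2) = w * Re (gauss (zt (v + 1)))" by simp
    also have "Re (gauss (zt (v + 1))) = - g"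
      using gauss_zt[of "v + 1"] v_ge_2 by (simp add: g_def)
    finally show ?thesis by (simp add: power2_eq_square)
  qed
  \<comment> \<open>The absolute value of \<open>G\<close> and the real part of \<open>G ^ 2\<close>
    are two linear equations for the squares of \<open>Re G\<close> and \<open>Im G\<close>.\<close>
  ultimately have re2: "2 * (Re G)\<^sup>2 = w\<^sup>2 - w * g" and im2: "2 * (Im G)\<^sup>2 = w\<^sup>2 + w * g" by simp_all
  \<comment> \<open>The top character is odd, so its conjugate contributes \<open>- cnj G\<close>
    and the last term is purely imaginary for each of the four classes of \<open>j\<close>.\<close>
  have period: "reduced_period s \<gamma> (2 ^ (v + 2)) (2 ^ v * j)
      = of_real (- Y v) + of_real (if even j then - h else h)
        + 2 ^ v * ((-\<i>) ^ (j mod 4) * G - \<i> ^ (j mod 4) * cnj G)" for j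
  proof -
    have pow: "2 ^ (v - 1) * (2 * j) = 2 ^ v * j"
    proof -
      have "v = Suc (v - 1)" using v_ge_2 by simp
      then have "(2::nat) ^ v = 2 * 2 ^ (v - 1)" by (metis power_Suc)
      then show ?thesis by simp
    qed
    have j4: "(2 * j) mod 4 = (if even j then 0 else 2)" by presburger
    have 1: "period_step (v + 1) (2 ^ v * j) = of_real (if even j then - h else h)"
      using period_step_gauss[of "v + 1" "2 * j", unfolded idx pow] v_ge_2 j4 by (simp add: h_def)
    have 2: "period_step (v + 2) (2 ^ v * j) = 2 ^ v * ((-\<i>) ^ (j mod 4) * G - \<i> ^ (j mod 4) * cnj G)"
      using period_step_eq[of "v + 2" j, unfolded idx] gauss_cnj_zt_top by (simp add: G_def)
    have 3: "(\<Sum>r=2..v. period_step r (2 ^ v * j)) = of_real (w - Y v)"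
      unfolding w_def by (rule sum_period_step_low) simp_all
    have 4: "(-1) ^ (2 ^ v * j) * gauss (-1) = of_real (- w)"
      using v_ge_2 by (simp add: gauss_quadratic w_def minus_one_power_iff)
    have split: "(\<Sum>r=2..v + 2. F r) = (\<Sum>r=2..v. F r) + F (v + 1) + F (v + 2)" for F :: "nat \<Rightarrow> complex"
    proof -
      have "v + 2 = Suc (Suc v)" "v + 1 = Suc v" by simp_all
      then show ?thesis using v_ge_2 by (simp only: sum.cl_ivl_Suc) simp
    qed
    have "reduced_period s \<gamma> (2 ^ (v + 2)) (2 ^ v * j) = (-1) ^ (2 ^ v * j) * gauss (-1)
        + (\<Sum>r=2..v + 2. period_step r (2 ^ v * j))"
      by (rule reduced_period_eq_sum_steps) simp_all
    then show ?thesis unfolding split 1 2 3 4 by simp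
  qed
  have conj_pair: "[:of_real a + of_real b * \<i>, 1:] * [:of_real a - of_real b * \<i>, 1:]
      = [:of_real a, 1:]\<^sup>2 + [:of_real (b\<^sup>2):]" for a b :: real
    by (simp add: power2_eq_square algebra_simps)
  have G_diff: "(-\<i>) ^ 0 * G - \<i> ^ 0 * cnj G = of_real (2 * Im G) * \<i>"
    "(-\<i>) ^ 1 * G - \<i> ^ 1 * cnj G = - (of_real (2 * Re G) * \<i>)"
    "(-\<i>) ^ 2 * G - \<i> ^ 2 * cnj G = - (of_real (2 * Im G) * \<i>)"
    "(-\<i>) ^ 3 * G - \<i> ^ 3 * cnj G = of_real (2 * Re G) * \<i>"
    by (simp_all add: complex_eq_iff power2_eq_square power3_eq_cube)
  have j4: "0 mod 4 = (0::nat)" "1 mod 4 = (1::nat)" "2 mod 4 = (2::nat)" "3 mod 4 = (3::nat)" by simp_all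
  have k: "2 ^ v * 0 = (0::nat)" "2 ^ v * 1 = (2::nat) ^ v" "2 ^ v * 2 = (2::nat) ^ (v + 1)"
    by (simp_all add: power_add)
  have f0: "factor (v + 2) 0 = [:of_real (Y v + h) - of_real (2 ^ (v + 1) * Im G) * \<i>, 1:]"
    using period[of 0, unfolded k j4 G_diff] by (simp add: factor_def power_add)
  have f2: "factor (v + 2) (2 ^ (v + 1)) = [:of_real (Y v + h) + of_real (2 ^ (v + 1) * Im G) * \<i>, 1:]"
    using period[of 2, unfolded k j4 G_diff] by (simp add: factor_def power_add)
  have f1: "factor (v + 2) (2 ^ v) = [:of_real (Y v - h) + of_real (2 ^ (v + 1) * Re G) * \<i>, 1:]"
    using period[of 1, unfolded k j4 G_diff] by (simp add: factor_def power_add)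
  have f3: "factor (v + 2) (2 ^ v * 3) = [:of_real (Y v - h) - of_real (2 ^ (v + 1) * Re G) * \<i>, 1:]"
    using period[of 3, unfolded k j4 G_diff] by (simp add: factor_def power_add)
  have sq: "(2 ^ (v + 1) * z)\<^sup>2 = 2 ^ (2 * v + 1) * (2 * z\<^sup>2)" for z :: real
    by (simp add: power_mult_distrib power_add power_even_eq power2_eq_square)
  have hM: "2 ^ (2 * v + 1) * (w * g) = 2 * h * (2 ^ v * w)"
    by (simp add: h power_add power_even_eq power2_eq_square)
  show "factor (v + 2) (2 ^ (v + 1)) * factor (v + 2) 0
      = [:of_real (Y v + h), 1:]\<^sup>2 + [:of_real (2 ^ (2 * v + 1) * w\<^sup>2 + 2 * h * (2 ^ v * w)):]"
    unfolding f0 f2 conj_pair sq im2 distrib_left hM ..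
  show "factor (v + 2) (2 ^ v) * factor (v + 2) (2 ^ v * 3)
      = [:of_real (Y v - h), 1:]\<^sup>2 + [:of_real (2 ^ (2 * v + 1) * w\<^sup>2 - 2 * h * (2 ^ v * w)):]"
    unfolding f1 f3 conj_pair sq re2 right_diff_distrib hM ..
qed

text \<open>With \<open>U = (X + y) ^ 2 + h ^ 2 + e\<close> and
  \<open>V = 2 * h * (X + y + M)\<close> the two factors are \<open>U - V\<close> and
  \<open>U + V\<close>. Reversing \<open>h\<close> swaps them, so only \<open>h ^ 2\<close> survives
  in the product.\<close>

lemma quartic_identity:
  fixes y h e M :: complex
  shows "([:y - h, 1:]\<^sup>2 + [:e - 2 * h * M:]) * ([:y + h, 1:]\<^sup>2 + [:e + 2 * h * M:])
    = ([:y, 1:]\<^sup>2 + [:h\<^sup>2 + e:])\<^sup>2 - [:4 * h\<^sup>2:] * [:y + M, 1:]\<^sup>2"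
  by (subst poly_eq_poly_eq_iff[symmetric], rule ext) (simp add: power2_eq_square algebra_simps)

text \<open>The pair at \<open>t = v - 1\<close> now occurs twice, since
  \<open>m - 2 - t = 1\<close>. The periods at the multiples of \<open>2 ^ v\<close> form the two
  quadratics of \<open>top_factors\<close>, which are conjugate under the sign of \<open>h\<close>
  and multiply to one rational quartic.\<close>

lemma reduced_period_poly_case_c:
  assumes m: "4 \<le> m" "m = v + 2" and q: "q = p ^ s"
  shows "unique_irreducible_decomposition (reduced_period_poly s \<gamma> (2 ^ m))
    (linear_factors m (m - 4)
     + replicate_mset 2
         ([: qpow p s 1 2 + S_sum p s C (m - 3)
             - 2 ^ (m - 3) * of_int (C (m - 2)) * qpow p s (2 ^ (m - 3) - 1) (2 ^ (m - 2)), 1 :]\<^sup>2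
          - [: 2 ^ (2 * (m - 2)) * (of_int (D (m - 1)))\<^sup>2 * qpow p s (2 ^ (m - 2) - 1) (2 ^ (m - 2)) :])
     + {# ([: qpow p s 1 2 + S_sum p s C (m - 2), 1 :]\<^sup>2
           + [: 2 ^ (2 * (m - 2)) * (of_int (C (m - 1)))\<^sup>2 * qpow p s (2 ^ (m - 2) - 1) (2 ^ (m - 2))
                + 2 ^ (2 * m - 3) * of_nat q :])\<^sup>2
          - [: 2 ^ (2 * (m - 1)) * (of_int (C (m - 1)))\<^sup>2 * qpow p s (2 ^ (m - 2) - 1) (2 ^ (m - 2)) :]
            * [: (2 ^ (m - 2) + 1) * qpow p s 1 2 + S_sum p s C (m - 2), 1 :]\<^sup>2 #})"
    (is "unique_irreducible_decomposition _ ?M")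
proof (rule unique_irreducible_decompositionI)
  define W where "W = qpow p s (2 ^ v - 1) (2 ^ v)"
  define H where "H = qpow p s 1 2"
  define y where "y = H + S_sum p s C v"
  define A where "A = 2 ^ (2 * v) * (of_int (C (v + 1)))\<^sup>2 * W + 2 ^ (2 * v + 1) * of_nat q"
  define B where "B = 2 ^ (2 * (v + 1)) * (of_int (C (v + 1)))\<^sup>2 * W"
  define Q where "Q = [: H + S_sum p s C (v - 1) - 2 ^ (v - 1) * of_int (C v) * qpow p s (2 ^ (v - 1) - 1) (2 ^ v), 1 :]\<^sup>2
          - [: 2 ^ (2 * v) * (of_int (D (v + 1)))\<^sup>2 * W :]"
  define R where "R = ([:y, 1:]\<^sup>2 + [:A:])\<^sup>2 - [:B:] * [:y + 2 ^ v * H, 1:]\<^sup>2"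
  have idx: "m - 1 = v + 1" "m - 2 = v" "m - 3 = v - 1" "m - 4 = v - 2" "2 * m - 3 = 2 * v + 1"
    using m by auto
  have "(2 ^ v + 1) * H + S_sum p s C v = y + 2 ^ v * H" by (simp add: y_def algebra_simps)
  then have M: "?M = linear_factors m (v - 2) + replicate_mset 2 Q + {#R#}"
    unfolding idx by (simp only: Q_def R_def A_def B_def y_def[symmetric] H_def[symmetric] W_def[symmetric])
  have C1: "C (v + 1) = c v" using C[of "v + 1"] v_ge_2 by simp
  have q_sq: "H\<^sup>2 = of_nat q"
  proof -
    have "s = s div 2 * 2" using four_dvd_s by presburger
    then have "((of_nat p :: rat) ^ (s div 2))\<^sup>2 = of_nat p ^ s" by (metis power_mult)
    then show ?thesis by (simp add: H_def qpow_def q)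
  qed
  define h where "h = amp (v + 1) * of_int (c v)"
  define w where "w = real p ^ (s div 2)"
  have w: "of_rat H = w" by (simp only: H_def w_def of_rat_qpow_half)
  have hh: "of_rat (2 ^ (2 * v) * (of_int (C (v + 1)))\<^sup>2 * W) = h\<^sup>2"
    by (simp only: h_def power_mult_distrib of_rat_mult of_rat_power amp_square of_rat_of_int_eq W_def C1 mult_ac)
  have A: "of_rat A = h\<^sup>2 + 2 ^ (2 * v + 1) * w\<^sup>2"
    unfolding A_def of_rat_add hh q_sq[symmetric] by (simp only: of_rat_mult of_rat_power of_rat_numeral_eq w)
  have B4: "B = 4 * (2 ^ (2 * v) * (of_int (C (v + 1)))\<^sup>2 * W)" by (simp add: B_def power_add)
  then have B: "of_rat B = 4 * h\<^sup>2" by (simp only: of_rat_mult[of 4] of_rat_numeral_eq hh)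
  have Yv: "of_rat y = Y v" by (simp only: y_def H_def of_rat_Y order_refl)
  have y_rat: "of_rat (y + 2 ^ v * H) = Y v + 2 ^ v * w"
    by (simp only: of_rat_add of_rat_mult of_rat_power of_rat_numeral_eq w Yv)
  have "complex_poly R = ([:of_real (Y v), 1:]\<^sup>2 + [:of_real (h\<^sup>2 + 2 ^ (2 * v + 1) * w\<^sup>2):])\<^sup>2
      - [:of_real (4 * h\<^sup>2):] * [:of_real (Y v + 2 ^ v * w), 1:]\<^sup>2"
    by (simp only: R_def complex_poly_simps complex_poly_power complex_poly_pCons map_poly_0 of_rat_1 of_real_1
        of_rat_complex A B y_rat Yv)
  also have "\<dots> = ([:of_real (Y v - h), 1:]\<^sup>2 + [:of_real (2 ^ (2 * v + 1) * w\<^sup>2 - 2 * h * (2 ^ v * w)):])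
      * ([:of_real (Y v + h), 1:]\<^sup>2 + [:of_real (2 ^ (2 * v + 1) * w\<^sup>2 + 2 * h * (2 ^ v * w)):])"
    using quartic_identity[of "of_real (Y v)" "of_real h" "of_real (2 ^ (2 * v + 1) * w\<^sup>2)" "of_real (2 ^ v * w)"]
    by simp
  finally have R: "(factor m (2 ^ v) * factor m (2 ^ v * 3)) * (factor m (2 ^ (v + 1)) * factor m 0) = complex_poly R"
    unfolding m(2) top_factors h_def[symmetric] w_def[symmetric] by simp
  have Q: "factor m (2 ^ (v - 1)) * factor m (2 ^ (v - 1) * 3) = complex_poly Q"
    unfolding Q_def H_def W_def by (rule middle_quadratic) (use m in auto)
  have "{v - 2 + 1..<m - 1} = {v - 1, v}" using m by auto
  moreover have "v - 1 \<noteq> v" "m - 2 - (v - 1) = 1" "m - 2 - v = 0" using m by auto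
  ultimately have prod: "(\<Prod>t\<in>{v - 2 + 1..<m - 1}. (factor m (2 ^ t) * factor m (2 ^ t * 3)) ^ 2 ^ (m - 2 - t))
      = complex_poly Q ^ 2 * (factor m (2 ^ v) * factor m (2 ^ v * 3))"
    by (simp add: Q)
  have "reduced_period_poly s \<gamma> (2 ^ m) = complex_poly (\<Prod>\<^sub># (linear_factors m (v - 2)))
    * (\<Prod>t\<in>{v - 2 + 1..<m - 1}. (factor m (2 ^ t) * factor m (2 ^ t * 3)) ^ 2 ^ (m - 2 - t))
    * factor m (2 ^ (m - 1)) * factor m 0"
    by (rule reduced_period_poly_split) (use m in auto)
  then have "reduced_period_poly s \<gamma> (2 ^ m) = complex_poly (\<Prod>\<^sub># (linear_factors m (v - 2)))
      * (complex_poly Q ^ 2 * (factor m (2 ^ v) * factor m (2 ^ v * 3))) * factor m (2 ^ (v + 1)) * factor m 0"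
    unfolding prod unfolding idx .
  then show "reduced_period_poly s \<gamma> (2 ^ m) = complex_poly (\<Prod>\<^sub># ?M)"
    unfolding M by (simp only: mult.assoc R[unfolded mult.assoc] complex_poly_simps complex_poly_power
        prod_mset_Un prod_mset_singleton prod_mset_replicate_mset)
  have "D (v + 1) \<noteq> 0" using D[of "v + 1"] d_nonzero[of v] v_ge_2 by auto
  then have Q_irr: "irreducible Q \<and> lead_coeff Q = 1"
    unfolding Q_def W_def using irreducible_quadratic_factor by blast
  have W0: "W > 0" using p_gt_1 by (simp add: W_def qpow_def)
  have q0: "(of_nat q :: rat) > 0" using p_gt_1 by (simp add: q)
  have "irreducible R"
    unfolding R_def
  proof (rule irreducible_quartic)
    show "B > 0" using W0 c_nonzero[of v] by (simp add: B_def C1)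
    show "x\<^sup>2 \<noteq> B" for x
    proof
      assume x: "x\<^sup>2 = B"
      have "(x / (2 ^ (v + 1) * of_int (c v)))\<^sup>2 = of_nat p ^ (s - s div 2 ^ v)"
        using c_nonzero[of v] unfolding power_divide x B_def C1 W_def qpow_eq_power[OF order_refl]
        by (simp add: power_mult_distrib mult.commute flip: power_mult)
      then show False using rational_power_even[OF prime_p] odd_exponent by blast
    qed
    \<comment> \<open>The \<open>h ^ 2\<close> parts of \<open>A\<close> and \<open>B / 4\<close>
      cancel, so both positivity conditions reduce to a comparison of \<open>(c v) ^ 2 * W\<close>
      with \<open>q\<close>.\<close>
    have AB: "A - B / 4 = 2 ^ (2 * v + 1) * of_nat q" by (simp add: A_def B4)
    then show "A - B / 4 > 0" using q0 by simp
    have "(of_int (c v))\<^sup>2 * W < of_nat q"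
    proof -
      have "(of_int (d v))\<^sup>2 * W > 0" using W0 d_nonzero[of v] by simp
      then show ?thesis using qpow_decompose by (simp add: W_def q)
    qed
    then have "2 ^ (4 * v + 2) * of_nat q * ((of_int (c v))\<^sup>2 * W) < 2 ^ (4 * v + 2) * of_nat q * of_nat q"
      using q0 by (intro mult_strict_left_mono) auto
    moreover have "B * (2 ^ v * H)\<^sup>2 = 2 ^ (4 * v + 2) * of_nat q * ((of_int (c v))\<^sup>2 * W)"
    proof -
      have "(2::rat) ^ (4 * v + 2) = 2 ^ (2 * (v + 1)) * (2 ^ v)\<^sup>2"
        by (simp flip: power_mult power_add)
      then show ?thesis by (simp only: B_def C1 power_mult_distrib q_sq mult_ac)
    qed
    moreover have "(A - B / 4)\<^sup>2 = 2 ^ (4 * v + 2) * of_nat q * of_nat q"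
    proof -
      have "(2::rat) ^ (4 * v + 2) = (2 ^ (2 * v + 1))\<^sup>2" by (simp flip: power_mult)
      then show ?thesis unfolding AB by (simp only: power_mult_distrib power2_eq_square[of "of_nat q"] mult_ac)
    qed
    ultimately show "B * (2 ^ v * H)\<^sup>2 < (A - B / 4)\<^sup>2" by simp
  qed
  moreover have "lead_coeff R = 1" unfolding R_def by (simp add: power2_eq_square)
  ultimately have R_irr: "irreducible R \<and> lead_coeff R = 1" by blast
  fix f assume "f \<in># ?M"
  then have "f \<in># linear_factors m (v - 2) \<or> f = Q \<or> f = R"
    unfolding M union_iff by (auto simp: in_replicate_mset)
  then show "irreducible f \<and> lead_coeff f = 1"
    using linear_factors_irreducible Q_irr R_irr by blast
qed

end

section \<open>Identification with \<open>CD_pair\<close> and assembly of the cases\<close>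

context field_5_mod_8
begin

text \<open>In the field \<open>c ^ 2 + d ^ 2\<close> vanishes, so
  \<open>(d * \<iota>) ^ 2 = c ^ 2\<close> for the square root \<open>\<iota>\<close> of -1 supplied
  by the generator. Exactly one of \<open>d\<close> and \<open>- d\<close> then meets the sign
  condition, because \<open>c\<close> is nonzero and the characteristic is odd.\<close>

lemma CD_pair_data:
  fixes c d :: int
  assumes n: "n \<le> v" and cd: "[c = 1] (mod 4)" "\<not> int p dvd c" "c\<^sup>2 + d\<^sup>2 = int p ^ (s div 2 ^ n)"
  obtains D where "signed_two_squares_rep s \<gamma> (n + 1) c D" "\<bar>D\<bar> = \<bar>d\<bar>"
    "CD_pair s \<gamma> (n + 1) = (c, D)"
    "\<forall>c' d'. two_squares_rep p s (n + 1) c' d' \<longrightarrow> c' = c \<and> \<bar>d'\<bar> = \<bar>d\<bar>"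
proof -
  have pos: "s div 2 ^ n > 0" using two_power_dvd_s[OF n] s_pos by (auto elim!: dvdE)
  have pint: "prime (int p)" "odd (int p)" using prime_p odd_p by simp_all
  have odd1: "odd x" if "[x = 1] (mod 4)" for x :: int
    using that unfolding cong_def by presburger
  have uniq: "c' = c \<and> \<bar>d'\<bar> = \<bar>d\<bar>" if "two_squares_rep p s (n + 1) c' d'" for c' d'
  proof -
    have c': "[c' = 1] (mod 4)" "\<not> int p dvd c'" "c'\<^sup>2 + d'\<^sup>2 = int p ^ (s div 2 ^ n)"
      using that by (auto simp: two_squares_rep_def)
    have "\<bar>c'\<bar> = \<bar>c\<bar> \<and> \<bar>d'\<bar> = \<bar>d\<bar>"
      using two_squares_unique[OF pint odd1[OF c'(1)] odd1[OF cd(1)] c'(2) cd(2) c'(3) cd(3) pos] .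
    moreover have "c' \<noteq> - c" using c'(1) cd(1) unfolding cong_def by presburger
    ultimately show ?thesis by (auto simp: abs_eq_iff)
  qed
  define \<iota> where "\<iota> = \<gamma> ^ ((CARD('a) - 1) div 4)"
  have "(2::nat) ^ 2 dvd q1" by (rule two_power_dvd_q1) simp
  then have "q1 div 2 = q1 div 4 * 2" by (auto elim!: dvdE)
  then have \<iota>2: "\<iota>\<^sup>2 = -1"
  proof -
    have "CARD('a) - 1 = q1" by (simp add: card q1_def)
    then have "\<iota> = \<gamma> ^ (q1 div 4)" unfolding \<iota>_def by (simp only:)
    then show ?thesis using gamma_power_half \<open>q1 div 2 = q1 div 4 * 2\<close> by (simp only: power_mult)
  qed
  have "(of_int (c\<^sup>2 + d\<^sup>2) :: 'a) = 0"
    unfolding cd(3) using of_nat_CHAR[where ?'a = 'a] char pos by (simp add: power_0_left)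
  then have "(of_int c)\<^sup>2 = (of_int d * \<iota>)\<^sup>2"
    by (simp add: power_mult_distrib \<iota>2 eq_neg_iff_add_eq_0)
  then have "of_int d * \<iota> = of_int c \<or> of_int (- d) * \<iota> = of_int c"
    by (auto simp: power2_eq_iff)
  then obtain D where D: "\<bar>D\<bar> = \<bar>d\<bar>" "of_int D * \<iota> = of_int c" by (metis abs_minus_cancel)
  have "two_squares_rep p s (n + 1) c D"
    using cd D(1) by (auto simp: two_squares_rep_def abs_eq_iff)
  then have rep: "signed_two_squares_rep s \<gamma> (n + 1) c D"
    using D(2) by (simp add: signed_two_squares_rep_def char \<iota>_def)
  have c0: "(of_int c :: 'a) \<noteq> 0" using cd(2) char by (simp add: of_int_eq_0_iff_char_dvd)
  have "CD_pair s \<gamma> (n + 1) = (c, D)"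
    unfolding CD_pair_def
  proof (rule the_equality)
    show "case (c, D) of (c, D) \<Rightarrow> signed_two_squares_rep s \<gamma> (n + 1) c D" using rep by simp
    fix x assume x: "case x of (c, D) \<Rightarrow> signed_two_squares_rep s \<gamma> (n + 1) c D"
    obtain c' D' where x': "x = (c', D')" by (cases x)
    then have sr: "two_squares_rep p s (n + 1) c' D'" "of_int D' * \<iota> = of_int c'"
      using x by (auto simp: signed_two_squares_rep_def char \<iota>_def)
    then have c': "c' = c" and "\<bar>D'\<bar> = \<bar>D\<bar>" using uniq D(1) by auto
    moreover have "D' \<noteq> - D"
    proof
      assume "D' = - D"
      then have "- of_int c = (of_int c :: 'a)" using sr(2) D(2) c' by simp
      then have "2 * of_int c = (0::'a)" by (simp add: neg_eq_iff_add_eq_0)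
      then show False using c0 two_neq_0[OF odd_p] by simp
    qed
    ultimately show "x = (c, D)" using x' by (auto simp: abs_eq_iff)
  qed
  then show ?thesis using that rep D(1) uniq by blast
qed

end

theorem theorem2:
  fixes \<gamma> :: "'a::{field,finite}" and p q s m :: nat and C D :: "nat \<Rightarrow> int"
  assumes "CHAR('a) = p" and "CARD('a) = q" and "q = p ^ s"
    and "[p = 5] (mod 8)" and "m \<ge> 4" and "2 ^ m dvd q - 1"
    and "generates_units \<gamma>"
    and C: "C = (\<lambda>r. fst (CD_pair s \<gamma> r))" and D: "D = (\<lambda>r. snd (CD_pair s \<gamma> r))"
  shows
    "(\<forall>r\<in>{2..m - 1} \<union> (if 2 ^ (m - 1) dvd s then {m} else {}).
        signed_two_squares_rep s \<gamma> r (C r) (D r) \<and>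
        (\<forall>c d. two_squares_rep p s r c d \<longrightarrow> c = C r \<and> \<bar>d\<bar> = \<bar>D r\<bar>))
   \<and> (2 ^ m dvd s \<longrightarrow>
        unique_irreducible_decomposition (reduced_period_poly s \<gamma> (2 ^ m))
          (replicate_mset (2 ^ (m - 2))
             [: - qpow p s 1 2 + 2 * of_int (D 2) * qpow p s 1 4, 1 :]
         + replicate_mset (2 ^ (m - 2))
             [: - qpow p s 1 2 - 2 * of_int (D 2) * qpow p s 1 4, 1 :]
         + {# [: qpow p s 1 2 + S_sum p s C (m - 1)
                 - 2 ^ (m - 1) * of_int (C m) * qpow p s (2 ^ (m - 1) - 1) (2 ^ m), 1 :] #}
         + {# [: qpow p s 1 2 + S_sum p s C m, 1 :] #}
         + (\<Sum>t=1..m - 2. repeat_mset (2 ^ (m - t - 2)) (R_factors p s C D t))))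
   \<and> (2 ^ (m - 1) dvd s \<and> \<not> 2 ^ m dvd s \<longrightarrow>
        unique_irreducible_decomposition (reduced_period_poly s \<gamma> (2 ^ m))
          (replicate_mset (2 ^ (m - 2))
             [: - qpow p s 1 2 + 2 * of_int (D 2) * qpow p s 1 4, 1 :]
         + replicate_mset (2 ^ (m - 2))
             [: - qpow p s 1 2 - 2 * of_int (D 2) * qpow p s 1 4, 1 :]
         + {# [: qpow p s 1 2 + S_sum p s C (m - 1), 1 :] ^ 2
              - [: 2 ^ (2 * (m - 1)) * of_int (C m) ^ 2
                   * qpow p s (2 ^ (m - 1) - 1) (2 ^ (m - 1)) :] #}
         + {# [: qpow p s 1 2 + S_sum p s C (m - 2)
                 - 2 ^ (m - 2) * of_int (C (m - 1))
                   * qpow p s (2 ^ (m - 2) - 1) (2 ^ (m - 1)), 1 :] ^ 2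
              - [: 2 ^ (2 * (m - 1)) * of_int (D m) ^ 2
                   * qpow p s (2 ^ (m - 1) - 1) (2 ^ (m - 1)) :] #}
         + (\<Sum>t=1..m - 3. repeat_mset (2 ^ (m - t - 2)) (R_factors p s C D t))))
   \<and> (2 ^ (m - 2) dvd s \<and> \<not> 2 ^ (m - 1) dvd s \<longrightarrow>
        unique_irreducible_decomposition (reduced_period_poly s \<gamma> (2 ^ m))
          (replicate_mset (2 ^ (m - 2))
             [: - qpow p s 1 2 + 2 * of_int (D 2) * qpow p s 1 4, 1 :]
         + replicate_mset (2 ^ (m - 2))
             [: - qpow p s 1 2 - 2 * of_int (D 2) * qpow p s 1 4, 1 :]
         + replicate_mset 2
             ([: qpow p s 1 2 + S_sum p s C (m - 3)
                 - 2 ^ (m - 3) * of_int (C (m - 2))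
                   * qpow p s (2 ^ (m - 3) - 1) (2 ^ (m - 2)), 1 :] ^ 2
              - [: 2 ^ (2 * (m - 2)) * of_int (D (m - 1)) ^ 2
                   * qpow p s (2 ^ (m - 2) - 1) (2 ^ (m - 2)) :])
         + {# ([: qpow p s 1 2 + S_sum p s C (m - 2), 1 :] ^ 2
               + [: 2 ^ (2 * (m - 2)) * of_int (C (m - 1)) ^ 2
                      * qpow p s (2 ^ (m - 2) - 1) (2 ^ (m - 2))
                    + 2 ^ (2 * m - 3) * of_nat q :]) ^ 2
              - [: 2 ^ (2 * (m - 1)) * of_int (C (m - 1)) ^ 2
                   * qpow p s (2 ^ (m - 2) - 1) (2 ^ (m - 2)) :]
                * [: (2 ^ (m - 2) + 1) * qpow p s 1 2 + S_sum p s C (m - 2), 1 :] ^ 2 #}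
         + (\<Sum>t=1..m - 4. repeat_mset (2 ^ (m - t - 2)) (R_factors p s C D t))))"
proof -
  interpret generated_field \<gamma> p s
    using assms by unfold_locales auto
  define v where "v = multiplicity 2 s"
  obtain k where "s = 2 ^ v * k" "\<not> 2 dvd k"
    unfolding v_def by (rule multiplicity_decompose'[of s 2]) (use s_pos in simp_all)
  then have k: "odd k" "s = 2 ^ v * k" by simp_all
  then have v: "2 ^ v dvd s" "\<not> 2 ^ Suc v dvd s" by auto
  \<comment> \<open>The odd cofactor \<open>w\<close> turns divisibility of \<open>q - 1\<close> by
    \<open>2 ^ m\<close> into a comparison of exponents; with \<open>m >= 4\<close> it also supplies
    the bound \<open>v >= 2\<close> for the next locale.\<close>
  have mv: "m \<le> v + 2"
  proof -
    obtain w where w: "odd w" "p ^ s - 1 = 2 ^ (v + 2) * w"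
      using power_minus_1_two_adic[OF assms(4) k(1), of v] k(2) by auto
    then have "2 ^ m dvd (2::nat) ^ (v + 2)"
      using assms(3,6) two_power_dvd_mult_odd by metis
    then show ?thesis by (rule power_dvd_imp_le) simp
  qed
  interpret field_5_mod_8 \<gamma> p s v
    using assms v mv by unfold_locales auto
  obtain c d sg where
    sq: "\<And>n. n \<le> v \<Longrightarrow> [c n = 1] (mod 4) \<and> \<not> int p dvd c n \<and> (c n)\<^sup>2 + (d n)\<^sup>2 = int p ^ (s div 2 ^ n)"
    and sg: "\<And>r. sg r = 1 \<or> sg r = (-1::int)" "\<And>r. 2 \<le> r \<Longrightarrow> r \<le> v \<Longrightarrow> sg r = 1"
    and G: "\<And>r. 2 \<le> r \<Longrightarrow> r \<le> v + 1 \<Longrightarrow>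
       gauss (zt r) = - of_real (of_int (sg r) * radix r) * (of_int (c (r - 1)) + of_int (d (r - 1)) * \<i>)"
    by (rule gauss_values) blast
  have CD: "signed_two_squares_rep s \<gamma> r (C r) (D r) \<and> C r = c (r - 1) \<and> \<bar>D r\<bar> = \<bar>d (r - 1)\<bar> \<and>
      (\<forall>x y. two_squares_rep p s r x y \<longrightarrow> x = C r \<and> \<bar>y\<bar> = \<bar>D r\<bar>)" if r: "2 \<le> r" "r \<le> v + 1" for r
  proof -
    have r1: "r - 1 \<le> v" "r - 1 + 1 = r" using r by auto
    obtain D' where "signed_two_squares_rep s \<gamma> r (c (r - 1)) D'" "\<bar>D'\<bar> = \<bar>d (r - 1)\<bar>"
      "CD_pair s \<gamma> r = (c (r - 1), D')"
      "\<forall>c' d'. two_squares_rep p s r c' d' \<longrightarrow> c' = c (r - 1) \<and> \<bar>d'\<bar> = \<bar>d (r - 1)\<bar>"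
      using sq[OF r1(1)] CD_pair_data[OF r1(1), of "c (r - 1)" "d (r - 1)", unfolded r1(2)] by blast
    then show ?thesis by (simp add: C D)
  qed
  interpret gauss_data \<gamma> p s v c d sg C D
    using sq sg G CD by unfold_locales auto
  have reps: "\<forall>r\<in>{2..m - 1} \<union> (if 2 ^ (m - 1) dvd s then {m} else {}).
        signed_two_squares_rep s \<gamma> r (C r) (D r) \<and>
        (\<forall>c d. two_squares_rep p s r c d \<longrightarrow> c = C r \<and> \<bar>d\<bar> = \<bar>D r\<bar>)"
  proof
    fix r assume r: "r \<in> {2..m - 1} \<union> (if 2 ^ (m - 1) dvd s then {m} else {})"
    have "m - 1 \<le> v" if "2 ^ (m - 1) dvd s"
      using that v(2) by (meson dvd_trans le_imp_power_dvd not_less_eq_eq)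
    then have "2 \<le> r" "r \<le> v + 1" using r mv assms(5) by (auto split: if_splits)
    then show "signed_two_squares_rep s \<gamma> r (C r) (D r) \<and>
        (\<forall>c d. two_squares_rep p s r c d \<longrightarrow> c = C r \<and> \<bar>d\<bar> = \<bar>D r\<bar>)"
      using CD by blast
  qed
  have le_v: "n \<le> v" if "2 ^ n dvd s" for n
    using that v(2) by (meson dvd_trans le_imp_power_dvd not_less_eq_eq)
  have ge_v: "v < n" if "\<not> 2 ^ n dvd s" for n
    using that v(1) by (meson dvd_trans le_imp_power_dvd not_less)
  show ?thesis
  proof (intro conjI impI reps, goal_cases)
    case 1
    then show ?case
      using reduced_period_poly_case_a[OF assms(5) le_v] by (simp only: linear_factors_def ac_simps)
  next
    case 2
    then have "m = v + 1" using le_v[of "m - 1"] ge_v[of m] assms(5) by simp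
    then show ?case
      using reduced_period_poly_case_b[OF assms(5)] by (simp only: linear_factors_def ac_simps)
  next
    case 3
    then have "m = v + 2" using le_v[of "m - 2"] ge_v[of "m - 1"] mv assms(5) by simp
    then show ?case
      using reduced_period_poly_case_c[OF assms(5) _ assms(3)] by (simp only: linear_factors_def ac_simps)
  qed
qed

end
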